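(* Let $R$ be a commutative ring with unit, let $(\mathfrak{g},[\cdot,\cdot])$ be a Lie algebra over $R$ and let $\sigma$ be a 2-cocycle in the trivial Lie algebra cohomology of $\mathfrak{g}$. Let $\operatorname{Sym}_\sigma(\mathfrak{g})=(\operatorname{Sym}(\mathfrak{g}),\{\cdot,\cdot\}_\sigma)$ be the associated modified Lie-Poisson algebra, let $\operatorname{Sym}(\mathfrak{g})\# U_{Lie}(\mathfrak{g})$ be the smash product algebra for the $U_{Lie}(\mathfrak{g})$-module algebra structure on $\operatorname{Sym}(\mathfrak{g})$ determined by $x\cdot a:=\{x,a\}_\sigma$ for $x\in\mathfrak{g}$, $a\in\operatorname{Sym}(\mathfrak{g})$, and let $$\alpha,\beta:\operatorname{Sym}_\sigma(\mathfrak{g})\to\operatorname{Sym}(\mathfrak{g})\# U_{Lie}(\mathfrak{g})$$ be the linear maps defined by $\alpha(a):=a\#1$ for $a\in\operatorname{Sym}(\mathfrak{g})$, and, for monomials $x_1x_2\cdots x_k$ with $x_1,\dots,x_k\in\mathfrak{g}$, by $$\beta(x_1x_2\cdots x_k):=\sum_{i=1}^k (x_1\cdots\widehat{x_i}\cdots x_k)\# x_i,$$ where the hat means that the factor is omitted. Then $(\operatorname{Sym}(\mathfrak{g})\# U_{Lie}(\mathfrak{g}),\alpha,\beta)$ is a Poisson enveloping algebra of $\operatorname{Sym}_\sigma(\mathfrak{g})$.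
   Context: All rings and associative algebras are unitary and morphisms preserve units; algebras are over $R$ and $\otimes=\otimes_R$. $U_{Lie}(\mathfrak{g})$ is the universal enveloping algebra of the Lie algebra $\mathfrak{g}$, with its standard Hopf algebra structure (elements $x$ of $\mathfrak{g}$ satisfy $\Delta(x)=1\otimes x+x\otimes1$, $\epsilon(x)=0$). 2-cocycle: a skew-symmetric (alternating) $R$-bilinear form $\sigma:\mathfrak{g}\times\mathfrak{g}\to R$ with $\sigma([x,y],z)+\sigma([y,z],x)+\sigma([z,x],y)=0$ for all $x,y,z\in\mathfrak{g}$. The bracket $\{\cdot,\cdot\}_\sigma$ on the symmetric algebra $\operatorname{Sym}(\mathfrak{g})$ is the unique biderivation with $\{x,y\}_\sigma:=[x,y]+\sigma(x,y)$ for $x,y\in\mathfrak{g}$; it makes $\operatorname{Sym}(\mathfrak{g})$ into a Poisson algebra, the modified Lie-Poisson algebra $\operatorname{Sym}_\sigma(\mathfrak{g})$. A Poisson algebra over $R$ is an $R$-module $\mathcal{A}$ with a commutative (associative, unitary) $R$-algebra structure and an $R$-Lie algebra structure $\{\cdot,\cdot\}$ such that $\{a_1a_2,a_3\}=a_1\{a_2,a_3\}+a_2\{a_1,a_3\}$ for all $a_1,a_2,a_3$. For a Hopf algebra $H$, an algebra $\mathcal{A}$ which is a left $H$-module is a left $H$-module algebra if $u\cdot(a_1a_2)=\sum_{(u)}(u_{(1)}\cdot a_1)(u_{(2)}\cdot a_2)$ and $u\cdot1=\epsilon(u)1$ (Sweedler notation). The smash product algebra $\mathcal{A}\# H$ is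 the $R$-module $\mathcal{A}\otimes H$, with elements $a\otimes u$ written $a\#u$, and with associative product $(a_1\# u)\odot(a_2\# v):=\sum_{(u)}a_1(u_{(1)}\cdot a_2)\# u_{(2)}v$ and unit $1\#1$. Here the action $x\cdot a=\{x,a\}_\sigma$ makes $\operatorname{Sym}(\mathfrak{g})$ a Lie module over $\mathfrak{g}$, hence a $U_{Lie}(\mathfrak{g})$-module, and it is a $U_{Lie}(\mathfrak{g})$-module algebra. For an algebra $U$, $U_L$ denotes $U$ viewed as a Lie algebra with the commutator bracket. A Poisson enveloping algebra of a Poisson algebra $\mathcal{A}$ is a triple $(U,\alpha,\beta)$ with $U$ an algebra, $\alpha:\mathcal{A}\to U$ an algebra morphism and $\beta:\mathcal{A}\to U_L$ a Lie algebra morphism such that for all $a_1,a_2\in\mathcal{A}$: $\alpha(\{a_1,a_2\})=\alpha(a_1)\beta(a_2)-\beta(a_2)\alpha(a_1)$ and $\beta(a_1a_2)=\alpha(a_1)\beta(a_2)+\alpha(a_2)\beta(a_1)$, and which is universal: for any algebra $U'$, algebra morphism $\alpha':\mathcal{A}\to U'$ and Lie algebra morphism $\beta':\mathcal{A}\to U'_L$ satisfying the same two identities, there is a unique algebra morphism $\gamma:U\to U'$ with $\gamma\circ\alpha=\alpha'$ and $\gamma\circ\beta=\beta'$. *)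

theory Defs
  imports "HOL-Algebra.QuotRing" "HOL-Algebra.Module"
begin

section \<open>Linear maps, algebras, Lie algebras, Poisson algebras\<close>

text \<open>
  Modules and algebras over \<open>R\<close> are records of the library type \<open>module\<close>. As in the library,
  the fields \<open>mult\<close> and \<open>one\<close> of a record that is only required to be a module carry no meaning.
  No structure is assumed to be nontrivial: the zero ring and zero algebras are allowed.
\<close>

definition linear_map ::
  "('r, 'e) ring_scheme \<Rightarrow> ('r, 'a, 'm) module_scheme \<Rightarrow> ('r, 'b, 'n) module_scheme \<Rightarrow> ('a \<Rightarrow> 'b) \<Rightarrow> bool"
  where "linear_map R M N f \<longleftrightarrow>
    f \<in> carrier M \<rightarrow> carrier N \<and>
    (\<forall>x\<in>carrier M. \<forall>y\<in>carrier M. f (x \<oplus>\<^bsub>M\<^esub> y) = f x \<oplus>\<^bsub>N\<^esub> f y) \<and>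
    (\<forall>r\<in>carrier R. \<forall>x\<in>carrier M. f (r \<odot>\<^bsub>M\<^esub> x) = r \<odot>\<^bsub>N\<^esub> f x)"

definition bilinear_map ::
  "('r, 'e) ring_scheme \<Rightarrow> ('r, 'a, 'm) module_scheme \<Rightarrow> ('r, 'b, 'n) module_scheme \<Rightarrow>
   ('r, 'c, 'p) module_scheme \<Rightarrow> ('a \<Rightarrow> 'b \<Rightarrow> 'c) \<Rightarrow> bool"
  where "bilinear_map R M N P f \<longleftrightarrow>
    (\<forall>x\<in>carrier M. linear_map R N P (\<lambda>y. f x y)) \<and>
    (\<forall>y\<in>carrier N. linear_map R M P (\<lambda>x. f x y))"

text \<open>
  Unitary associative algebras. (The library locale \<open>algebra\<close> describes the commutative ones.)
\<close>

locale assoc_algebra = module R A + ring A for R (structure) and A (structure) +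
  assumes smult_mult_left:
      "\<lbrakk>r \<in> carrier R; x \<in> carrier A; y \<in> carrier A\<rbrakk> \<Longrightarrow>
        (r \<odot>\<^bsub>A\<^esub> x) \<otimes>\<^bsub>A\<^esub> y = r \<odot>\<^bsub>A\<^esub> (x \<otimes>\<^bsub>A\<^esub> y)"
    and smult_mult_right:
      "\<lbrakk>r \<in> carrier R; x \<in> carrier A; y \<in> carrier A\<rbrakk> \<Longrightarrow>
        x \<otimes>\<^bsub>A\<^esub> (r \<odot>\<^bsub>A\<^esub> y) = r \<odot>\<^bsub>A\<^esub> (x \<otimes>\<^bsub>A\<^esub> y)"

definition algebra_hom ::
  "('r, 'e) ring_scheme \<Rightarrow> ('r, 'a, 'm) module_scheme \<Rightarrow> ('r, 'b, 'n) module_scheme \<Rightarrow> ('a \<Rightarrow> 'b) \<Rightarrow> bool"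
  where "algebra_hom R A B f \<longleftrightarrow> linear_map R A B f \<and> f \<in> ring_hom A B"

definition base_algebra :: "('r, 'e) ring_scheme \<Rightarrow> ('r, 'r) module"
  where "base_algebra R =
    \<lparr>carrier = carrier R, mult = mult R, one = \<one>\<^bsub>R\<^esub>, zero = \<zero>\<^bsub>R\<^esub>, add = add R, smult = mult R\<rparr>"

record ('r, 'a) lie = "('r, 'a) module" +
  bracket :: "'a \<Rightarrow> 'a \<Rightarrow> 'a"

definition with_bracket :: "('r, 'a) module \<Rightarrow> ('a \<Rightarrow> 'a \<Rightarrow> 'a) \<Rightarrow> ('r, 'a) lie"
  where "with_bracket M br = module.extend M (lie.fields br)"

locale lie_algebra = module R L for R (structure) and L (structure) +
  assumes bracket_bilinear: "bilinear_map R L L L (bracket L)"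
    and bracket_alternating: "x \<in> carrier L \<Longrightarrow> bracket L x x = \<zero>\<^bsub>L\<^esub>"
    and jacobi:
      "\<lbrakk>x \<in> carrier L; y \<in> carrier L; z \<in> carrier L\<rbrakk> \<Longrightarrow>
        bracket L (bracket L x y) z \<oplus>\<^bsub>L\<^esub> bracket L (bracket L y z) x
          \<oplus>\<^bsub>L\<^esub> bracket L (bracket L z x) y = \<zero>\<^bsub>L\<^esub>"

definition lie_hom ::
  "('r, 'e) ring_scheme \<Rightarrow> ('r, 'a) lie \<Rightarrow> ('r, 'b) lie \<Rightarrow> ('a \<Rightarrow> 'b) \<Rightarrow> bool"
  where "lie_hom R L K f \<longleftrightarrow> linear_map R L K f \<and>
    (\<forall>x\<in>carrier L. \<forall>y\<in>carrier L. f (bracket L x y) = bracket K (f x) (f y))"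

definition commutator_lie :: "('r, 'a) module \<Rightarrow> ('r, 'a) lie"
  where "commutator_lie A = with_bracket A (\<lambda>x y. x \<otimes>\<^bsub>A\<^esub> y \<ominus>\<^bsub>A\<^esub> y \<otimes>\<^bsub>A\<^esub> x)"

locale poisson_algebra = algebra R A + lie_algebra R A for R (structure) and A (structure) +
  assumes leibniz:
    "\<lbrakk>a\<^sub>1 \<in> carrier A; a\<^sub>2 \<in> carrier A; a\<^sub>3 \<in> carrier A\<rbrakk> \<Longrightarrow>
      bracket A (a\<^sub>1 \<otimes>\<^bsub>A\<^esub> a\<^sub>2) a\<^sub>3 = a\<^sub>1 \<otimes>\<^bsub>A\<^esub> bracket A a\<^sub>2 a\<^sub>3 \<oplus>\<^bsub>A\<^esub> a\<^sub>2 \<otimes>\<^bsub>A\<^esub> bracket A a\<^sub>1 a\<^sub>3"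

definition two_cocycle :: "('r, 'e) ring_scheme \<Rightarrow> ('r, 'g) lie \<Rightarrow> ('g \<Rightarrow> 'g \<Rightarrow> 'r) \<Rightarrow> bool"
  where "two_cocycle R \<gg> \<sigma> \<longleftrightarrow>
    bilinear_map R \<gg> \<gg> (base_algebra R) \<sigma> \<and>
    (\<forall>x\<in>carrier \<gg>. \<sigma> x x = \<zero>\<^bsub>R\<^esub>) \<and>
    (\<forall>x\<in>carrier \<gg>. \<forall>y\<in>carrier \<gg>. \<forall>z\<in>carrier \<gg>.
      \<sigma> (bracket \<gg> x y) z \<oplus>\<^bsub>R\<^esub> \<sigma> (bracket \<gg> y z) x \<oplus>\<^bsub>R\<^esub> \<sigma> (bracket \<gg> z x) y = \<zero>\<^bsub>R\<^esub>)"


section \<open>Poisson enveloping algebras\<close>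

definition poisson_enveloping_pair ::
  "('r, 'e) ring_scheme \<Rightarrow> ('r, 'a) lie \<Rightarrow> ('r, 'u) module \<Rightarrow> ('a \<Rightarrow> 'u) \<Rightarrow> ('a \<Rightarrow> 'u) \<Rightarrow> bool"
  where "poisson_enveloping_pair R A U \<alpha> \<beta> \<longleftrightarrow>
    algebra_hom R A U \<alpha> \<and> lie_hom R A (commutator_lie U) \<beta> \<and>
    (\<forall>a\<^sub>1\<in>carrier A. \<forall>a\<^sub>2\<in>carrier A.
      \<alpha> (bracket A a\<^sub>1 a\<^sub>2) = \<alpha> a\<^sub>1 \<otimes>\<^bsub>U\<^esub> \<beta> a\<^sub>2 \<ominus>\<^bsub>U\<^esub> \<beta> a\<^sub>2 \<otimes>\<^bsub>U\<^esub> \<alpha> a\<^sub>1 \<and>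
      \<beta> (a\<^sub>1 \<otimes>\<^bsub>A\<^esub> a\<^sub>2) = \<alpha> a\<^sub>1 \<otimes>\<^bsub>U\<^esub> \<beta> a\<^sub>2 \<oplus>\<^bsub>U\<^esub> \<alpha> a\<^sub>2 \<otimes>\<^bsub>U\<^esub> \<beta> a\<^sub>1)"

text \<open>
  A HOL formula cannot quantify over types, so the type \<open>'v\<close> from which the carriers of the test
  algebras \<open>V\<close> are taken is a parameter. A theorem about \<open>TYPE('v)\<close> with a type variable \<open>'v\<close> that
  occurs nowhere else covers all algebras. Uniqueness of \<open>\<gamma>\<close> is uniqueness on the carrier; this is
  why \<open>\<gamma>\<close> is taken in the extensional function space.
\<close>

definition poisson_enveloping_algebra ::
  "'v itself \<Rightarrow> ('r, 'e) ring_scheme \<Rightarrow> ('r, 'a) lie \<Rightarrow> ('r, 'u) module \<Rightarrow>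
   ('a \<Rightarrow> 'u) \<Rightarrow> ('a \<Rightarrow> 'u) \<Rightarrow> bool"
  where "poisson_enveloping_algebra (_ :: 'v itself) R A U \<alpha> \<beta> \<longleftrightarrow>
    poisson_algebra R A \<and> assoc_algebra R U \<and> poisson_enveloping_pair R A U \<alpha> \<beta> \<and>
    (\<forall>(V :: ('r, 'v) module) \<alpha>' \<beta>'.
      assoc_algebra R V \<and> poisson_enveloping_pair R A V \<alpha>' \<beta>' \<longrightarrow>
      (\<exists>!\<gamma>. \<gamma> \<in> carrier U \<rightarrow>\<^sub>E carrier V \<and> algebra_hom R U V \<gamma> \<and>
        (\<forall>a\<in>carrier A. \<gamma> (\<alpha> a) = \<alpha>' a) \<and> (\<forall>a\<in>carrier A. \<gamma> (\<beta> a) = \<beta>' a)))"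


section \<open>Free modules, quotients, tensor products\<close>

text \<open>The free module on a set \<open>S\<close>: finitely supported functions vanishing outside \<open>S\<close>.\<close>

definition free_module :: "('r, 'e) ring_scheme \<Rightarrow> 's set \<Rightarrow> ('r, 's \<Rightarrow> 'r) module"
  where "free_module R S =
    \<lparr>carrier = {p. range p \<subseteq> carrier R \<and> {s. p s \<noteq> \<zero>\<^bsub>R\<^esub>} \<subseteq> S \<and> finite {s. p s \<noteq> \<zero>\<^bsub>R\<^esub>}},
     mult = undefined, one = undefined,
     zero = (\<lambda>s. \<zero>\<^bsub>R\<^esub>), add = (\<lambda>p q s. p s \<oplus>\<^bsub>R\<^esub> q s), smult = (\<lambda>r p s. r \<otimes>\<^bsub>R\<^esub> p s)\<rparr>"

definition single :: "('r, 'e) ring_scheme \<Rightarrow> 's \<Rightarrow> 's \<Rightarrow> 'r"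
  where "single R s = (\<lambda>t. if t = s then \<one>\<^bsub>R\<^esub> else \<zero>\<^bsub>R\<^esub>)"

definition submodule_span ::
  "('r, 'e) ring_scheme \<Rightarrow> ('r, 'a, 'm) module_scheme \<Rightarrow> 'a set \<Rightarrow> 'a set"
  where "submodule_span R M S = \<Inter>{N. submodule N R M \<and> S \<subseteq> N}"

text \<open>
  The quotient of a module by a submodule, or of an algebra by an ideal: the library's quotient
  ring together with its scalar multiplication. For a mere module \<open>M\<close> the fields \<open>mult\<close> and \<open>one\<close>
  are again meaningless.
\<close>

definition quotient_module :: "('r, 'a) module \<Rightarrow> 'a set \<Rightarrow> ('r, 'a set) module"
  where "quotient_module M N =
    ring.extend (M Quot N) (module.fields (\<lambda>r X. N <+>\<^bsub>M\<^esub> ((\<lambda>x. r \<odot>\<^bsub>M\<^esub> x) ` X)))"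

definition tensor_relations ::
  "('r, 'e) ring_scheme \<Rightarrow> ('r, 'a) module \<Rightarrow> ('r, 'b) module \<Rightarrow> ('a \<times> 'b \<Rightarrow> 'r) set"
  where "tensor_relations R M N = (let F = free_module R (carrier M \<times> carrier N) in
    {single R (m \<oplus>\<^bsub>M\<^esub> m', n) \<ominus>\<^bsub>F\<^esub> (single R (m, n) \<oplus>\<^bsub>F\<^esub> single R (m', n)) | m m' n.
       m \<in> carrier M \<and> m' \<in> carrier M \<and> n \<in> carrier N} \<union>
    {single R (m, n \<oplus>\<^bsub>N\<^esub> n') \<ominus>\<^bsub>F\<^esub> (single R (m, n) \<oplus>\<^bsub>F\<^esub> single R (m, n')) | m n n'.
       m \<in> carrier M \<and> n \<in> carrier N \<and> n' \<in> carrier N} \<union>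
    {single R (r \<odot>\<^bsub>M\<^esub> m, n) \<ominus>\<^bsub>F\<^esub> r \<odot>\<^bsub>F\<^esub> single R (m, n) | r m n.
       r \<in> carrier R \<and> m \<in> carrier M \<and> n \<in> carrier N} \<union>
    {single R (m, r \<odot>\<^bsub>N\<^esub> n) \<ominus>\<^bsub>F\<^esub> r \<odot>\<^bsub>F\<^esub> single R (m, n) | r m n.
       r \<in> carrier R \<and> m \<in> carrier M \<and> n \<in> carrier N})"

definition tensor_submodule ::
  "('r, 'e) ring_scheme \<Rightarrow> ('r, 'a) module \<Rightarrow> ('r, 'b) module \<Rightarrow> ('a \<times> 'b \<Rightarrow> 'r) set"
  where "tensor_submodule R M N =
    submodule_span R (free_module R (carrier M \<times> carrier N)) (tensor_relations R M N)"

definition tensor_product ::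
  "('r, 'e) ring_scheme \<Rightarrow> ('r, 'a) module \<Rightarrow> ('r, 'b) module \<Rightarrow> ('r, ('a \<times> 'b \<Rightarrow> 'r) set) module"
  where "tensor_product R M N =
    quotient_module (free_module R (carrier M \<times> carrier N)) (tensor_submodule R M N)"

definition pure_tensor ::
  "('r, 'e) ring_scheme \<Rightarrow> ('r, 'a) module \<Rightarrow> ('r, 'b) module \<Rightarrow> 'a \<Rightarrow> 'b \<Rightarrow> ('a \<times> 'b \<Rightarrow> 'r) set"
  where "pure_tensor R M N m n =
    tensor_submodule R M N +>\<^bsub>free_module R (carrier M \<times> carrier N)\<^esub> single R (m, n)"

text \<open>
  The linear map on the tensor product of \<open>M\<close> and \<open>N\<close> induced by a bilinear map \<open>f\<close>. A Sweedler
  sum over \<open>u\<close> of the terms \<open>f u\<^sub>1 u\<^sub>2\<close> is the value of this map at the coproduct of \<open>u\<close>.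
\<close>

definition tensor_lift ::
  "('r, 'e) ring_scheme \<Rightarrow> ('r, 'a) module \<Rightarrow> ('r, 'b) module \<Rightarrow> ('r, 'c) module \<Rightarrow>
   ('a \<Rightarrow> 'b \<Rightarrow> 'c) \<Rightarrow> ('a \<times> 'b \<Rightarrow> 'r) set \<Rightarrow> 'c"
  where "tensor_lift R M N P f =
    (THE h. h \<in> carrier (tensor_product R M N) \<rightarrow>\<^sub>E carrier P \<and>
      linear_map R (tensor_product R M N) P h \<and>
      (\<forall>m\<in>carrier M. \<forall>n\<in>carrier N. h (pure_tensor R M N m n) = f m n))"

text \<open>
  The bilinear operation on the tensor product of \<open>M\<close> and \<open>N\<close> with values in \<open>P\<close> that takes the
  value \<open>f m n m' n'\<close> on the pure tensors of \<open>m, n\<close> and of \<open>m', n'\<close>.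
\<close>

definition tensor_lift2 ::
  "('r, 'e) ring_scheme \<Rightarrow> ('r, 'a) module \<Rightarrow> ('r, 'b) module \<Rightarrow> ('r, 'c) module \<Rightarrow>
   ('a \<Rightarrow> 'b \<Rightarrow> 'a \<Rightarrow> 'b \<Rightarrow> 'c) \<Rightarrow> ('a \<times> 'b \<Rightarrow> 'r) set \<Rightarrow> ('a \<times> 'b \<Rightarrow> 'r) set \<Rightarrow> 'c"
  where "tensor_lift2 R M N P f s t =
    tensor_lift R M N P (\<lambda>m n. tensor_lift R M N P (\<lambda>m' n'. f m n m' n') t) s"

definition tensor_product_algebra ::
  "('r, 'e) ring_scheme \<Rightarrow> ('r, 'a) module \<Rightarrow> ('r, 'b) module \<Rightarrow> ('r, ('a \<times> 'b \<Rightarrow> 'r) set) module"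
  where "tensor_product_algebra R A B = (tensor_product R A B)
    \<lparr>mult := tensor_lift2 R A B (tensor_product R A B)
       (\<lambda>a b a' b'. pure_tensor R A B (a \<otimes>\<^bsub>A\<^esub> a') (b \<otimes>\<^bsub>B\<^esub> b')),
     one := pure_tensor R A B \<one>\<^bsub>A\<^esub> \<one>\<^bsub>B\<^esub>\<rparr>"


section \<open>Module algebras and smash products\<close>

text \<open>
  The structure maps of the Hopf algebra \<open>H\<close> that occur below are the coproduct \<open>\<Delta>\<close> and the
  counit \<open>\<epsilon>\<close>; neither notion involves the antipode.
\<close>

definition left_module_action ::
  "('r, 'e) ring_scheme \<Rightarrow> ('r, 'h) module \<Rightarrow> ('r, 'a) module \<Rightarrow> ('h \<Rightarrow> 'a \<Rightarrow> 'a) \<Rightarrow> bool"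
  where "left_module_action R H A act \<longleftrightarrow>
    bilinear_map R H A A act \<and>
    (\<forall>a\<in>carrier A. act \<one>\<^bsub>H\<^esub> a = a) \<and>
    (\<forall>u\<in>carrier H. \<forall>v\<in>carrier H. \<forall>a\<in>carrier A. act (u \<otimes>\<^bsub>H\<^esub> v) a = act u (act v a))"

definition module_algebra_action ::
  "('r, 'e) ring_scheme \<Rightarrow> ('r, 'h) module \<Rightarrow> ('h \<Rightarrow> ('h \<times> 'h \<Rightarrow> 'r) set) \<Rightarrow> ('h \<Rightarrow> 'r) \<Rightarrow>
   ('r, 'a) module \<Rightarrow> ('h \<Rightarrow> 'a \<Rightarrow> 'a) \<Rightarrow> bool"
  where "module_algebra_action R H \<Delta> \<epsilon> A act \<longleftrightarrow>
    left_module_action R H A act \<and>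
    (\<forall>u\<in>carrier H. \<forall>a\<^sub>1\<in>carrier A. \<forall>a\<^sub>2\<in>carrier A.
      act u (a\<^sub>1 \<otimes>\<^bsub>A\<^esub> a\<^sub>2) =
        tensor_lift R H H A (\<lambda>u\<^sub>1 u\<^sub>2. act u\<^sub>1 a\<^sub>1 \<otimes>\<^bsub>A\<^esub> act u\<^sub>2 a\<^sub>2) (\<Delta> u)) \<and>
    (\<forall>u\<in>carrier H. act u \<one>\<^bsub>A\<^esub> = \<epsilon> u \<odot>\<^bsub>A\<^esub> \<one>\<^bsub>A\<^esub>)"

definition smash_product ::
  "('r, 'e) ring_scheme \<Rightarrow> ('r, 'a) module \<Rightarrow> ('r, 'h) module \<Rightarrow> ('h \<Rightarrow> ('h \<times> 'h \<Rightarrow> 'r) set) \<Rightarrow>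
   ('h \<Rightarrow> 'a \<Rightarrow> 'a) \<Rightarrow> ('r, ('a \<times> 'h \<Rightarrow> 'r) set) module"
  where "smash_product R A H \<Delta> act = (tensor_product R A H)
    \<lparr>mult := tensor_lift2 R A H (tensor_product R A H)
       (\<lambda>a\<^sub>1 u a\<^sub>2 v. tensor_lift R H H (tensor_product R A H)
          (\<lambda>u\<^sub>1 u\<^sub>2. pure_tensor R A H (a\<^sub>1 \<otimes>\<^bsub>A\<^esub> act u\<^sub>1 a\<^sub>2) (u\<^sub>2 \<otimes>\<^bsub>H\<^esub> v)) (\<Delta> u)),
     one := pure_tensor R A H \<one>\<^bsub>A\<^esub> \<one>\<^bsub>H\<^esub>\<rparr>"


section \<open>Tensor, symmetric and universal enveloping algebras\<close>

text \<open>The free associative algebra on \<open>S\<close>: linear combinations of words, with concatenation.\<close>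

definition free_algebra :: "('r, 'e) ring_scheme \<Rightarrow> 's set \<Rightarrow> ('r, 's list \<Rightarrow> 'r) module"
  where "free_algebra R S = (free_module R (lists S))
    \<lparr>mult := (\<lambda>p q w. \<Oplus>\<^bsub>R\<^esub>i\<in>{..length w}. p (take i w) \<otimes>\<^bsub>R\<^esub> q (drop i w)),
     one := single R []\<rparr>"

text \<open>
  The tensor algebra of \<open>M\<close> as the free algebra on the underlying set of \<open>M\<close> modulo the relations
  making the inclusion of generators linear. In degree \<open>n\<close> the ideal consists of the relations of
  multilinearity between words of length \<open>n\<close>, so this is the direct sum of the tensor powers of \<open>M\<close>.
\<close>

definition linearity_ideal ::
  "('r, 'e) ring_scheme \<Rightarrow> ('r, 'g, 'm) module_scheme \<Rightarrow> ('g list \<Rightarrow> 'r) set"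
  where "linearity_ideal R M = (let F = free_algebra R (carrier M) in
    Idl\<^bsub>F\<^esub> ({single R [x \<oplus>\<^bsub>M\<^esub> y] \<ominus>\<^bsub>F\<^esub> (single R [x] \<oplus>\<^bsub>F\<^esub> single R [y]) | x y.
               x \<in> carrier M \<and> y \<in> carrier M} \<union>
            {single R [r \<odot>\<^bsub>M\<^esub> x] \<ominus>\<^bsub>F\<^esub> r \<odot>\<^bsub>F\<^esub> single R [x] | r x.
               r \<in> carrier R \<and> x \<in> carrier M}))"

definition tensor_algebra ::
  "('r, 'e) ring_scheme \<Rightarrow> ('r, 'g, 'm) module_scheme \<Rightarrow> ('r, ('g list \<Rightarrow> 'r) set) module"
  where "tensor_algebra R M = quotient_module (free_algebra R (carrier M)) (linearity_ideal R M)"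

definition tensor_gen ::
  "('r, 'e) ring_scheme \<Rightarrow> ('r, 'g, 'm) module_scheme \<Rightarrow> 'g \<Rightarrow> ('g list \<Rightarrow> 'r) set"
  where "tensor_gen R M x = linearity_ideal R M +>\<^bsub>free_algebra R (carrier M)\<^esub> single R [x]"

definition Sym_ideal ::
  "('r, 'e) ring_scheme \<Rightarrow> ('r, 'g, 'm) module_scheme \<Rightarrow> ('g list \<Rightarrow> 'r) set set"
  where "Sym_ideal R M = (let T = tensor_algebra R M; t = tensor_gen R M in
    Idl\<^bsub>T\<^esub> {t x \<otimes>\<^bsub>T\<^esub> t y \<ominus>\<^bsub>T\<^esub> t y \<otimes>\<^bsub>T\<^esub> t x | x y. x \<in> carrier M \<and> y \<in> carrier M})"

definition Sym ::
  "('r, 'e) ring_scheme \<Rightarrow> ('r, 'g, 'm) module_scheme \<Rightarrow> ('r, ('g list \<Rightarrow> 'r) set set) module"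
  where "Sym R M = quotient_module (tensor_algebra R M) (Sym_ideal R M)"

definition Sym_gen ::
  "('r, 'e) ring_scheme \<Rightarrow> ('r, 'g, 'm) module_scheme \<Rightarrow> 'g \<Rightarrow> ('g list \<Rightarrow> 'r) set set"
  where "Sym_gen R M x = Sym_ideal R M +>\<^bsub>tensor_algebra R M\<^esub> tensor_gen R M x"

definition Sym_monomial ::
  "('r, 'e) ring_scheme \<Rightarrow> ('r, 'g, 'm) module_scheme \<Rightarrow> 'g list \<Rightarrow> ('g list \<Rightarrow> 'r) set set"
  where "Sym_monomial R M xs = foldr (\<lambda>x p. Sym_gen R M x \<otimes>\<^bsub>Sym R M\<^esub> p) xs \<one>\<^bsub>Sym R M\<^esub>"

definition ULie_ideal :: "('r, 'e) ring_scheme \<Rightarrow> ('r, 'g) lie \<Rightarrow> ('g list \<Rightarrow> 'r) set set"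
  where "ULie_ideal R \<gg> = (let T = tensor_algebra R \<gg>; t = tensor_gen R \<gg> in
    Idl\<^bsub>T\<^esub> {(t x \<otimes>\<^bsub>T\<^esub> t y \<ominus>\<^bsub>T\<^esub> t y \<otimes>\<^bsub>T\<^esub> t x) \<ominus>\<^bsub>T\<^esub> t (bracket \<gg> x y) | x y.
            x \<in> carrier \<gg> \<and> y \<in> carrier \<gg>})"

definition ULie :: "('r, 'e) ring_scheme \<Rightarrow> ('r, 'g) lie \<Rightarrow> ('r, ('g list \<Rightarrow> 'r) set set) module"
  where "ULie R \<gg> = quotient_module (tensor_algebra R \<gg>) (ULie_ideal R \<gg>)"

definition ULie_gen :: "('r, 'e) ring_scheme \<Rightarrow> ('r, 'g) lie \<Rightarrow> 'g \<Rightarrow> ('g list \<Rightarrow> 'r) set set"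
  where "ULie_gen R \<gg> x = ULie_ideal R \<gg> +>\<^bsub>tensor_algebra R \<gg>\<^esub> tensor_gen R \<gg> x"

definition ULie_comult ::
  "('r, 'e) ring_scheme \<Rightarrow> ('r, 'g) lie \<Rightarrow> ('g list \<Rightarrow> 'r) set set \<Rightarrow>
   (('g list \<Rightarrow> 'r) set set \<times> ('g list \<Rightarrow> 'r) set set \<Rightarrow> 'r) set"
  where "ULie_comult R \<gg> = (let U = ULie R \<gg>; UU = tensor_product_algebra R U U in
    THE \<Delta>. \<Delta> \<in> carrier U \<rightarrow>\<^sub>E carrier UU \<and> algebra_hom R U UU \<Delta> \<and>
      (\<forall>x\<in>carrier \<gg>. \<Delta> (ULie_gen R \<gg> x) =
        pure_tensor R U U \<one>\<^bsub>U\<^esub> (ULie_gen R \<gg> x) \<oplus>\<^bsub>UU\<^esub> pure_tensor R U U (ULie_gen R \<gg> x) \<one>\<^bsub>U\<^esub>))"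

definition ULie_counit :: "('r, 'e) ring_scheme \<Rightarrow> ('r, 'g) lie \<Rightarrow> ('g list \<Rightarrow> 'r) set set \<Rightarrow> 'r"
  where "ULie_counit R \<gg> = (let U = ULie R \<gg> in
    THE \<epsilon>. \<epsilon> \<in> carrier U \<rightarrow>\<^sub>E carrier R \<and> algebra_hom R U (base_algebra R) \<epsilon> \<and>
      (\<forall>x\<in>carrier \<gg>. \<epsilon> (ULie_gen R \<gg> x) = \<zero>\<^bsub>R\<^esub>))"


section \<open>The modified Lie-Poisson algebra and its smash product\<close>

definition biderivation ::
  "('r, 'e) ring_scheme \<Rightarrow> ('r, 'a) module \<Rightarrow> ('a \<Rightarrow> 'a \<Rightarrow> 'a) \<Rightarrow> bool"
  where "biderivation R A d \<longleftrightarrow>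
    bilinear_map R A A A d \<and>
    (\<forall>a\<in>carrier A. \<forall>b\<in>carrier A. \<forall>c\<in>carrier A.
      d (a \<otimes>\<^bsub>A\<^esub> b) c = a \<otimes>\<^bsub>A\<^esub> d b c \<oplus>\<^bsub>A\<^esub> b \<otimes>\<^bsub>A\<^esub> d a c \<and>
      d c (a \<otimes>\<^bsub>A\<^esub> b) = a \<otimes>\<^bsub>A\<^esub> d c b \<oplus>\<^bsub>A\<^esub> b \<otimes>\<^bsub>A\<^esub> d c a)"

definition lie_poisson_bracket ::
  "('r, 'e) ring_scheme \<Rightarrow> ('r, 'g) lie \<Rightarrow> ('g \<Rightarrow> 'g \<Rightarrow> 'r) \<Rightarrow>
   ('g list \<Rightarrow> 'r) set set \<Rightarrow> ('g list \<Rightarrow> 'r) set set \<Rightarrow> ('g list \<Rightarrow> 'r) set set"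
  where "lie_poisson_bracket R \<gg> \<sigma> = (let S = Sym R \<gg> in
    THE d. d \<in> carrier S \<rightarrow>\<^sub>E carrier S \<rightarrow>\<^sub>E carrier S \<and> biderivation R S d \<and>
      (\<forall>x\<in>carrier \<gg>. \<forall>y\<in>carrier \<gg>.
        d (Sym_gen R \<gg> x) (Sym_gen R \<gg> y) = Sym_gen R \<gg> (bracket \<gg> x y) \<oplus>\<^bsub>S\<^esub> \<sigma> x y \<odot>\<^bsub>S\<^esub> \<one>\<^bsub>S\<^esub>))"

definition Sym_poisson ::
  "('r, 'e) ring_scheme \<Rightarrow> ('r, 'g) lie \<Rightarrow> ('g \<Rightarrow> 'g \<Rightarrow> 'r) \<Rightarrow> ('r, ('g list \<Rightarrow> 'r) set set) lie"
  where "Sym_poisson R \<gg> \<sigma> = with_bracket (Sym R \<gg>) (lie_poisson_bracket R \<gg> \<sigma>)"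

definition Sym_action ::
  "('r, 'e) ring_scheme \<Rightarrow> ('r, 'g) lie \<Rightarrow> ('g \<Rightarrow> 'g \<Rightarrow> 'r) \<Rightarrow>
   ('g list \<Rightarrow> 'r) set set \<Rightarrow> ('g list \<Rightarrow> 'r) set set \<Rightarrow> ('g list \<Rightarrow> 'r) set set"
  where "Sym_action R \<gg> \<sigma> = (let S = Sym R \<gg>; U = ULie R \<gg> in
    THE act. act \<in> carrier U \<rightarrow>\<^sub>E carrier S \<rightarrow>\<^sub>E carrier S \<and>
      module_algebra_action R U (ULie_comult R \<gg>) (ULie_counit R \<gg>) S act \<and>
      (\<forall>x\<in>carrier \<gg>. \<forall>a\<in>carrier S.
        act (ULie_gen R \<gg> x) a = lie_poisson_bracket R \<gg> \<sigma> (Sym_gen R \<gg> x) a))"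

definition Sym_smash_ULie ::
  "('r, 'e) ring_scheme \<Rightarrow> ('r, 'g) lie \<Rightarrow> ('g \<Rightarrow> 'g \<Rightarrow> 'r) \<Rightarrow>
   ('r, (('g list \<Rightarrow> 'r) set set \<times> ('g list \<Rightarrow> 'r) set set \<Rightarrow> 'r) set) module"
  where "Sym_smash_ULie R \<gg> \<sigma> =
    smash_product R (Sym R \<gg>) (ULie R \<gg>) (ULie_comult R \<gg>) (Sym_action R \<gg> \<sigma>)"

definition smash_alpha ::
  "('r, 'e) ring_scheme \<Rightarrow> ('r, 'g) lie \<Rightarrow> ('g list \<Rightarrow> 'r) set set \<Rightarrow>
   (('g list \<Rightarrow> 'r) set set \<times> ('g list \<Rightarrow> 'r) set set \<Rightarrow> 'r) set"
  where "smash_alpha R \<gg> a = pure_tensor R (Sym R \<gg>) (ULie R \<gg>) a \<one>\<^bsub>ULie R \<gg>\<^esub>"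

definition smash_beta ::
  "('r, 'e) ring_scheme \<Rightarrow> ('r, 'g) lie \<Rightarrow> ('g \<Rightarrow> 'g \<Rightarrow> 'r) \<Rightarrow> ('g list \<Rightarrow> 'r) set set \<Rightarrow>
   (('g list \<Rightarrow> 'r) set set \<times> ('g list \<Rightarrow> 'r) set set \<Rightarrow> 'r) set"
  where "smash_beta R \<gg> \<sigma> = (let S = Sym R \<gg>; U = ULie R \<gg>; W = Sym_smash_ULie R \<gg> \<sigma> in
    THE \<beta>. \<beta> \<in> carrier S \<rightarrow>\<^sub>E carrier W \<and> linear_map R S W \<beta> \<and>
      (\<forall>xs\<in>lists (carrier \<gg>). \<beta> (Sym_monomial R \<gg> xs) =
        (\<Oplus>\<^bsub>W\<^esub>i\<in>{..<length xs}.
          pure_tensor R S U (Sym_monomial R \<gg> (take i xs @ drop (Suc i) xs)) (ULie_gen R \<gg> (xs ! i)))))"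

end

theory Submission
  imports Defs
begin

text \<open>
  Write \<open>S\<close> for the symmetric algebra, \<open>U\<close> for the enveloping algebra and \<open>W = S # U\<close> for the smash product.
  The idea is that \<open>W\<close> is generated by two copies of known objects, \<open>a # \<one>\<close> with \<open>a\<close> in \<open>S\<close> and \<open>\<one> # x\<close> with \<open>x\<close>
  in the Lie algebra, and that its product is determined by two rules:
  \<open>(a # \<one>) (b # v) = ab # v\<close> and \<open>(\<one> # x) (b # v) = {x, b} # v + b # xv\<close>
  (\<open>W_mult_Sym\<close>, \<open>W_mult_gen\<close>). The second one comes from the coproduct, \<open>x\<close> being primitive and acting on
  \<open>S\<close> by the derivation \<open>{x, \<cdot>}\<close>. The same two rules are what a pair \<open>(\<alpha>', \<beta>')\<close> into another
  algebra \<open>V\<close> has to obey: \<open>\<alpha>'\<close> is multiplicative, and \<open>\<beta>'(x) \<alpha>'(b) = \<alpha>'({x, b}) + \<alpha>'(b) \<beta>'(x)\<close>. Hence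
  \<open>a # u \<mapsto> \<alpha>'(a) B(u)\<close> is a homomorphism, where \<open>B\<close> is the extension of \<open>\<beta>'\<close> from the Lie algebra to \<open>U\<close>; this
  extension exists because \<open>\<beta>'\<close> kills constants, so that the cocycle disappears from \<open>\<beta>'({x, y})\<close>. It is
  the only possible homomorphism, because it is prescribed on generators (\<open>smash_universal_exists\<close>,
  \<open>smash_universal_unique\<close>).

  That \<open>W\<close> is associative is also seen on generators: the elements that associate with all pairs to their right
  are closed under sums and products, and the two rules show that the generators are among them
  (\<open>left_nucleus_mult\<close>, \<open>left_nucleus_gen\<close>).

  Most facts about \<open>S\<close> and \<open>\<beta>\<close> rest on one principle: a derivation from \<open>S\<close> into an \<open>S\<close>-module is determined
  by its values on the Lie algebra, and these may be prescribed by any linear map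
  (\<open>derivation_eq\<close>, \<open>Sym_derivation_exists\<close>). It gives the derivations \<open>{x, \<cdot>}\<close>, then by extension in the other
  argument the bracket, and then its skew-symmetry and the Jacobi identity, which hold because they hold on
  generators and are identities between derivations. The map \<open>\<beta>\<close> is the derivation \<open>S \<rightarrow> W\<close> with
  \<open>\<beta>(x) = \<one> # x\<close>, for the action of \<open>S\<close> on \<open>W\<close> through \<open>\<alpha>\<close>; the sum over omitted factors is the Leibniz rule for
  a monomial. The identities for commutators of \<open>\<alpha>\<close> and \<open>\<beta>\<close> again propagate from generators.

  The constructions themselves are used only through their universal properties. Those of \<open>S\<close> and \<open>U\<close> follow from
  the free algebra by passing to quotients. The coproduct of \<open>U\<close>, and its action on \<open>S\<close>, come from the universal
  property of \<open>U\<close>, applied to the algebras \<open>U \<otimes> U\<close> and \<open>End(S)\<close>. Since words are built by multiplication with one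
  letter at a time from the left, the inductive step of an induction over \<open>U\<close> requires of the coproduct only
  its value at products \<open>xu\<close> with \<open>x\<close> in the Lie algebra (\<open>sweedler_mult_gen\<close>).
\<close>

section \<open>Linear maps and generators of algebras\<close>

lemma linear_mapI:
  assumes "\<And>x. x \<in> carrier M \<Longrightarrow> f x \<in> carrier N"
    and "\<And>x y. x \<in> carrier M \<Longrightarrow> y \<in> carrier M \<Longrightarrow> f (x \<oplus>\<^bsub>M\<^esub> y) = f x \<oplus>\<^bsub>N\<^esub> f y"
    and "\<And>r x. r \<in> carrier R \<Longrightarrow> x \<in> carrier M \<Longrightarrow> f (r \<odot>\<^bsub>M\<^esub> x) = r \<odot>\<^bsub>N\<^esub> f x"
  shows "linear_map R M N f"
  using assms by (simp add: linear_map_def)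

lemma linear_mapD:
  assumes "linear_map R M N f"
  shows linear_map_closed: "x \<in> carrier M \<Longrightarrow> f x \<in> carrier N"
    and linear_map_add: "x \<in> carrier M \<Longrightarrow> y \<in> carrier M \<Longrightarrow> f (x \<oplus>\<^bsub>M\<^esub> y) = f x \<oplus>\<^bsub>N\<^esub> f y"
    and linear_map_smult: "r \<in> carrier R \<Longrightarrow> x \<in> carrier M \<Longrightarrow> f (r \<odot>\<^bsub>M\<^esub> x) = r \<odot>\<^bsub>N\<^esub> f x"
  using assms by (auto simp: linear_map_def)

lemma linear_map_zero:
  assumes "module R M" "module R N" "linear_map R M N f"
  shows "f \<zero>\<^bsub>M\<^esub> = \<zero>\<^bsub>N\<^esub>"
proof -
  interpret M: module R M by fact
  interpret N: module R N by fact
  have "f (\<zero>\<^bsub>R\<^esub> \<odot>\<^bsub>M\<^esub> \<zero>\<^bsub>M\<^esub>) = \<zero>\<^bsub>R\<^esub> \<odot>\<^bsub>N\<^esub> f \<zero>\<^bsub>M\<^esub>"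
    by (intro linear_map_smult[OF assms(3)]) auto
  then show ?thesis using linear_map_closed[OF assms(3)] by simp
qed

lemma linear_map_a_inv:
  assumes "module R M" "module R N" "linear_map R M N f" "x \<in> carrier M"
  shows "f (\<ominus>\<^bsub>M\<^esub> x) = \<ominus>\<^bsub>N\<^esub> f x"
proof -
  interpret M: module R M by fact
  interpret N: module R N by fact
  have "f ((\<ominus>\<^bsub>R\<^esub> \<one>\<^bsub>R\<^esub>) \<odot>\<^bsub>M\<^esub> x) = (\<ominus>\<^bsub>R\<^esub> \<one>\<^bsub>R\<^esub>) \<odot>\<^bsub>N\<^esub> f x"
    using linear_map_smult[OF assms(3)] assms(4) by simp
  then show ?thesis using linear_map_closed[OF assms(3,4)] assms(4)
    by (simp add: M.smult_l_minus N.smult_l_minus)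
qed

lemma linear_map_minus:
  assumes "module R M" "module R N" "linear_map R M N f" "x \<in> carrier M" "y \<in> carrier M"
  shows "f (x \<ominus>\<^bsub>M\<^esub> y) = f x \<ominus>\<^bsub>N\<^esub> f y"
proof -
  interpret M: module R M by fact
  show ?thesis
    using assms(4,5) linear_map_add[OF assms(3)] linear_map_a_inv[OF assms(1-3)]
    by (simp add: a_minus_def)
qed

lemma linear_map_comp:
  assumes "linear_map R M N f" "linear_map R N P g"
  shows "linear_map R M P (\<lambda>x. g (f x))"
  using assms by (auto simp: linear_map_def Pi_iff)

lemma linear_map_cong:
  assumes "module R M" "\<And>x. x \<in> carrier M \<Longrightarrow> f x = g x"
  shows "linear_map R M N f \<longleftrightarrow> linear_map R M N g"
proof -
  interpret M: module R M by fact
  show ?thesis using assms(2) by (auto simp: linear_map_def Pi_iff)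
qed

lemma bilinear_mapD:
  assumes "bilinear_map R M N P f"
  shows bilinear_map_left: "y \<in> carrier N \<Longrightarrow> linear_map R M P (\<lambda>x. f x y)"
    and bilinear_map_right: "x \<in> carrier M \<Longrightarrow> linear_map R N P (f x)"
  using assms by (auto simp: bilinear_map_def)

lemma bilinear_mapE:
  assumes "bilinear_map R M N P f" "x \<in> carrier M" "y \<in> carrier N"
  shows bilinear_map_closed: "f x y \<in> carrier P"
    and bilinear_map_add_left: "x' \<in> carrier M \<Longrightarrow> f (x \<oplus>\<^bsub>M\<^esub> x') y = f x y \<oplus>\<^bsub>P\<^esub> f x' y"
    and bilinear_map_add_right: "y' \<in> carrier N \<Longrightarrow> f x (y \<oplus>\<^bsub>N\<^esub> y') = f x y \<oplus>\<^bsub>P\<^esub> f x y'"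
    and bilinear_map_smult_left: "r \<in> carrier R \<Longrightarrow> f (r \<odot>\<^bsub>M\<^esub> x) y = r \<odot>\<^bsub>P\<^esub> f x y"
    and bilinear_map_smult_right: "r \<in> carrier R \<Longrightarrow> f x (r \<odot>\<^bsub>N\<^esub> y) = r \<odot>\<^bsub>P\<^esub> f x y"
  using assms by (auto simp: bilinear_map_def linear_map_def)

lemma bilinear_mapI:
  assumes "\<And>x y. x \<in> carrier M \<Longrightarrow> y \<in> carrier N \<Longrightarrow> f x y \<in> carrier P"
    and "\<And>x x' y. x \<in> carrier M \<Longrightarrow> x' \<in> carrier M \<Longrightarrow> y \<in> carrier N \<Longrightarrow>
      f (x \<oplus>\<^bsub>M\<^esub> x') y = f x y \<oplus>\<^bsub>P\<^esub> f x' y"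
    and "\<And>x y y'. x \<in> carrier M \<Longrightarrow> y \<in> carrier N \<Longrightarrow> y' \<in> carrier N \<Longrightarrow>
      f x (y \<oplus>\<^bsub>N\<^esub> y') = f x y \<oplus>\<^bsub>P\<^esub> f x y'"
    and "\<And>r x y. r \<in> carrier R \<Longrightarrow> x \<in> carrier M \<Longrightarrow> y \<in> carrier N \<Longrightarrow>
      f (r \<odot>\<^bsub>M\<^esub> x) y = r \<odot>\<^bsub>P\<^esub> f x y"
    and "\<And>r x y. r \<in> carrier R \<Longrightarrow> x \<in> carrier M \<Longrightarrow> y \<in> carrier N \<Longrightarrow>
      f x (r \<odot>\<^bsub>N\<^esub> y) = r \<odot>\<^bsub>P\<^esub> f x y"
  shows "bilinear_map R M N P f"
  using assms by (simp add: bilinear_map_def linear_map_def)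

lemma (in assoc_algebra) assoc_algebra_simps [simp]:
  shows "module R A" "ring A" "cring R"
  by unfold_locales

lemma (in assoc_algebra) mult_bilinear: "bilinear_map R A A A (\<otimes>\<^bsub>A\<^esub>)"
  by (intro bilinear_mapI) (auto simp: smult_mult_left smult_mult_right l_distr r_distr)

lemma assoc_algebraI:
  assumes "module R A" "monoid A" "bilinear_map R A A A (\<otimes>\<^bsub>A\<^esub>)"
  shows "assoc_algebra R A"
proof -
  interpret module R A by fact
  note b = bilinear_mapE[OF assms(3)]
  have "ring A"
    using assms(2) b by (intro ringI M.abelian_group_axioms) auto
  then show ?thesis using b assms(1)
    by (auto intro!: assoc_algebra.intro assoc_algebra_axioms.intro)
qed

text \<open>
  The hypothesis of the inductions by which homomorphisms and derivations are compared: an algebra is generated by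
  \<open>X\<close> as soon as linear combinations of \<open>\<one>\<close> and left multiplications by elements of \<open>X\<close> reach
  everything. Asking for left multiplications only, instead of closure under all products, makes
  the inductive step cheap, and costs nothing because words can be built letter by letter.
\<close>

definition generates ::
  "('r, 'e) ring_scheme \<Rightarrow> ('r, 'a, 'm) module_scheme \<Rightarrow> 'a set \<Rightarrow> bool"
  where "generates R A X \<longleftrightarrow> X \<subseteq> carrier A \<and>
    (\<forall>N. submodule N R A \<and> \<one>\<^bsub>A\<^esub> \<in> N \<and> (\<forall>x\<in>X. \<forall>a\<in>N. x \<otimes>\<^bsub>A\<^esub> a \<in> N) \<longrightarrow> N = carrier A)"

lemma submodule_CollectI:
  assumes "module R M" "P \<zero>\<^bsub>M\<^esub>"
    and "\<And>a b. \<lbrakk>a \<in> carrier M; b \<in> carrier M; P a; P b\<rbrakk> \<Longrightarrow> P (a \<oplus>\<^bsub>M\<^esub> b)"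
    and "\<And>r a. \<lbrakk>r \<in> carrier R; a \<in> carrier M; P a\<rbrakk> \<Longrightarrow> P (r \<odot>\<^bsub>M\<^esub> a)"
  shows "submodule {a \<in> carrier M. P a} R M"
proof -
  interpret module R M by fact
  have "P (\<ominus>\<^bsub>M\<^esub> a)" if "a \<in> carrier M" "P a" for a
    using assms(4)[of "\<ominus>\<^bsub>R\<^esub> \<one>\<^bsub>R\<^esub>" a] that by (simp add: smult_l_minus)
  then show ?thesis using assms by (intro submoduleI) auto
qed

lemma generates_induct [consumes 3, case_names one mult add smult]:
  assumes A: "assoc_algebra R A" and g: "generates R A X" and a: "a \<in> carrier A"
    and one: "P \<one>\<^bsub>A\<^esub>"
    and mult: "\<And>x a. \<lbrakk>x \<in> X; x \<in> carrier A; a \<in> carrier A; P a\<rbrakk> \<Longrightarrow> P (x \<otimes>\<^bsub>A\<^esub> a)"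
    and add: "\<And>a b. \<lbrakk>a \<in> carrier A; b \<in> carrier A; P a; P b\<rbrakk> \<Longrightarrow> P (a \<oplus>\<^bsub>A\<^esub> b)"
    and smult: "\<And>r a. \<lbrakk>r \<in> carrier R; a \<in> carrier A; P a\<rbrakk> \<Longrightarrow> P (r \<odot>\<^bsub>A\<^esub> a)"
  shows "P a"
proof -
  interpret assoc_algebra R A by fact
  have "P \<zero>\<^bsub>A\<^esub>" using smult[of "\<zero>\<^bsub>R\<^esub>", OF _ _ one] by simp
  then have "submodule {a \<in> carrier A. P a} R A"
    using add smult by (intro submodule_CollectI) auto
  moreover have "X \<subseteq> carrier A" using g by (simp add: generates_def)
  ultimately have "{a \<in> carrier A. P a} = carrier A"
    using g[unfolded generates_def, THEN conjunct2, rule_format, of "{a \<in> carrier A. P a}"]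
      one mult by auto
  then show ?thesis using a by auto
qed

lemma algebra_homD:
  assumes "algebra_hom R A B f"
  shows algebra_hom_linear: "linear_map R A B f"
    and algebra_hom_one: "f \<one>\<^bsub>A\<^esub> = \<one>\<^bsub>B\<^esub>"
    and algebra_hom_mult: "x \<in> carrier A \<Longrightarrow> y \<in> carrier A \<Longrightarrow> f (x \<otimes>\<^bsub>A\<^esub> y) = f x \<otimes>\<^bsub>B\<^esub> f y"
  using assms by (auto simp: algebra_hom_def ring_hom_def)

lemma algebra_homI:
  assumes "linear_map R A B f" "f \<one>\<^bsub>A\<^esub> = \<one>\<^bsub>B\<^esub>"
    and "\<And>x y. x \<in> carrier A \<Longrightarrow> y \<in> carrier A \<Longrightarrow> f (x \<otimes>\<^bsub>A\<^esub> y) = f x \<otimes>\<^bsub>B\<^esub> f y"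
  shows "algebra_hom R A B f"
  using assms by (auto simp: algebra_hom_def ring_hom_def linear_map_def)

lemma algebra_hom_comp:
  assumes "algebra_hom R A B f" "algebra_hom R B C g"
  shows "algebra_hom R A C (\<lambda>x. g (f x))"
  using assms linear_map_closed[OF algebra_hom_linear[OF assms(1)]]
  by (intro algebra_homI linear_map_comp[of R A B f C g])
    (auto simp: algebra_homD)

lemma generates_image:
  assumes A: "assoc_algebra R A" and B: "assoc_algebra R B" and g: "generates R A X"
    and f: "algebra_hom R A B f" and surj: "f ` carrier A = carrier B"
  shows "generates R B (f ` X)"
proof -
  interpret A: assoc_algebra R A by fact
  interpret B: assoc_algebra R B by fact
  have X: "X \<subseteq> carrier A" using g by (simp add: generates_def)
  have "N = carrier B" if N: "submodule N R B" and one: "\<one>\<^bsub>B\<^esub> \<in> N"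
    and mult: "\<forall>x\<in>f ` X. \<forall>a\<in>N. x \<otimes>\<^bsub>B\<^esub> a \<in> N" for N
  proof -
    note sub = B.submoduleE[OF N]
    have "f a \<in> N" if "a \<in> carrier A" for a
      using A g that
    proof (induction a rule: generates_induct)
      case one then show ?case using \<open>\<one>\<^bsub>B\<^esub> \<in> N\<close> algebra_hom_one[OF f] by simp
    next
      case (mult x a) then show ?case
        using \<open>\<forall>x\<in>f ` X. \<forall>a\<in>N. x \<otimes>\<^bsub>B\<^esub> a \<in> N\<close> algebra_hom_mult[OF f] by simp
    next
      case (add a b) then show ?case
        using sub(5) linear_map_add[OF algebra_hom_linear[OF f]] by simp
    next
      case (smult r a) then show ?case
        using sub(4) linear_map_smult[OF algebra_hom_linear[OF f]] by simp
    qed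
    then have "f ` carrier A \<subseteq> N" by auto
    then show ?thesis using sub(1) surj by simp
  qed
  then show ?thesis using X surj by (auto simp: generates_def)
qed

lemma algebra_hom_unique:
  assumes A: "assoc_algebra R A" and g: "generates R A X"
    and f: "algebra_hom R A B f" and h: "algebra_hom R A B h"
    and eq: "\<And>x. x \<in> X \<Longrightarrow> f x = h x" and a: "a \<in> carrier A"
  shows "f a = h a"
  using A g a
proof (induction a rule: generates_induct)
  case one then show ?case using f h by (simp add: algebra_hom_one)
next
  case (mult x a) then show ?case using f h eq by (simp add: algebra_hom_mult)
next
  case (add a b) then show ?case
    using f[THEN algebra_hom_linear] h[THEN algebra_hom_linear] by (simp add: linear_map_add)
next
  case (smult r a) then show ?case
    using f[THEN algebra_hom_linear] h[THEN algebra_hom_linear] by (simp add: linear_map_smult)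
qed

text \<open>
  By induction, what commutes with the generators commutes with everything. This applies first to the generators
  themselves and then to an arbitrary element.
\<close>

lemma generates_comm:
  assumes A: "assoc_algebra R A" and g: "generates R A X"
    and comm: "\<And>x y. \<lbrakk>x \<in> X; y \<in> X\<rbrakk> \<Longrightarrow> x \<otimes>\<^bsub>A\<^esub> y = y \<otimes>\<^bsub>A\<^esub> x"
    and a: "a \<in> carrier A" and b: "b \<in> carrier A"
  shows "a \<otimes>\<^bsub>A\<^esub> b = b \<otimes>\<^bsub>A\<^esub> a"
proof -
  interpret assoc_algebra R A by fact
  have step: "a \<otimes>\<^bsub>A\<^esub> y = y \<otimes>\<^bsub>A\<^esub> a"
    if y: "y \<in> carrier A" and gen: "\<And>x. x \<in> X \<Longrightarrow> x \<otimes>\<^bsub>A\<^esub> y = y \<otimes>\<^bsub>A\<^esub> x"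
      and a: "a \<in> carrier A" for y a
    using A g a
  proof (induction a rule: generates_induct)
    case (mult x a)
    have "x \<otimes>\<^bsub>A\<^esub> a \<otimes>\<^bsub>A\<^esub> y = x \<otimes>\<^bsub>A\<^esub> y \<otimes>\<^bsub>A\<^esub> a" using mult y by (simp add: m_assoc)
    also have "\<dots> = y \<otimes>\<^bsub>A\<^esub> (x \<otimes>\<^bsub>A\<^esub> a)" using mult y gen by (simp add: m_assoc)
    finally show ?case .
  qed (use y in \<open>auto simp: l_distr r_distr smult_mult_left smult_mult_right\<close>)
  have X: "X \<subseteq> carrier A" using g by (simp add: generates_def)
  have "x \<otimes>\<^bsub>A\<^esub> b = b \<otimes>\<^bsub>A\<^esub> x" if "x \<in> X" for x
    using step[of x b] X comm that b by (simp add: subset_eq)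
  then show ?thesis by (rule step[OF b _ a])
qed

section \<open>Free modules and quotients\<close>

lemma free_module_simps [simp]:
  "zero (free_module R S) = (\<lambda>s. \<zero>\<^bsub>R\<^esub>)"
  "add (free_module R S) = (\<lambda>p q s. p s \<oplus>\<^bsub>R\<^esub> q s)"
  "smult (free_module R S) = (\<lambda>r p s. r \<otimes>\<^bsub>R\<^esub> p s)"
  by (simp_all add: free_module_def)

lemma free_module_carrier:
  "p \<in> carrier (free_module R S) \<longleftrightarrow>
    (\<forall>s. p s \<in> carrier R) \<and> {s. p s \<noteq> \<zero>\<^bsub>R\<^esub>} \<subseteq> S \<and> finite {s. p s \<noteq> \<zero>\<^bsub>R\<^esub>}"
  by (auto simp: free_module_def)

lemma module_free_module:
  assumes "cring R"
  shows "module R (free_module R S)"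
proof -
  interpret cring R by fact
  let ?F = "free_module R S"
  have closed: "(\<lambda>s. p s \<oplus>\<^bsub>R\<^esub> q s) \<in> carrier ?F" if "p \<in> carrier ?F" "q \<in> carrier ?F" for p q
  proof -
    have "{s. p s \<oplus>\<^bsub>R\<^esub> q s \<noteq> \<zero>\<^bsub>R\<^esub>} \<subseteq> {s. p s \<noteq> \<zero>\<^bsub>R\<^esub>} \<union> {s. q s \<noteq> \<zero>\<^bsub>R\<^esub>}" by auto
    then show ?thesis using that unfolding free_module_carrier
      by (auto intro: finite_subset)
  qed
  have smult: "(\<lambda>s. r \<otimes>\<^bsub>R\<^esub> p s) \<in> carrier ?F" if "p \<in> carrier ?F" "r \<in> carrier R" for p r
  proof -
    have "{s. r \<otimes>\<^bsub>R\<^esub> p s \<noteq> \<zero>\<^bsub>R\<^esub>} \<subseteq> {s. p s \<noteq> \<zero>\<^bsub>R\<^esub>}" using that by auto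
    then show ?thesis using that unfolding free_module_carrier
      by (auto intro: finite_subset)
  qed
  have inv: "\<exists>y\<in>carrier ?F. (\<lambda>s. y s \<oplus>\<^bsub>R\<^esub> p s) = (\<lambda>s. \<zero>\<^bsub>R\<^esub>)" if "p \<in> carrier ?F" for p
    using that smult[of p "\<ominus>\<^bsub>R\<^esub> \<one>\<^bsub>R\<^esub>"]
    by (intro bexI[of _ "\<lambda>s. (\<ominus>\<^bsub>R\<^esub> \<one>\<^bsub>R\<^esub>) \<otimes>\<^bsub>R\<^esub> p s"])
       (auto simp: free_module_carrier l_minus l_neg)
  have zero: "(\<lambda>s. \<zero>\<^bsub>R\<^esub>) \<in> carrier ?F" by (simp add: free_module_carrier)
  have "abelian_group ?F"
    using closed inv zero
    by (intro abelian_groupI) (auto simp: free_module_carrier a_ac intro!: ext)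
  then show ?thesis
    using smult by (intro moduleI assms)
      (auto simp: free_module_carrier l_distr r_distr m_assoc intro!: ext)
qed

lemma single_closed:
  assumes "cring R" "s \<in> S"
  shows "single R s \<in> carrier (free_module R S)"
proof -
  interpret cring R by fact
  have "{t. single R s t \<noteq> \<zero>\<^bsub>R\<^esub>} \<subseteq> {s}" by (auto simp: single_def)
  then show ?thesis using assms
    by (auto simp: free_module_carrier single_def intro: finite_subset)
qed

text \<open>
  Induction on the size of the support, removing one basis element at a time.
\<close>

lemma free_module_induct [consumes 2, case_names zero step]:
  assumes R: "cring R" and p: "p \<in> carrier (free_module R S)"
    and zero: "P (\<lambda>s. \<zero>\<^bsub>R\<^esub>)"
    and step: "\<And>r s p. \<lbrakk>r \<in> carrier R; s \<in> S; p \<in> carrier (free_module R S); P p\<rbrakk> \<Longrightarrow>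
      P (r \<odot>\<^bsub>free_module R S\<^esub> single R s \<oplus>\<^bsub>free_module R S\<^esub> p)"
  shows "P p"
proof -
  interpret cring R by fact
  have "\<forall>p \<in> carrier (free_module R S). {s. p s \<noteq> \<zero>\<^bsub>R\<^esub>} \<subseteq> A \<longrightarrow> P p" if "finite A" for A
    using that
  proof induction
    case empty
    have "p = (\<lambda>s. \<zero>\<^bsub>R\<^esub>)" if "{s. p s \<noteq> \<zero>\<^bsub>R\<^esub>} \<subseteq> {}" for p using that by auto
    then show ?case using zero by blast
  next
    case (insert x A)
    show ?case
    proof (intro ballI impI)
      fix p assume p: "p \<in> carrier (free_module R S)" and sub: "{s. p s \<noteq> \<zero>\<^bsub>R\<^esub>} \<subseteq> insert x A"
      show "P p"
      proof (cases "p x = \<zero>\<^bsub>R\<^esub>")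
        case True then show ?thesis using insert p sub by blast
      next
        case False
        let ?q = "p(x := \<zero>\<^bsub>R\<^esub>)"
        have sq: "{s. ?q s \<noteq> \<zero>\<^bsub>R\<^esub>} \<subseteq> {s. p s \<noteq> \<zero>\<^bsub>R\<^esub>}" by auto
        have q: "?q \<in> carrier (free_module R S)"
          using p sq finite_subset[OF sq] by (auto simp: free_module_carrier)
        have "{s. ?q s \<noteq> \<zero>\<^bsub>R\<^esub>} \<subseteq> A" using sub by auto
        then have "P ?q" using insert.IH q by blast
        moreover have "x \<in> S" "p x \<in> carrier R" using False p by (auto simp: free_module_carrier)
        ultimately have
          "P (p x \<odot>\<^bsub>free_module R S\<^esub> single R x \<oplus>\<^bsub>free_module R S\<^esub> ?q)"
          using step q by blast
        moreover have "p x \<odot>\<^bsub>free_module R S\<^esub> single R x \<oplus>\<^bsub>free_module R S\<^esub> ?q = p"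
          using p by (auto simp: single_def free_module_carrier)
        ultimately show ?thesis by simp
      qed
    qed
  qed
  then show ?thesis using p by (auto simp: free_module_carrier)
qed

lemma free_module_universal:
  assumes R: "cring R" and P: "module R P" and f: "f \<in> S \<rightarrow> carrier P"
  obtains h where "linear_map R (free_module R S) P h" "\<And>s. s \<in> S \<Longrightarrow> h (single R s) = f s"
proof -
  interpret P: module R P by fact
  define h where "h p = (\<Oplus>\<^bsub>P\<^esub>s\<in>{s. p s \<noteq> \<zero>\<^bsub>R\<^esub>}. p s \<odot>\<^bsub>P\<^esub> f s)" for p
  let ?F = "free_module R S"
  have h: "h p = (\<Oplus>\<^bsub>P\<^esub>s\<in>A. p s \<odot>\<^bsub>P\<^esub> f s)"
    if "p \<in> carrier ?F" "{s. p s \<noteq> \<zero>\<^bsub>R\<^esub>} \<subseteq> A" "A \<subseteq> S" "finite A" for p A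
    unfolding h_def using that f
    by (intro P.add.finprod_mono_neutral_cong_left) (auto simp: free_module_carrier Pi_iff)
  have lin: "linear_map R ?F P h"
  proof (rule linear_mapI)
    fix p assume p: "p \<in> carrier ?F"
    then show "h p \<in> carrier P" unfolding h_def using f
      by (intro P.finsum_closed) (auto simp: free_module_carrier Pi_iff)
    fix q assume q: "q \<in> carrier ?F"
    let ?A = "{s. p s \<noteq> \<zero>\<^bsub>R\<^esub>} \<union> {s. q s \<noteq> \<zero>\<^bsub>R\<^esub>}"
    have A: "finite ?A" "?A \<subseteq> S" using p q by (auto simp: free_module_carrier)
    have pq: "p \<oplus>\<^bsub>?F\<^esub> q \<in> carrier ?F" 
      using module_free_module[OF R] p q by (meson abelian_groupE(1) module_def)
    have pq_supp: "{s. p s \<oplus>\<^bsub>R\<^esub> q s \<noteq> \<zero>\<^bsub>R\<^esub>} \<subseteq> ?A"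
      using P.R.zero_closed by auto
    have "h (p \<oplus>\<^bsub>?F\<^esub> q) = (\<Oplus>\<^bsub>P\<^esub>s\<in>?A. (p s \<oplus>\<^bsub>R\<^esub> q s) \<odot>\<^bsub>P\<^esub> f s)"
      using h[OF pq _ A(2,1)] pq_supp by simp
    also have "\<dots> = (\<Oplus>\<^bsub>P\<^esub>s\<in>?A. p s \<odot>\<^bsub>P\<^esub> f s \<oplus>\<^bsub>P\<^esub> q s \<odot>\<^bsub>P\<^esub> f s)"
      using p q f A by (intro P.finsum_cong') (auto simp: free_module_carrier P.smult_l_distr Pi_iff subset_eq)
    also have "\<dots> = h p \<oplus>\<^bsub>P\<^esub> h q"
      using p q f A h[OF p _ A(2,1)] h[OF q _ A(2,1)]
      by (subst P.finsum_addf) (auto simp: free_module_carrier Pi_iff subset_eq)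
    finally show "h (p \<oplus>\<^bsub>?F\<^esub> q) = h p \<oplus>\<^bsub>P\<^esub> h q" .
  next
    fix r p assume r: "r \<in> carrier R" and p: "p \<in> carrier ?F"
    let ?A = "{s. p s \<noteq> \<zero>\<^bsub>R\<^esub>}"
    have A: "finite ?A" "?A \<subseteq> S" using p by (auto simp: free_module_carrier)
    have rp: "r \<odot>\<^bsub>?F\<^esub> p \<in> carrier ?F" 
      using module_free_module[OF R] p r by (meson module.smult_closed)
    have rp_supp: "{s. r \<otimes>\<^bsub>R\<^esub> p s \<noteq> \<zero>\<^bsub>R\<^esub>} \<subseteq> ?A" using r by auto
    have "h (r \<odot>\<^bsub>?F\<^esub> p) = (\<Oplus>\<^bsub>P\<^esub>s\<in>?A. (r \<otimes>\<^bsub>R\<^esub> p s) \<odot>\<^bsub>P\<^esub> f s)"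
      using h[OF rp _ A(2,1)] rp_supp by simp
    also have "\<dots> = (\<Oplus>\<^bsub>P\<^esub>s\<in>?A. r \<odot>\<^bsub>P\<^esub> (p s \<odot>\<^bsub>P\<^esub> f s))"
      using p r f A by (intro P.finsum_cong') (auto simp: free_module_carrier P.smult_assoc1 Pi_iff subset_eq)
    also have "\<dots> = r \<odot>\<^bsub>P\<^esub> h p"
      unfolding h_def using p f A r
      by (subst P.finsum_smult_ldistr) (auto simp: free_module_carrier Pi_iff subset_eq)
    finally show "h (r \<odot>\<^bsub>?F\<^esub> p) = r \<odot>\<^bsub>P\<^esub> h p" .
  qed
  have "h (single R s) = f s" if s: "s \<in> S" for s
  proof -
    have "h (single R s) = (\<Oplus>\<^bsub>P\<^esub>t\<in>{s}. single R s t \<odot>\<^bsub>P\<^esub> f t)"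
      using s by (intro h single_closed R) (auto simp: single_def)
    also have "\<dots> = f s" using s f by (auto simp: single_def Pi_iff)
    finally show ?thesis .
  qed
  with lin show thesis by (rule that)
qed

lemma quotient_module_simps:
  "carrier (quotient_module M N) = (\<lambda>x. N +>\<^bsub>M\<^esub> x) ` carrier M"
  "zero (quotient_module M N) = N"
  "add (quotient_module M N) = set_add M"
  "mult (quotient_module M N) = rcoset_mult M N"
  "one (quotient_module M N) = N +>\<^bsub>M\<^esub> \<one>\<^bsub>M\<^esub>"
  "smult (quotient_module M N) = (\<lambda>r X. N <+>\<^bsub>M\<^esub> ((\<lambda>x. r \<odot>\<^bsub>M\<^esub> x) ` X))"
  by (auto simp: quotient_module_def ring.defs module.defs FactRing_def A_RCOSETS_def'
      a_r_coset_def')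

context
  fixes R :: "('r, 'e) ring_scheme" and M :: "('r, 'a) module" and N :: "'a set"
  assumes M: "module R M" and N: "submodule N R M"
begin

interpretation M: module R M by (rule M)

interpretation N: abelian_subgroup N M
  using N M.abelian_group_axioms
  by (intro abelian_subgroupI3 additive_subgroup.intro) (auto simp: submodule_def)

lemma coset_add:
  "\<lbrakk>x \<in> carrier M; y \<in> carrier M\<rbrakk> \<Longrightarrow>
    (N +>\<^bsub>M\<^esub> x) \<oplus>\<^bsub>quotient_module M N\<^esub> (N +>\<^bsub>M\<^esub> y) = N +>\<^bsub>M\<^esub> (x \<oplus>\<^bsub>M\<^esub> y)"
  by (simp add: quotient_module_simps N.a_rcos_sum)

lemma coset_smult:
  assumes r: "r \<in> carrier R" and x: "x \<in> carrier M"
  shows "r \<odot>\<^bsub>quotient_module M N\<^esub> (N +>\<^bsub>M\<^esub> x) = N +>\<^bsub>M\<^esub> (r \<odot>\<^bsub>M\<^esub> x)"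
proof -
  have rN: "r \<odot>\<^bsub>M\<^esub> n \<in> N" if "n \<in> N" for n using submodule.smult_closed[OF N r that] .
  have c: "n \<in> carrier M" if "n \<in> N" for n using that N.a_subset by auto
  have "n \<oplus>\<^bsub>M\<^esub> r \<odot>\<^bsub>M\<^esub> (m \<oplus>\<^bsub>M\<^esub> x) \<in> N +>\<^bsub>M\<^esub> (r \<odot>\<^bsub>M\<^esub> x)" if "n \<in> N" "m \<in> N" for n m
  proof -
    have "n \<oplus>\<^bsub>M\<^esub> r \<odot>\<^bsub>M\<^esub> (m \<oplus>\<^bsub>M\<^esub> x) = (n \<oplus>\<^bsub>M\<^esub> r \<odot>\<^bsub>M\<^esub> m) \<oplus>\<^bsub>M\<^esub> r \<odot>\<^bsub>M\<^esub> x"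
      using that r x by (simp add: M.smult_r_distr M.a_assoc c)
    then show ?thesis using that rN by (auto simp: a_r_coset_def')
  qed
  moreover have "n \<oplus>\<^bsub>M\<^esub> r \<odot>\<^bsub>M\<^esub> x \<in> N <+>\<^bsub>M\<^esub> ((\<lambda>x. r \<odot>\<^bsub>M\<^esub> x) ` (N +>\<^bsub>M\<^esub> x))" if "n \<in> N" for n
    using that N.a_rcos_self[OF x] by (auto simp: set_add_def')
  ultimately have "N <+>\<^bsub>M\<^esub> ((\<lambda>x. r \<odot>\<^bsub>M\<^esub> x) ` (N +>\<^bsub>M\<^esub> x)) = N +>\<^bsub>M\<^esub> (r \<odot>\<^bsub>M\<^esub> x)"
    unfolding set_add_def' a_r_coset_def' by blast
  then show ?thesis by (simp add: quotient_module_simps)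
qed

lemma coset_eq_iff:
  "\<lbrakk>x \<in> carrier M; y \<in> carrier M\<rbrakk> \<Longrightarrow> N +>\<^bsub>M\<^esub> x = N +>\<^bsub>M\<^esub> y \<longleftrightarrow> x \<ominus>\<^bsub>M\<^esub> y \<in> N"
  by (metis N.a_rcos_self N.a_repr_independence' N.a_rcos_module_minus M.abelian_group_axioms N.a_rcos_module
     M.minus_eq)

lemma coset_zero: "N +>\<^bsub>M\<^esub> \<zero>\<^bsub>M\<^esub> = \<zero>\<^bsub>quotient_module M N\<^esub>"
  by (simp add: quotient_module_simps N.a_subset)

lemma coset_closed: "x \<in> carrier M \<Longrightarrow> N +>\<^bsub>M\<^esub> x \<in> carrier (quotient_module M N)"
  by (simp add: quotient_module_simps)

lemma quotient_module_cases:
  assumes "X \<in> carrier (quotient_module M N)"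
  obtains x where "x \<in> carrier M" "X = N +>\<^bsub>M\<^esub> x"
  using assms by (auto simp: quotient_module_simps)

lemma module_quotient_module: "module R (quotient_module M N)"
proof (rule moduleI)
  let ?Q = "quotient_module M N"
  show "cring R" by (rule M.R.is_cring)
  show "abelian_group ?Q"
  proof (rule abelian_groupI)
    fix X assume "X \<in> carrier ?Q"
    then obtain x where "x \<in> carrier M" "X = N +>\<^bsub>M\<^esub> x" by (rule quotient_module_cases)
    then show "\<exists>Y\<in>carrier ?Q. Y \<oplus>\<^bsub>?Q\<^esub> X = \<zero>\<^bsub>?Q\<^esub>"
      by (intro bexI[of _ "N +>\<^bsub>M\<^esub> (\<ominus>\<^bsub>M\<^esub> x)"]) (auto simp: coset_add coset_closed M.l_neg coset_zero)
  qed (auto simp: coset_add coset_closed M.a_ac coset_zero[symmetric] elim!: quotient_module_cases)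
qed (auto simp: coset_add coset_smult coset_closed M.smult_l_distr M.smult_r_distr M.smult_assoc1
    elim!: quotient_module_cases)

lemma coset_linear: "linear_map R M (quotient_module M N) (\<lambda>x. N +>\<^bsub>M\<^esub> x)"
  by (intro linear_mapI) (auto simp: coset_add coset_smult coset_closed)

lemma quotient_module_factor:
  assumes P: "module R P" and f: "linear_map R M P f" and van: "\<And>n. n \<in> N \<Longrightarrow> f n = \<zero>\<^bsub>P\<^esub>"
  obtains h where "linear_map R (quotient_module M N) P h"
    "\<And>x. x \<in> carrier M \<Longrightarrow> h (N +>\<^bsub>M\<^esub> x) = f x"
proof -
  interpret P: module R P by fact
  define h where "h X = f (SOME x. x \<in> carrier M \<and> X = N +>\<^bsub>M\<^esub> x)" for X
  have h_coset: "h (N +>\<^bsub>M\<^esub> x) = f x" if x: "x \<in> carrier M" for x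
  proof -
    let ?y = "SOME y. y \<in> carrier M \<and> N +>\<^bsub>M\<^esub> x = N +>\<^bsub>M\<^esub> y"
    have y: "?y \<in> carrier M \<and> N +>\<^bsub>M\<^esub> x = N +>\<^bsub>M\<^esub> ?y" by (rule someI) (use x in auto)
    then have "x \<ominus>\<^bsub>M\<^esub> ?y \<in> N" using coset_eq_iff x by blast
    then have "f x \<ominus>\<^bsub>P\<^esub> f ?y = \<zero>\<^bsub>P\<^esub>"
      using van y x linear_map_minus[OF M P f] by metis
    then show ?thesis
      unfolding h_def using linear_map_closed[OF f] x y by (simp add: P.add.inv_solve_right' P.minus_eq)
  qed
  have "linear_map R (quotient_module M N) P h"
    by (intro linear_mapI)
      (auto simp: coset_add coset_smult h_coset linear_mapD[OF f] elim!: quotient_module_cases)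
  then show thesis using h_coset by (rule that)
qed

end

lemma ideal_submodule:
  assumes A: "assoc_algebra R A" and I: "ideal I A"
  shows "submodule I R A"
proof -
  interpret A: assoc_algebra R A by fact
  interpret I: ideal I A by fact
  have "r \<odot>\<^bsub>A\<^esub> x \<in> I" if "r \<in> carrier R" "x \<in> I" for r x
    using I.I_l_closed[OF that(2), of "r \<odot>\<^bsub>A\<^esub> \<one>\<^bsub>A\<^esub>"] that by (simp add: A.smult_mult_left)
  then show ?thesis
    using I.a_subset by (intro A.submoduleI) auto
qed

lemma submodule_ideal:
  assumes A: "assoc_algebra R A" and I: "submodule I R A"
    and "\<And>x a. \<lbrakk>x \<in> I; a \<in> carrier A\<rbrakk> \<Longrightarrow> a \<otimes>\<^bsub>A\<^esub> x \<in> I"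
    and "\<And>x a. \<lbrakk>x \<in> I; a \<in> carrier A\<rbrakk> \<Longrightarrow> x \<otimes>\<^bsub>A\<^esub> a \<in> I"
  shows "ideal I A"
proof -
  interpret assoc_algebra R A by fact
  show ?thesis using I assms(3,4) by (intro idealI) (auto simp: submodule_def)
qed

lemma quotient_algebra:
  assumes A: "assoc_algebra R A" and I: "ideal I A"
  shows assoc_algebra_quotient: "assoc_algebra R (quotient_module A I)"
    and coset_algebra_hom: "algebra_hom R A (quotient_module A I) (\<lambda>x. I +>\<^bsub>A\<^esub> x)"
proof -
  interpret A: assoc_algebra R A by fact
  interpret I: ideal I A by fact
  let ?Q = "quotient_module A I"
  have sub: "submodule I R A" by (rule ideal_submodule[OF A I])
  note M = A.module_axioms
  note [simp] = coset_add[OF M sub] coset_smult[OF M sub] coset_closed[OF M sub]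
  have mult [simp]: "(I +>\<^bsub>A\<^esub> x) \<otimes>\<^bsub>?Q\<^esub> (I +>\<^bsub>A\<^esub> y) = I +>\<^bsub>A\<^esub> (x \<otimes>\<^bsub>A\<^esub> y)"
    if "x \<in> carrier A" "y \<in> carrier A" for x y
    using that by (simp add: quotient_module_simps I.rcoset_mult_add)
  have one: "\<one>\<^bsub>?Q\<^esub> = I +>\<^bsub>A\<^esub> \<one>\<^bsub>A\<^esub>" by (simp add: quotient_module_simps)
  have "monoid ?Q"
    by (rule monoidI) (auto simp: one A.m_assoc elim!: quotient_module_cases[OF M sub])
  moreover have "bilinear_map R ?Q ?Q ?Q (\<otimes>\<^bsub>?Q\<^esub>)"
    by (rule bilinear_mapI)
      (auto simp: A.l_distr A.r_distr A.smult_mult_left A.smult_mult_right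
        elim!: quotient_module_cases[OF M sub])
  ultimately show "assoc_algebra R ?Q"
    by (intro assoc_algebraI module_quotient_module M sub)
  show "algebra_hom R A ?Q (\<lambda>x. I +>\<^bsub>A\<^esub> x)"
    by (intro algebra_homI coset_linear M sub) (auto simp: one)
qed

lemma quotient_algebra_factor:
  assumes A: "assoc_algebra R A" and B: "assoc_algebra R B" and X: "X \<subseteq> carrier A"
    and f: "algebra_hom R A B f" and van: "\<And>x. x \<in> X \<Longrightarrow> f x = \<zero>\<^bsub>B\<^esub>"
  obtains h where "algebra_hom R (quotient_module A (Idl\<^bsub>A\<^esub> X)) B h"
    "\<And>a. a \<in> carrier A \<Longrightarrow> h (Idl\<^bsub>A\<^esub> X +>\<^bsub>A\<^esub> a) = f a"
proof -
  interpret A: assoc_algebra R A by fact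
  interpret B: assoc_algebra R B by fact
  let ?I = "Idl\<^bsub>A\<^esub> X" and ?Q = "quotient_module A (Idl\<^bsub>A\<^esub> X)"
  have I: "ideal ?I A" by (rule A.genideal_ideal[OF X])
  note sub = ideal_submodule[OF A I]
  note lin = algebra_hom_linear[OF f]
  have "ideal {a \<in> carrier A. f a = \<zero>\<^bsub>B\<^esub>} A"
    using linear_mapD[OF lin] linear_map_zero[OF _ _ lin] algebra_hom_mult[OF f]
    by (intro submodule_ideal[OF A] submodule_CollectI) auto
  then have "?I \<subseteq> {a \<in> carrier A. f a = \<zero>\<^bsub>B\<^esub>}"
    by (rule A.genideal_minimal) (use X van in auto)
  then obtain h where h: "linear_map R ?Q B h" "\<And>a. a \<in> carrier A \<Longrightarrow> h (?I +>\<^bsub>A\<^esub> a) = f a"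
    using quotient_module_factor[OF A.module_axioms sub B.module_axioms lin] by blast
  note \<pi> = coset_algebra_hom[OF A I]
  have "algebra_hom R ?Q B h"
    using h algebra_homD[OF f] algebra_hom_mult[OF \<pi>, symmetric] algebra_hom_one[OF \<pi>, symmetric]
    by (intro algebra_homI) (auto elim!: quotient_module_cases[OF A.module_axioms sub])
  then show thesis using h(2) by (rule that)
qed

lemma generates_quotient:
  assumes A: "assoc_algebra R A" and I: "ideal I A" and g: "generates R A X"
  shows "generates R (quotient_module A I) ((\<lambda>x. I +>\<^bsub>A\<^esub> x) ` X)"
  by (rule generates_image[OF A assoc_algebra_quotient[OF A I] g coset_algebra_hom[OF A I]])
    (simp add: quotient_module_simps)

section \<open>Free, tensor, symmetric and universal enveloping algebras\<close>

lemma module_cong: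
  assumes "module R M" "carrier M' = carrier M" "zero M' = zero M" "add M' = add M"
    "smult M' = smult M"
  shows "module R M'"
proof -
  interpret module R M by fact
  have "\<exists>y\<in>carrier M. y \<oplus>\<^bsub>M\<^esub> x = \<zero>\<^bsub>M\<^esub>" if "x \<in> carrier M" for x
    using that M.l_neg by blast
  then have "abelian_group M'"
    by (intro abelian_groupI) (auto simp: assms M.a_ac)
  then show ?thesis
    by (intro moduleI R.is_cring) (auto simp: assms smult_l_distr smult_r_distr smult_assoc1)
qed

lemma free_algebra_simps [simp]:
  "carrier (free_algebra R S) = carrier (free_module R (lists S))"
  "zero (free_algebra R S) = (\<lambda>s. \<zero>\<^bsub>R\<^esub>)"
  "add (free_algebra R S) = (\<lambda>p q s. p s \<oplus>\<^bsub>R\<^esub> q s)"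
  "smult (free_algebra R S) = (\<lambda>r p s. r \<otimes>\<^bsub>R\<^esub> p s)"
  "one (free_algebra R S) = single R []"
  by (simp_all add: free_algebra_def)

lemma free_algebra_mult:
  "p \<otimes>\<^bsub>free_algebra R S\<^esub> q = (\<lambda>w. \<Oplus>\<^bsub>R\<^esub>i\<in>{..length w}. p (take i w) \<otimes>\<^bsub>R\<^esub> q (drop i w))"
  by (simp add: free_algebra_def)

lemma module_free_algebra: "cring R \<Longrightarrow> module R (free_algebra R S)"
  by (rule module_cong[OF module_free_module]) simp_all

lemma free_module_linear_eq:
  assumes R: "cring R" and P: "module R P"
    and f: "linear_map R (free_module R S) P f" and h: "linear_map R (free_module R S) P h"
    and eq: "\<And>s. s \<in> S \<Longrightarrow> f (single R s) = h (single R s)"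
    and p: "p \<in> carrier (free_module R S)"
  shows "f p = h p"
proof -
  let ?F = "free_module R S"
  note F = module_free_module[OF R, of S]
  show ?thesis
    using R p
  proof (induction p rule: free_module_induct)
    case zero
    show ?case using linear_map_zero[OF F P f] linear_map_zero[OF F P h] by simp
  next
    case (step r s p)
    have s: "single R s \<in> carrier ?F" by (rule single_closed[OF R step(2)])
    have rs: "r \<odot>\<^bsub>?F\<^esub> single R s \<in> carrier ?F" by (rule module.smult_closed[OF F step(1) s])
    show ?case
      unfolding linear_map_add[OF f rs step(3)] linear_map_add[OF h rs step(3)]
        linear_map_smult[OF f step(1) s] linear_map_smult[OF h step(1) s]
      using eq step by simp
  qed
qed

lemma free_algebra_mult_bilinear:
  assumes R: "cring R"
  shows "bilinear_map R (free_algebra R S) (free_algebra R S) (free_algebra R S)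
    (\<otimes>\<^bsub>free_algebra R S\<^esub>)"
proof -
  interpret R: cring R by fact
  let ?A = "free_algebra R S"
  have c: "p w \<in> carrier R" if "p \<in> carrier ?A" for p w
    using that by (simp add: free_module_carrier)
  note [simp] = c[simplified]
  have closed: "p \<otimes>\<^bsub>?A\<^esub> q \<in> carrier ?A" if p: "p \<in> carrier ?A" and q: "q \<in> carrier ?A" for p q
  proof -
    let ?P = "{w. p w \<noteq> \<zero>\<^bsub>R\<^esub>}" and ?Q = "{w. q w \<noteq> \<zero>\<^bsub>R\<^esub>}"
    let ?PQ = "(\<lambda>(u, v). u @ v) ` (?P \<times> ?Q)"
    have PQ: "w \<in> ?PQ" if "(p \<otimes>\<^bsub>?A\<^esub> q) w \<noteq> \<zero>\<^bsub>R\<^esub>" for w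
    proof -
      have "\<exists>i\<in>{..length w}. p (take i w) \<otimes>\<^bsub>R\<^esub> q (drop i w) \<noteq> \<zero>\<^bsub>R\<^esub>"
      proof (rule ccontr)
        assume "\<not> ?thesis"
        then have "(p \<otimes>\<^bsub>?A\<^esub> q) w = (\<Oplus>\<^bsub>R\<^esub>i\<in>{..length w}. \<zero>\<^bsub>R\<^esub>)"
          unfolding free_algebra_mult by (intro R.finsum_cong') auto
        with that show False by simp
      qed
      then obtain i where "p (take i w) \<otimes>\<^bsub>R\<^esub> q (drop i w) \<noteq> \<zero>\<^bsub>R\<^esub>" by blast
      then have "p (take i w) \<noteq> \<zero>\<^bsub>R\<^esub>" "q (drop i w) \<noteq> \<zero>\<^bsub>R\<^esub>" using p q by auto
      then show ?thesis by (intro image_eqI[of _ _ "(take i w, drop i w)"]) auto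
    qed
    have fin: "finite ?P" "finite ?Q" "?P \<subseteq> lists S" "?Q \<subseteq> lists S"
      using p q by (auto simp: free_module_carrier)
    have "finite ?PQ" using fin by auto
    moreover have "?PQ \<subseteq> lists S" using fin(3,4) by (fastforce simp: subset_eq)
    moreover have "{w. (p \<otimes>\<^bsub>?A\<^esub> q) w \<noteq> \<zero>\<^bsub>R\<^esub>} \<subseteq> ?PQ" using PQ by blast
    ultimately have "finite {w. (p \<otimes>\<^bsub>?A\<^esub> q) w \<noteq> \<zero>\<^bsub>R\<^esub>}" "{w. (p \<otimes>\<^bsub>?A\<^esub> q) w \<noteq> \<zero>\<^bsub>R\<^esub>} \<subseteq> lists S"
      by (meson finite_subset, meson subset_trans)
    moreover have "(p \<otimes>\<^bsub>?A\<^esub> q) w \<in> carrier R" for w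
      unfolding free_algebra_mult using p q by (intro R.finsum_closed) auto
    ultimately show ?thesis by (simp add: free_module_carrier)
  qed
  show ?thesis
    using closed
  proof (rule bilinear_mapI)
    fix p p' q assume "p \<in> carrier ?A" "p' \<in> carrier ?A" "q \<in> carrier ?A"
    then show "(p \<oplus>\<^bsub>?A\<^esub> p') \<otimes>\<^bsub>?A\<^esub> q = p \<otimes>\<^bsub>?A\<^esub> q \<oplus>\<^bsub>?A\<^esub> p' \<otimes>\<^bsub>?A\<^esub> q"
      by (intro ext) (simp add: free_algebra_mult Pi_iff R.l_distr R.finsum_addf)
  next
    fix p q q' assume "p \<in> carrier ?A" "q \<in> carrier ?A" "q' \<in> carrier ?A"
    then show "p \<otimes>\<^bsub>?A\<^esub> (q \<oplus>\<^bsub>?A\<^esub> q') = p \<otimes>\<^bsub>?A\<^esub> q \<oplus>\<^bsub>?A\<^esub> p \<otimes>\<^bsub>?A\<^esub> q'"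
      by (intro ext) (simp add: free_algebra_mult Pi_iff R.r_distr R.finsum_addf)
  next
    fix r p q assume "r \<in> carrier R" "p \<in> carrier ?A" "q \<in> carrier ?A"
    then show "(r \<odot>\<^bsub>?A\<^esub> p) \<otimes>\<^bsub>?A\<^esub> q = r \<odot>\<^bsub>?A\<^esub> (p \<otimes>\<^bsub>?A\<^esub> q)"
      by (intro ext) (simp add: free_algebra_mult Pi_iff R.m_assoc R.finsum_rdistr)
  next
    fix r p q assume "r \<in> carrier R" "p \<in> carrier ?A" "q \<in> carrier ?A"
    then show "p \<otimes>\<^bsub>?A\<^esub> (r \<odot>\<^bsub>?A\<^esub> q) = r \<odot>\<^bsub>?A\<^esub> (p \<otimes>\<^bsub>?A\<^esub> q)"
      by (intro ext) (simp add: free_algebra_mult Pi_iff R.m_lcomm R.finsum_rdistr)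
  qed
qed

lemma free_algebra_single_mult:
  assumes R: "cring R"
  shows "single R u \<otimes>\<^bsub>free_algebra R S\<^esub> single R v = single R (u @ v)"
proof
  interpret R: cring R by fact
  fix w
  have "(\<Oplus>\<^bsub>R\<^esub>i\<in>{..length w}. single R u (take i w) \<otimes>\<^bsub>R\<^esub> single R v (drop i w)) =
    (\<Oplus>\<^bsub>R\<^esub>i\<in>{..length w}. if length u = i then single R (u @ v) w else \<zero>\<^bsub>R\<^esub>)"
  proof (intro R.finsum_cong' refl)
    fix i assume i: "i \<in> {..length w}"
    have "w = u @ v \<longleftrightarrow> take i w = u \<and> drop i w = v" if "length u = i"
      using that by (metis append_eq_conv_conj append_take_drop_id)
    moreover have "take i w \<noteq> u" if "length u \<noteq> i" using that i by auto
    ultimately show "single R u (take i w) \<otimes>\<^bsub>R\<^esub> single R v (drop i w) =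
      (if length u = i then single R (u @ v) w else \<zero>\<^bsub>R\<^esub>)"
      by (auto simp: single_def)
  qed (auto simp: single_def)
  also have "\<dots> = single R (u @ v) w"
  proof (cases "length u \<le> length w")
    case True
    then show ?thesis
      by (intro R.finsum_singleton) (auto simp: single_def)
  next
    case False
    then have "(\<Oplus>\<^bsub>R\<^esub>i\<in>{..length w}. if length u = i then single R (u @ v) w else \<zero>\<^bsub>R\<^esub>)
      = (\<Oplus>\<^bsub>R\<^esub>i\<in>{..length w}. \<zero>\<^bsub>R\<^esub>)" by (intro R.finsum_cong') auto
    moreover have "w \<noteq> u @ v" using False by auto
    ultimately show ?thesis by (simp add: single_def)
  qed
  finally show "(single R u \<otimes>\<^bsub>free_algebra R S\<^esub> single R v) w = single R (u @ v) w"
    by (simp add: free_algebra_mult)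
qed

lemma free_algebra_linear_eq:
  assumes R: "cring R" and P: "module R P"
    and f: "linear_map R (free_algebra R S) P f" and h: "linear_map R (free_algebra R S) P h"
    and eq: "\<And>w. w \<in> lists S \<Longrightarrow> f (single R w) = h (single R w)"
    and p: "p \<in> carrier (free_algebra R S)"
  shows "f p = h p"
proof -
  have "linear_map R (free_module R (lists S)) P f" "linear_map R (free_module R (lists S)) P h"
    using f h by (simp_all add: linear_map_def)
  from free_module_linear_eq[OF R P this, OF eq] p show ?thesis by simp
qed

text \<open>
  On words, associativity of the convolution product is associativity of concatenation. It extends to all
  elements by linearity, in one argument after the other.
\<close>

lemma assoc_algebra_free_algebra:
  assumes R: "cring R"
  shows "assoc_algebra R (free_algebra R S)"
proof -
  let ?A = "free_algebra R S"
  note M = module_free_algebra[OF R, of S]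
  note bil = free_algebra_mult_bilinear[OF R, of S]
  note L = bilinear_map_left[OF bil] and Rt = bilinear_map_right[OF bil]
  note closed = bilinear_map_closed[OF bil]
  have s: "single R w \<in> carrier ?A" if "w \<in> lists S" for w
    using single_closed[OF R that] by simp
  have id: "linear_map R ?A ?A (\<lambda>p. p)" by (simp add: linear_map_def)
  note mult = free_algebra_single_mult[OF R]
  have assoc1: "single R u \<otimes>\<^bsub>?A\<^esub> single R v \<otimes>\<^bsub>?A\<^esub> r = single R u \<otimes>\<^bsub>?A\<^esub> (single R v \<otimes>\<^bsub>?A\<^esub> r)"
    if "u \<in> lists S" "v \<in> lists S" "r \<in> carrier ?A" for u v r
    by (rule free_algebra_linear_eq[OF R M Rt linear_map_comp[OF Rt Rt] _ that(3)])
      (use that s in \<open>auto simp: mult\<close>)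
  have assoc2: "single R u \<otimes>\<^bsub>?A\<^esub> q \<otimes>\<^bsub>?A\<^esub> r = single R u \<otimes>\<^bsub>?A\<^esub> (q \<otimes>\<^bsub>?A\<^esub> r)"
    if "u \<in> lists S" "q \<in> carrier ?A" "r \<in> carrier ?A" for u q r
    by (rule free_algebra_linear_eq[OF R M linear_map_comp[OF Rt L] linear_map_comp[OF L Rt] _ that(2)])
      (use that s assoc1 in auto)
  have assoc3: "p \<otimes>\<^bsub>?A\<^esub> q \<otimes>\<^bsub>?A\<^esub> r = p \<otimes>\<^bsub>?A\<^esub> (q \<otimes>\<^bsub>?A\<^esub> r)"
    if "p \<in> carrier ?A" "q \<in> carrier ?A" "r \<in> carrier ?A" for p q r
    by (rule free_algebra_linear_eq[OF R M linear_map_comp[OF L L] L _ that(1)])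
      (use that s assoc2 closed in auto)
  have one: "single R [] \<in> carrier ?A" by (simp add: single_closed[OF R])
  have lone: "single R [] \<otimes>\<^bsub>?A\<^esub> p = p" if "p \<in> carrier ?A" for p
    by (rule free_algebra_linear_eq[OF R M Rt[OF one] id _ that]) (simp add: mult)
  have rone: "p \<otimes>\<^bsub>?A\<^esub> single R [] = p" if "p \<in> carrier ?A" for p
    by (rule free_algebra_linear_eq[OF R M L[OF one] id _ that]) (simp add: mult)
  have "monoid ?A"
    using closed one assoc3 lone rone by (intro monoidI) auto
  then show ?thesis by (rule assoc_algebraI[OF M _ bil])
qed

lemma generates_free_algebra:
  assumes R: "cring R"
  shows "generates R (free_algebra R S) ((\<lambda>x. single R [x]) ` S)"
proof -
  let ?A = "free_algebra R S"
  interpret A: assoc_algebra R ?A by (rule assoc_algebra_free_algebra[OF R])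
  have "N = carrier ?A" if N: "submodule N R ?A" and one: "\<one>\<^bsub>?A\<^esub> \<in> N"
    and mult: "\<forall>x\<in>(\<lambda>x. single R [x]) ` S. \<forall>a\<in>N. x \<otimes>\<^bsub>?A\<^esub> a \<in> N" for N
  proof -
    note sub = A.submoduleE[OF N]
    have w: "single R w \<in> N" if "w \<in> lists S" for w
      using that
    proof induction
      case Nil then show ?case using one by simp
    next
      case (Cons x w)
      then have "single R [x] \<otimes>\<^bsub>?A\<^esub> single R w \<in> N" using mult by blast
      then show ?case by (simp add: free_algebra_single_mult[OF R])
    qed
    have "p \<in> N" if "p \<in> carrier (free_module R (lists S))" for p
      using R that
    proof (induction p rule: free_module_induct)
      case zero
      have "\<zero>\<^bsub>?A\<^esub> \<in> N" using N by (metis (no_types, lifting) subgroup.one_closed submodule_def monoid.simps(2))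
      then show ?case by simp
    next
      case (step r s p)
      have "r \<odot>\<^bsub>?A\<^esub> single R s \<oplus>\<^bsub>?A\<^esub> p \<in> N" using step w by (intro sub(5) sub(4))
      then show ?case by simp
    qed
    then show ?thesis using sub(1) by auto
  qed
  then show ?thesis by (auto simp: generates_def intro!: single_closed[OF R])
qed

lemma free_algebra_universal:
  assumes R: "cring R" and B: "assoc_algebra R B" and f: "f \<in> S \<rightarrow> carrier B"
  obtains h where "algebra_hom R (free_algebra R S) B h" "\<And>s. s \<in> S \<Longrightarrow> h (single R [s]) = f s"
proof -
  interpret B: assoc_algebra R B by fact
  let ?A = "free_algebra R S"
  interpret A: assoc_algebra R ?A by (rule assoc_algebra_free_algebra[OF R])
  define g where "g w = foldr (\<lambda>s b. f s \<otimes>\<^bsub>B\<^esub> b) w \<one>\<^bsub>B\<^esub>" for w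
  have g: "g w \<in> carrier B" if "w \<in> lists S" for w
    using that f by (induction) (auto simp: g_def)
  have g_append: "g (u @ v) = g u \<otimes>\<^bsub>B\<^esub> g v" if "u \<in> lists S" "v \<in> lists S" for u v
    using that(1)
  proof induction
    case Nil then show ?case using g[OF that(2)] by (simp add: g_def)
  next
    case (Cons x w)
    then have "f x \<in> carrier B" using f by auto
    with Cons g[OF that(2)] g[OF Cons(2)] show ?case by (simp add: g_def B.m_assoc)
  qed
  obtain h where h': "linear_map R (free_module R (lists S)) B h"
    and hs: "\<And>w. w \<in> lists S \<Longrightarrow> h (single R w) = g w"
    using free_module_universal[OF R B.module_axioms, of g "lists S"] g by auto
  have h: "linear_map R ?A B h"
    using h' by (simp add: linear_map_def)
  note bA = A.mult_bilinear and bB = B.mult_bilinear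
  note hc = linear_map_closed[OF h]
  have s: "single R w \<in> carrier ?A" if "w \<in> lists S" for w
    using single_closed[OF R that] by simp
  have mult1: "h (single R u \<otimes>\<^bsub>?A\<^esub> q) = h (single R u) \<otimes>\<^bsub>B\<^esub> h q"
    if "u \<in> lists S" "q \<in> carrier ?A" for u q
    by (rule free_algebra_linear_eq[OF R B.module_axioms
          linear_map_comp[OF bilinear_map_right[OF bA] h]
          linear_map_comp[OF h bilinear_map_right[OF bB]] _ that(2)])
       (use that s hc g in \<open>auto simp: free_algebra_single_mult[OF R] hs g_append\<close>)
  have mult: "h (p \<otimes>\<^bsub>?A\<^esub> q) = h p \<otimes>\<^bsub>B\<^esub> h q" if "p \<in> carrier ?A" "q \<in> carrier ?A" for p q
    by (rule free_algebra_linear_eq[OF R B.module_axioms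
          linear_map_comp[OF bilinear_map_left[OF bA] h]
          linear_map_comp[OF h bilinear_map_left[OF bB]] _ that(1)])
       (use that hc mult1 in auto)
  have "algebra_hom R ?A B h"
    using h mult hs[of "[]"] by (intro algebra_homI) (auto simp: g_def)
  moreover have "h (single R [s]) = f s" if "s \<in> S" for s
    using hs[of "[s]"] that f by (simp add: g_def Pi_iff)
  ultimately show thesis by (rule that)
qed

text \<open>
  The tensor algebra is the free algebra on the elements of \<open>M\<close> modulo linearity of the inclusion
  of generators, so its homomorphisms are the linear maps out of \<open>M\<close>. The symmetric and the
  universal enveloping algebra inherit the corresponding description, with one more relation each.
\<close>

context
  fixes R :: "('r, 'e) ring_scheme" and M :: "('r, 'g, 'm) module_scheme"
  assumes M: "module R M"
begin

interpretation M: module R M by (rule M)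

private abbreviation "F \<equiv> free_algebra R (carrier M)"
private abbreviation "linearity_relations \<equiv>
  {single R [x \<oplus>\<^bsub>M\<^esub> y] \<ominus>\<^bsub>F\<^esub> (single R [x] \<oplus>\<^bsub>F\<^esub> single R [y]) | x y. x \<in> carrier M \<and> y \<in> carrier M} \<union>
  {single R [r \<odot>\<^bsub>M\<^esub> x] \<ominus>\<^bsub>F\<^esub> r \<odot>\<^bsub>F\<^esub> single R [x] | r x. r \<in> carrier R \<and> x \<in> carrier M}"

interpretation F: assoc_algebra R F
  by (rule assoc_algebra_free_algebra[OF M.R.is_cring])

private lemma single_word_closed: "x \<in> carrier M \<Longrightarrow> single R [x] \<in> carrier F"
  by (simp add: single_closed[OF M.R.is_cring])

private lemma linearity_relations: "linearity_relations \<subseteq> carrier F"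
proof
  fix p assume "p \<in> linearity_relations"
  then consider (add) x y where "x \<in> carrier M" "y \<in> carrier M"
      "p = single R [x \<oplus>\<^bsub>M\<^esub> y] \<ominus>\<^bsub>F\<^esub> (single R [x] \<oplus>\<^bsub>F\<^esub> single R [y])"
    | (smult) r x where "r \<in> carrier R" "x \<in> carrier M"
      "p = single R [r \<odot>\<^bsub>M\<^esub> x] \<ominus>\<^bsub>F\<^esub> r \<odot>\<^bsub>F\<^esub> single R [x]" by blast
  then show "p \<in> carrier F"
  proof cases
    case add then show ?thesis
      by (simp only:) (intro F.minus_closed F.a_closed single_word_closed M.a_closed)
  next
    case smult then show ?thesis
      by (simp only:) (intro F.minus_closed F.smult_closed single_word_closed M.smult_closed)
  qed
qed

private lemma linearity_ideal_eq: "linearity_ideal R M = Idl\<^bsub>F\<^esub> linearity_relations"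
  by (simp add: linearity_ideal_def Let_def)

private lemma linearity_ideal: "ideal (linearity_ideal R M) F"
  unfolding linearity_ideal_eq by (rule F.genideal_ideal[OF linearity_relations])

lemma assoc_algebra_tensor_algebra: "assoc_algebra R (tensor_algebra R M)"
  unfolding tensor_algebra_def by (rule assoc_algebra_quotient[OF F.assoc_algebra_axioms linearity_ideal])

lemma generates_tensor_algebra: "generates R (tensor_algebra R M) (tensor_gen R M ` carrier M)"
  using generates_quotient[OF F.assoc_algebra_axioms linearity_ideal
      generates_free_algebra[OF M.R.is_cring]]
  by (simp add: tensor_algebra_def tensor_gen_def image_image)

lemma tensor_gen_linear: "linear_map R M (tensor_algebra R M) (tensor_gen R M)"
proof -
  let ?I = "linearity_ideal R M"
  note sub = ideal_submodule[OF F.assoc_algebra_axioms linearity_ideal]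
  note coset = coset_closed[OF F.module_axioms sub] coset_add[OF F.module_axioms sub]
    coset_smult[OF F.module_axioms sub] coset_eq_iff[OF F.module_axioms sub]
  have rel: "p \<in> ?I" if "p \<in> linearity_relations" for p
    unfolding linearity_ideal_eq using F.genideal_self[OF linearity_relations] that by blast
  show ?thesis
  proof (rule linear_mapI)
    fix x assume x: "x \<in> carrier M"
    note sx = single_word_closed[OF x]
    show "tensor_gen R M x \<in> carrier (tensor_algebra R M)"
      using coset(1)[OF sx] by (simp add: tensor_gen_def tensor_algebra_def)
    fix y assume y: "y \<in> carrier M"
    note sy = single_word_closed[OF y]
    have "?I +>\<^bsub>F\<^esub> single R [x \<oplus>\<^bsub>M\<^esub> y] = ?I +>\<^bsub>F\<^esub> (single R [x] \<oplus>\<^bsub>F\<^esub> single R [y])"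
      unfolding coset(4)[OF single_word_closed[OF M.a_closed[OF x y]] F.a_closed[OF sx sy]]
      by (rule rel) (use x y in blast)
    then show "tensor_gen R M (x \<oplus>\<^bsub>M\<^esub> y) =
      tensor_gen R M x \<oplus>\<^bsub>tensor_algebra R M\<^esub> tensor_gen R M y"
      unfolding tensor_gen_def tensor_algebra_def coset(2)[OF sx sy] .
  next
    fix r x assume r: "r \<in> carrier R" and x: "x \<in> carrier M"
    note sx = single_word_closed[OF x]
    have "?I +>\<^bsub>F\<^esub> single R [r \<odot>\<^bsub>M\<^esub> x] = ?I +>\<^bsub>F\<^esub> (r \<odot>\<^bsub>F\<^esub> single R [x])"
      unfolding coset(4)[OF single_word_closed[OF M.smult_closed[OF r x]] F.smult_closed[OF r sx]]
      by (rule rel) (use r x in blast)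
    then show "tensor_gen R M (r \<odot>\<^bsub>M\<^esub> x) = r \<odot>\<^bsub>tensor_algebra R M\<^esub> tensor_gen R M x"
      unfolding tensor_gen_def tensor_algebra_def coset(3)[OF r sx] .
  qed
qed

lemma tensor_algebra_universal:
  assumes B: "assoc_algebra R B" and f: "linear_map R M B f"
  obtains h where "algebra_hom R (tensor_algebra R M) B h"
    "\<And>x. x \<in> carrier M \<Longrightarrow> h (tensor_gen R M x) = f x"
proof -
  interpret B: assoc_algebra R B by fact
  obtain h where h: "algebra_hom R F B h" and hx: "\<And>x. x \<in> carrier M \<Longrightarrow> h (single R [x]) = f x"
    using free_algebra_universal[OF M.R.is_cring B, of f "carrier M"] linear_map_closed[OF f] by blast
  note lin = algebra_hom_linear[OF h]
  note fc = linear_map_closed[OF f]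
  note minus = linear_map_minus[OF F.module_axioms B.module_axioms lin]
  have van: "h p = \<zero>\<^bsub>B\<^esub>" if "p \<in> linearity_relations" for p
  proof -
    from that consider (add) x y where "x \<in> carrier M" "y \<in> carrier M"
        "p = single R [x \<oplus>\<^bsub>M\<^esub> y] \<ominus>\<^bsub>F\<^esub> (single R [x] \<oplus>\<^bsub>F\<^esub> single R [y])"
      | (smult) r x where "r \<in> carrier R" "x \<in> carrier M"
        "p = single R [r \<odot>\<^bsub>M\<^esub> x] \<ominus>\<^bsub>F\<^esub> r \<odot>\<^bsub>F\<^esub> single R [x]" by blast
    then show ?thesis
    proof cases
      case add
      note s = single_word_closed[OF add(1)] single_word_closed[OF add(2)]
      have "h p = h (single R [x \<oplus>\<^bsub>M\<^esub> y]) \<ominus>\<^bsub>B\<^esub> (h (single R [x]) \<oplus>\<^bsub>B\<^esub> h (single R [y]))"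
        unfolding add(3) using add(1,2) s
        by (subst minus) (auto simp del: free_algebra_simps simp: linear_map_add[OF lin]
            intro!: single_word_closed F.a_closed)
      then show ?thesis using add fc by (simp add: hx linear_map_add[OF f] B.minus_eq B.r_neg)
    next
      case smult
      note s = single_word_closed[OF smult(2)]
      have "h p = h (single R [r \<odot>\<^bsub>M\<^esub> x]) \<ominus>\<^bsub>B\<^esub> (r \<odot>\<^bsub>B\<^esub> h (single R [x]))"
        unfolding smult(3) using smult(1,2) s
        by (subst minus) (auto simp del: free_algebra_simps simp: linear_map_smult[OF lin]
            intro!: single_word_closed)
      then show ?thesis using smult fc by (simp add: hx linear_map_smult[OF f] B.minus_eq B.r_neg)
    qed
  qed
  obtain k where "algebra_hom R (quotient_module F (Idl\<^bsub>F\<^esub> linearity_relations)) B k"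
    and "\<And>a. a \<in> carrier F \<Longrightarrow> k (Idl\<^bsub>F\<^esub> linearity_relations +>\<^bsub>F\<^esub> a) = h a"
    by (rule quotient_algebra_factor[OF F.assoc_algebra_axioms B linearity_relations h], erule van)
      (rule that)
  then have k: "algebra_hom R (tensor_algebra R M) B k"
    and ka: "k (linearity_ideal R M +>\<^bsub>F\<^esub> a) = h a" if "a \<in> carrier F" for a
    unfolding tensor_algebra_def linearity_ideal_eq using that by blast+
  have "k (tensor_gen R M x) = f x" if "x \<in> carrier M" for x
    unfolding tensor_gen_def ka[OF single_word_closed[OF that]] by (rule hx[OF that])
  with k[OF F.one_closed] show thesis by (rule that)
qed

interpretation T: assoc_algebra R "tensor_algebra R M"
  by (rule assoc_algebra_tensor_algebra)

private lemma tensor_gen_closed: "x \<in> carrier M \<Longrightarrow> tensor_gen R M x \<in> carrier (tensor_algebra R M)"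
  by (rule linear_map_closed[OF tensor_gen_linear])

text \<open>
  What a presentation \<open>T / (X)\<close> of an algebra inherits from the tensor algebra \<open>T\<close>.
\<close>

lemma tensor_quotient:
  assumes X: "X \<subseteq> carrier (tensor_algebra R M)"
  defines "I \<equiv> Idl\<^bsub>tensor_algebra R M\<^esub> X"
  defines "Q \<equiv> quotient_module (tensor_algebra R M) I"
  defines "\<iota> \<equiv> \<lambda>x. I +>\<^bsub>tensor_algebra R M\<^esub> tensor_gen R M x"
  shows "assoc_algebra R Q" and "generates R Q (\<iota> ` carrier M)" and "linear_map R M Q \<iota>"
    and "algebra_hom R (tensor_algebra R M) Q (\<lambda>x. I +>\<^bsub>tensor_algebra R M\<^esub> x)"
    and "x \<in> X \<Longrightarrow> I +>\<^bsub>tensor_algebra R M\<^esub> x = \<zero>\<^bsub>Q\<^esub>"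
    and "\<lbrakk>assoc_algebra R B; linear_map R M B f;
      \<And>k x. \<lbrakk>algebra_hom R (tensor_algebra R M) B k; x \<in> X;
          \<And>x. x \<in> carrier M \<Longrightarrow> k (tensor_gen R M x) = f x\<rbrakk> \<Longrightarrow> k x = \<zero>\<^bsub>B\<^esub>\<rbrakk> \<Longrightarrow>
      \<exists>h. algebra_hom R Q B h \<and> (\<forall>x\<in>carrier M. h (\<iota> x) = f x)"
proof -
  let ?T = "tensor_algebra R M"
  note T = assoc_algebra_tensor_algebra
  have I: "ideal I ?T" unfolding I_def by (rule T.genideal_ideal[OF X])
  note sub = ideal_submodule[OF T I]
  show "assoc_algebra R Q" unfolding Q_def by (rule assoc_algebra_quotient[OF T I])
  show "generates R Q (\<iota> ` carrier M)"
    using generates_quotient[OF T I generates_tensor_algebra] by (simp add: Q_def \<iota>_def image_image)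
  show hom: "algebra_hom R ?T Q (\<lambda>x. I +>\<^bsub>?T\<^esub> x)"
    unfolding Q_def by (rule coset_algebra_hom[OF T I])
  show "linear_map R M Q \<iota>"
    unfolding \<iota>_def by (rule linear_map_comp[OF tensor_gen_linear algebra_hom_linear[OF hom]])
  show "I +>\<^bsub>?T\<^esub> x = \<zero>\<^bsub>Q\<^esub>" if "x \<in> X"
  proof -
    have x: "x \<in> carrier ?T" using that X by auto
    have "x \<in> I" unfolding I_def using T.genideal_self[OF X] that by auto
    then have "x \<ominus>\<^bsub>?T\<^esub> \<zero>\<^bsub>?T\<^esub> \<in> I" using x by (simp add: T.minus_eq)
    then show ?thesis
      using coset_eq_iff[OF T.module_axioms sub x T.M.zero_closed] coset_zero[OF T.module_axioms sub]
      by (simp add: Q_def)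
  qed
  show "\<exists>h. algebra_hom R Q B h \<and> (\<forall>x\<in>carrier M. h (\<iota> x) = f x)"
    if B: "assoc_algebra R B" and f: "linear_map R M B f"
      and van: "\<And>k x. \<lbrakk>algebra_hom R ?T B k; x \<in> X;
          \<And>x. x \<in> carrier M \<Longrightarrow> k (tensor_gen R M x) = f x\<rbrakk> \<Longrightarrow> k x = \<zero>\<^bsub>B\<^esub>"
  proof -
    obtain k where k: "algebra_hom R ?T B k" "\<And>x. x \<in> carrier M \<Longrightarrow> k (tensor_gen R M x) = f x"
      by (rule tensor_algebra_universal[OF B f]) blast
    have "k x = \<zero>\<^bsub>B\<^esub>" if "x \<in> X" for x by (rule van[OF k(1) that k(2)])
    then obtain h where "algebra_hom R Q B h" "\<And>a. a \<in> carrier ?T \<Longrightarrow> h (I +>\<^bsub>?T\<^esub> a) = k a"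
      using quotient_algebra_factor[OF T B X k(1), folded I_def, folded Q_def] by blast
    then show ?thesis using k tensor_gen_closed by (auto simp: \<iota>_def)
  qed
qed

private abbreviation "commutativity_relations \<equiv>
  {tensor_gen R M x \<otimes>\<^bsub>tensor_algebra R M\<^esub> tensor_gen R M y \<ominus>\<^bsub>tensor_algebra R M\<^esub>
     tensor_gen R M y \<otimes>\<^bsub>tensor_algebra R M\<^esub> tensor_gen R M x | x y. x \<in> carrier M \<and> y \<in> carrier M}"

private lemma commutativity_relations: "commutativity_relations \<subseteq> carrier (tensor_algebra R M)"
  using tensor_gen_closed by auto

lemma Sym_eq: "Sym R M = quotient_module (tensor_algebra R M) (Idl\<^bsub>tensor_algebra R M\<^esub> commutativity_relations)"
  "Sym_gen R M x = Idl\<^bsub>tensor_algebra R M\<^esub> commutativity_relations +>\<^bsub>tensor_algebra R M\<^esub> tensor_gen R M x"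
  by (simp_all add: Sym_def Sym_gen_def Sym_ideal_def Let_def)

lemma assoc_algebra_Sym: "assoc_algebra R (Sym R M)"
  unfolding Sym_eq by (rule tensor_quotient(1)[OF commutativity_relations])

lemma generates_Sym: "generates R (Sym R M) (Sym_gen R M ` carrier M)"
  unfolding Sym_eq by (rule tensor_quotient(2)[OF commutativity_relations])

lemma Sym_gen_linear: "linear_map R M (Sym R M) (Sym_gen R M)"
  unfolding Sym_eq by (rule tensor_quotient(3)[OF commutativity_relations])

lemma Sym_gen_comm:
  assumes "x \<in> carrier M" "y \<in> carrier M"
  shows "Sym_gen R M x \<otimes>\<^bsub>Sym R M\<^esub> Sym_gen R M y = Sym_gen R M y \<otimes>\<^bsub>Sym R M\<^esub> Sym_gen R M x"
proof -
  let ?T = "tensor_algebra R M" and ?t = "tensor_gen R M"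
  interpret S: assoc_algebra R "Sym R M" by (rule assoc_algebra_Sym)
  let ?\<pi> = "\<lambda>a. Idl\<^bsub>?T\<^esub> commutativity_relations +>\<^bsub>?T\<^esub> a"
  have \<pi>: "algebra_hom R ?T (Sym R M) ?\<pi>"
    unfolding Sym_eq by (rule tensor_quotient(4)[OF commutativity_relations])
  note c = assms[THEN tensor_gen_closed]
  note S = assms[THEN linear_map_closed[OF Sym_gen_linear]]
  have "?\<pi> (?t x \<otimes>\<^bsub>?T\<^esub> ?t y \<ominus>\<^bsub>?T\<^esub> ?t y \<otimes>\<^bsub>?T\<^esub> ?t x) = \<zero>\<^bsub>Sym R M\<^esub>"
    unfolding Sym_eq by (rule tensor_quotient(5)[OF commutativity_relations]) (use assms in blast)
  then have "?\<pi> (?t x \<otimes>\<^bsub>?T\<^esub> ?t y) \<ominus>\<^bsub>Sym R M\<^esub> ?\<pi> (?t y \<otimes>\<^bsub>?T\<^esub> ?t x) = \<zero>\<^bsub>Sym R M\<^esub>"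
    using linear_map_minus[OF T.module_axioms S.module_axioms algebra_hom_linear[OF \<pi>]] c by simp
  then show ?thesis
    using S by (simp add: algebra_hom_mult[OF \<pi>] c Sym_eq(2)[symmetric] S.add.inv_solve_right' S.minus_eq)
qed

lemma Sym_universal:
  assumes B: "assoc_algebra R B" and f: "linear_map R M B f"
    and comm: "\<And>x y. \<lbrakk>x \<in> carrier M; y \<in> carrier M\<rbrakk> \<Longrightarrow> f x \<otimes>\<^bsub>B\<^esub> f y = f y \<otimes>\<^bsub>B\<^esub> f x"
  obtains h where "algebra_hom R (Sym R M) B h" "\<And>x. x \<in> carrier M \<Longrightarrow> h (Sym_gen R M x) = f x"
proof -
  interpret B: assoc_algebra R B by fact
  note fc = linear_map_closed[OF f]
  have "k a = \<zero>\<^bsub>B\<^esub>"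
    if k: "algebra_hom R (tensor_algebra R M) B k" and a: "a \<in> commutativity_relations"
      and kx: "\<And>x. x \<in> carrier M \<Longrightarrow> k (tensor_gen R M x) = f x" for k a
    using a linear_map_minus[OF T.module_axioms B.module_axioms algebra_hom_linear[OF k]] fc
    by (auto simp: algebra_hom_mult[OF k] kx tensor_gen_closed comm B.minus_eq B.r_neg)
  then have "\<exists>h. algebra_hom R (Sym R M) B h \<and> (\<forall>x\<in>carrier M. h (Sym_gen R M x) = f x)"
    unfolding Sym_eq by (intro tensor_quotient(6)[OF commutativity_relations B f]) blast
  then show thesis using that by blast
qed

lemma algebra_Sym: "algebra R (Sym R M)"
proof -
  interpret S: assoc_algebra R "Sym R M" by (rule assoc_algebra_Sym)
  have "a \<otimes>\<^bsub>Sym R M\<^esub> b = b \<otimes>\<^bsub>Sym R M\<^esub> a" if "a \<in> carrier (Sym R M)" "b \<in> carrier (Sym R M)" for a b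
    by (rule generates_comm[OF assoc_algebra_Sym generates_Sym _ that]) (auto simp: Sym_gen_comm)
  then have "cring (Sym R M)"
    by (intro cring.intro comm_monoid.intro comm_monoid_axioms.intro S.ring_axioms S.monoid_axioms)
  then show ?thesis
    using S.module_axioms S.smult_mult_left
    by (auto simp: algebra_def algebra_axioms_def)
qed

end

context
  fixes R :: "('r, 'e) ring_scheme" and L :: "('r, 'g) lie"
  assumes L: "lie_algebra R L"
begin

interpretation L: lie_algebra R L by (rule L)

private abbreviation "T \<equiv> tensor_algebra R L"
private abbreviation "t \<equiv> tensor_gen R L"

interpretation T: assoc_algebra R T
  by (rule assoc_algebra_tensor_algebra[OF L.module_axioms])

private abbreviation "lie_relations \<equiv>
  {(t x \<otimes>\<^bsub>T\<^esub> t y \<ominus>\<^bsub>T\<^esub> t y \<otimes>\<^bsub>T\<^esub> t x) \<ominus>\<^bsub>T\<^esub> t (bracket L x y) | x y. x \<in> carrier L \<and> y \<in> carrier L}"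

private lemma t_closed: "x \<in> carrier L \<Longrightarrow> t x \<in> carrier T"
  by (rule linear_map_closed[OF tensor_gen_linear[OF L.module_axioms]])

private lemma bracket_closed: "x \<in> carrier L \<Longrightarrow> y \<in> carrier L \<Longrightarrow> bracket L x y \<in> carrier L"
  by (rule bilinear_map_closed[OF L.bracket_bilinear])

private lemma lie_relations: "lie_relations \<subseteq> carrier T"
  using t_closed bracket_closed by auto

lemma ULie_eq: "ULie R L = quotient_module T (Idl\<^bsub>T\<^esub> lie_relations)"
  "ULie_gen R L x = Idl\<^bsub>T\<^esub> lie_relations +>\<^bsub>T\<^esub> t x"
  by (simp_all add: ULie_def ULie_gen_def ULie_ideal_def Let_def)

lemma assoc_algebra_ULie: "assoc_algebra R (ULie R L)"
  unfolding ULie_eq by (rule tensor_quotient(1)[OF L.module_axioms lie_relations])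

lemma generates_ULie: "generates R (ULie R L) (ULie_gen R L ` carrier L)"
  unfolding ULie_eq by (rule tensor_quotient(2)[OF L.module_axioms lie_relations])

lemma ULie_gen_linear: "linear_map R L (ULie R L) (ULie_gen R L)"
  unfolding ULie_eq by (rule tensor_quotient(3)[OF L.module_axioms lie_relations])

lemma ULie_gen_bracket:
  assumes "x \<in> carrier L" "y \<in> carrier L"
  shows "ULie_gen R L x \<otimes>\<^bsub>ULie R L\<^esub> ULie_gen R L y =
    ULie_gen R L (bracket L x y) \<oplus>\<^bsub>ULie R L\<^esub> ULie_gen R L y \<otimes>\<^bsub>ULie R L\<^esub> ULie_gen R L x"
proof -
  let ?U = "ULie R L" and ?u = "ULie_gen R L"
  interpret U: assoc_algebra R ?U by (rule assoc_algebra_ULie)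
  let ?\<pi> = "\<lambda>a. Idl\<^bsub>T\<^esub> lie_relations +>\<^bsub>T\<^esub> a"
  have \<pi>: "algebra_hom R T ?U ?\<pi>"
    unfolding ULie_eq by (rule tensor_quotient(4)[OF L.module_axioms lie_relations])
  note c = assms[THEN t_closed] t_closed[OF bracket_closed[OF assms]]
  have u: "?u x \<in> carrier ?U" if "x \<in> carrier L" for x
    by (rule linear_map_closed[OF ULie_gen_linear that])
  note u = assms[THEN u] u[OF bracket_closed[OF assms]]
  have "?\<pi> ((t x \<otimes>\<^bsub>T\<^esub> t y \<ominus>\<^bsub>T\<^esub> t y \<otimes>\<^bsub>T\<^esub> t x) \<ominus>\<^bsub>T\<^esub> t (bracket L x y)) = \<zero>\<^bsub>?U\<^esub>"
    unfolding ULie_eq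
    by (rule tensor_quotient(5)[OF L.module_axioms lie_relations]) (use assms in blast)
  then have "(?u x \<otimes>\<^bsub>?U\<^esub> ?u y \<ominus>\<^bsub>?U\<^esub> ?u y \<otimes>\<^bsub>?U\<^esub> ?u x) \<ominus>\<^bsub>?U\<^esub> ?u (bracket L x y) = \<zero>\<^bsub>?U\<^esub>"
    using linear_map_minus[OF T.module_axioms U.module_axioms algebra_hom_linear[OF \<pi>]] c
    by (simp add: algebra_hom_mult[OF \<pi>] ULie_eq(2)[symmetric])
  then show ?thesis
    using u by (simp add: U.add.inv_solve_right' U.minus_eq)
qed

lemma ULie_universal:
  assumes B: "assoc_algebra R B" and f: "linear_map R L B f"
    and comm: "\<And>x y. \<lbrakk>x \<in> carrier L; y \<in> carrier L\<rbrakk> \<Longrightarrow>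
      f x \<otimes>\<^bsub>B\<^esub> f y = f (bracket L x y) \<oplus>\<^bsub>B\<^esub> f y \<otimes>\<^bsub>B\<^esub> f x"
  obtains h where "algebra_hom R (ULie R L) B h" "\<And>x. x \<in> carrier L \<Longrightarrow> h (ULie_gen R L x) = f x"
proof -
  interpret B: assoc_algebra R B by fact
  note fc = linear_map_closed[OF f]
  have "k a = \<zero>\<^bsub>B\<^esub>"
    if k: "algebra_hom R T B k" and a: "a \<in> lie_relations"
      and kx: "\<And>x. x \<in> carrier L \<Longrightarrow> k (t x) = f x" for k a
  proof -
    obtain x y where xy: "x \<in> carrier L" "y \<in> carrier L"
      and a: "a = (t x \<otimes>\<^bsub>T\<^esub> t y \<ominus>\<^bsub>T\<^esub> t y \<otimes>\<^bsub>T\<^esub> t x) \<ominus>\<^bsub>T\<^esub> t (bracket L x y)"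
      using a by blast
    note c = t_closed[OF xy(1)] t_closed[OF xy(2)] t_closed[OF bracket_closed[OF xy]]
    note fc = fc[OF xy(1)] fc[OF xy(2)] fc[OF bracket_closed[OF xy]]
    have "k a = (f x \<otimes>\<^bsub>B\<^esub> f y \<ominus>\<^bsub>B\<^esub> f y \<otimes>\<^bsub>B\<^esub> f x) \<ominus>\<^bsub>B\<^esub> f (bracket L x y)"
      using linear_map_minus[OF T.module_axioms B.module_axioms algebra_hom_linear[OF k]] c xy
      by (simp add: a algebra_hom_mult[OF k] kx bracket_closed)
    also have "\<dots> = \<zero>\<^bsub>B\<^esub>"
      unfolding comm[OF xy] using fc by (simp add: B.minus_eq B.r_neg B.a_assoc)
    finally show ?thesis .
  qed
  then have "\<exists>h. algebra_hom R (ULie R L) B h \<and> (\<forall>x\<in>carrier L. h (ULie_gen R L x) = f x)"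
    unfolding ULie_eq by (intro tensor_quotient(6)[OF L.module_axioms lie_relations B f]) blast
  then show thesis using that by blast
qed

end

section \<open>Tensor products and the Hopf structure of the enveloping algebra\<close>

text \<open>
  Maps specified by a definite description range over extensional functions, while the properties
  that characterize them only see the carrier. Existence may therefore be shown by any map with
  the required property, without regard to its values elsewhere.
\<close>

lemma THE_extensional:
  assumes ex: "P h" and closed: "\<And>h x. P h \<Longrightarrow> x \<in> A \<Longrightarrow> h x \<in> B"
    and cong: "\<And>h h'. \<lbrakk>P h; \<And>x. x \<in> A \<Longrightarrow> h' x = h x\<rbrakk> \<Longrightarrow> P h'"
    and unique: "\<And>h h' x. \<lbrakk>P h; P h'; x \<in> A\<rbrakk> \<Longrightarrow> h x = h' x"
  shows "P (THE h. h \<in> A \<rightarrow>\<^sub>E B \<and> P h)"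
proof -
  have "P (restrict h A)" by (rule cong[OF ex]) simp
  then have "restrict h A \<in> A \<rightarrow>\<^sub>E B \<and> P (restrict h A)" using closed[OF ex] by auto
  moreover have "h' = restrict h A" if "h' \<in> A \<rightarrow>\<^sub>E B \<and> P h'" for h'
    using that unique[OF _ ex] by (intro PiE_ext[of _ A "\<lambda>_. B"]) (auto simp: closed[OF ex])
  ultimately have "\<exists>!h. h \<in> A \<rightarrow>\<^sub>E B \<and> P h" by blast
  from theI'[OF this] show ?thesis by blast
qed

lemma THE_extensional2:
  assumes ex: "P h" and closed: "\<And>h x y. P h \<Longrightarrow> x \<in> A \<Longrightarrow> y \<in> B \<Longrightarrow> h x y \<in> C"
    and cong: "\<And>h h'. \<lbrakk>P h; \<And>x y. x \<in> A \<Longrightarrow> y \<in> B \<Longrightarrow> h' x y = h x y\<rbrakk> \<Longrightarrow> P h'"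
    and unique: "\<And>h h' x y. \<lbrakk>P h; P h'; x \<in> A; y \<in> B\<rbrakk> \<Longrightarrow> h x y = h' x y"
  shows "P (THE h. h \<in> A \<rightarrow>\<^sub>E B \<rightarrow>\<^sub>E C \<and> P h)"
proof -
  let ?h = "\<lambda>x\<in>A. \<lambda>y\<in>B. h x y"
  have "P ?h" by (rule cong[OF ex]) simp
  moreover have "?h \<in> A \<rightarrow>\<^sub>E B \<rightarrow>\<^sub>E C" using closed[OF ex] by auto
  moreover have "h' = ?h" if h': "h' \<in> A \<rightarrow>\<^sub>E B \<rightarrow>\<^sub>E C" "P h'" for h'
  proof (rule PiE_ext[OF h'(1) \<open>?h \<in> _\<close>])
    fix x assume "x \<in> A"
    then show "h' x = ?h x"
      using h' closed[OF ex] unique[OF h'(2) ex] by (intro PiE_ext[of _ B "\<lambda>_. C"]) auto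
  qed
  ultimately show ?thesis by (metis (mono_tags, lifting) the_equality)
qed

lemma algebra_hom_cong:
  assumes A: "assoc_algebra R A" and f: "algebra_hom R A B f"
    and eq: "\<And>x. x \<in> carrier A \<Longrightarrow> g x = f x"
  shows "algebra_hom R A B g"
proof -
  interpret A: assoc_algebra R A by fact
  show ?thesis using algebra_homD[OF f] linear_mapD[OF algebra_hom_linear[OF f]]
    by (intro algebra_homI linear_mapI) (auto simp: eq)
qed

lemma submodule_span:
  assumes M: "module R M" and X: "X \<subseteq> carrier M"
  shows "submodule (submodule_span R M X) R M" "X \<subseteq> submodule_span R M X"
    and submodule_span_minimal: "\<lbrakk>submodule N R M; X \<subseteq> N\<rbrakk> \<Longrightarrow> submodule_span R M X \<subseteq> N"
proof -
  interpret M: module R M by fact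
  have zero: "\<zero>\<^bsub>M\<^esub> \<in> N" if "submodule N R M" for N
    using that by (metis (no_types, lifting) subgroup.one_closed submodule_def monoid.simps(2))
  show "submodule (submodule_span R M X) R M"
    unfolding submodule_span_def
  proof (rule M.submoduleI)
    show "\<Inter> {N. submodule N R M \<and> X \<subseteq> N} \<subseteq> carrier M"
      using M.carrier_is_submodule X by blast
  qed (auto simp: zero intro: M.submoduleE(3-5))
  show "X \<subseteq> submodule_span R M X" by (auto simp: submodule_span_def)
  show "submodule_span R M X \<subseteq> N" if "submodule N R M" "X \<subseteq> N"
    using that by (auto simp: submodule_span_def)
qed

context
  fixes R :: "('r, 'e) ring_scheme" and M :: "('r, 'a) module" and N :: "('r, 'b) module"
  assumes M: "module R M" and N: "module R N"
begin

interpretation M: module R M by (rule M)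
interpretation N: module R N by (rule N)

private abbreviation "FMN \<equiv> free_module R (carrier M \<times> carrier N)"
private abbreviation "TMN \<equiv> tensor_product R M N"
private abbreviation "KMN \<equiv> tensor_submodule R M N"
private abbreviation "pMN m n \<equiv> pure_tensor R M N m n"

interpretation F: module R FMN by (rule module_free_module[OF M.R.is_cring])

private lemma single_pair_closed:
  "m \<in> carrier M \<Longrightarrow> n \<in> carrier N \<Longrightarrow> single R (m, n) \<in> carrier FMN"
  by (simp add: single_closed[OF M.R.is_cring])

private lemma tensor_relation_cases:
  assumes "q \<in> tensor_relations R M N"
  obtains (add_left) m m' n where "m \<in> carrier M" "m' \<in> carrier M" "n \<in> carrier N"
      "q = single R (m \<oplus>\<^bsub>M\<^esub> m', n) \<ominus>\<^bsub>FMN\<^esub> (single R (m, n) \<oplus>\<^bsub>FMN\<^esub> single R (m', n))"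
  | (add_right) m n n' where "m \<in> carrier M" "n \<in> carrier N" "n' \<in> carrier N"
      "q = single R (m, n \<oplus>\<^bsub>N\<^esub> n') \<ominus>\<^bsub>FMN\<^esub> (single R (m, n) \<oplus>\<^bsub>FMN\<^esub> single R (m, n'))"
  | (smult_left) r m n where "r \<in> carrier R" "m \<in> carrier M" "n \<in> carrier N"
      "q = single R (r \<odot>\<^bsub>M\<^esub> m, n) \<ominus>\<^bsub>FMN\<^esub> r \<odot>\<^bsub>FMN\<^esub> single R (m, n)"
  | (smult_right) r m n where "r \<in> carrier R" "m \<in> carrier M" "n \<in> carrier N"
      "q = single R (m, r \<odot>\<^bsub>N\<^esub> n) \<ominus>\<^bsub>FMN\<^esub> r \<odot>\<^bsub>FMN\<^esub> single R (m, n)"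
  using assms unfolding tensor_relations_def Let_def
  by (elim UnE CollectE exE conjE) (rule add_left add_right smult_left smult_right; assumption)+

private lemma tensor_relationI:
  "\<lbrakk>m \<in> carrier M; m' \<in> carrier M; n \<in> carrier N\<rbrakk> \<Longrightarrow>
    single R (m \<oplus>\<^bsub>M\<^esub> m', n) \<ominus>\<^bsub>FMN\<^esub> (single R (m, n) \<oplus>\<^bsub>FMN\<^esub> single R (m', n)) \<in> tensor_relations R M N"
  "\<lbrakk>m \<in> carrier M; n \<in> carrier N; n' \<in> carrier N\<rbrakk> \<Longrightarrow>
    single R (m, n \<oplus>\<^bsub>N\<^esub> n') \<ominus>\<^bsub>FMN\<^esub> (single R (m, n) \<oplus>\<^bsub>FMN\<^esub> single R (m, n')) \<in> tensor_relations R M N"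
  "\<lbrakk>r \<in> carrier R; m \<in> carrier M; n \<in> carrier N\<rbrakk> \<Longrightarrow>
    single R (r \<odot>\<^bsub>M\<^esub> m, n) \<ominus>\<^bsub>FMN\<^esub> r \<odot>\<^bsub>FMN\<^esub> single R (m, n) \<in> tensor_relations R M N"
  "\<lbrakk>r \<in> carrier R; m \<in> carrier M; n \<in> carrier N\<rbrakk> \<Longrightarrow>
    single R (m, r \<odot>\<^bsub>N\<^esub> n) \<ominus>\<^bsub>FMN\<^esub> r \<odot>\<^bsub>FMN\<^esub> single R (m, n) \<in> tensor_relations R M N"
  unfolding tensor_relations_def Let_def
  by (rule UnI1, rule UnI1, rule UnI1, rule CollectI, intro exI conjI, rule refl, assumption+)
    (rule UnI1, rule UnI1, rule UnI2, rule CollectI, intro exI conjI, rule refl, assumption+,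
     rule UnI1, rule UnI2, rule CollectI, intro exI conjI, rule refl, assumption+,
     rule UnI2, rule CollectI, intro exI conjI, rule refl, assumption+)

private lemma tensor_relations_closed: "tensor_relations R M N \<subseteq> carrier FMN"
proof
  fix q assume "q \<in> tensor_relations R M N"
  then show "q \<in> carrier FMN"
    by (cases rule: tensor_relation_cases)
      (simp only:, intro F.minus_closed F.a_closed F.smult_closed single_pair_closed M.a_closed
        N.a_closed M.smult_closed N.smult_closed; assumption)+
qed

private lemma K: "submodule KMN R FMN"
  unfolding tensor_submodule_def by (rule submodule_span[OF F.module_axioms tensor_relations_closed])

private lemma relation_in_K: "q \<in> tensor_relations R M N \<Longrightarrow> q \<in> KMN"
  unfolding tensor_submodule_def using submodule_span(2)[OF F.module_axioms tensor_relations_closed] by blast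

lemma module_tensor_product: "module R TMN"
  unfolding tensor_product_def by (rule module_quotient_module[OF F.module_axioms K])

interpretation T: module R TMN by (rule module_tensor_product)

private lemmas coset = coset_closed[OF F.module_axioms K, folded tensor_product_def]
  coset_add[OF F.module_axioms K, folded tensor_product_def]
  coset_smult[OF F.module_axioms K, folded tensor_product_def]
  coset_eq_iff[OF F.module_axioms K]

lemma pure_tensor_bilinear: "bilinear_map R M N TMN (pure_tensor R M N)"
proof (rule bilinear_mapI)
  fix m n assume m: "m \<in> carrier M" and n: "n \<in> carrier N"
  note s = single_pair_closed[OF m n]
  show "pMN m n \<in> carrier TMN" unfolding pure_tensor_def by (rule coset(1)[OF s])
  {
    fix m' assume m': "m' \<in> carrier M"
    note s' = single_pair_closed[OF m' n]
    have "single R (m \<oplus>\<^bsub>M\<^esub> m', n) \<ominus>\<^bsub>FMN\<^esub> (single R (m, n) \<oplus>\<^bsub>FMN\<^esub> single R (m', n)) \<in> KMN"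
      by (rule relation_in_K) (use m m' n in \<open>unfold tensor_relations_def Let_def, blast\<close>)
    then show "pMN (m \<oplus>\<^bsub>M\<^esub> m') n = pMN m n \<oplus>\<^bsub>TMN\<^esub> pMN m' n"
      unfolding pure_tensor_def coset(2)[OF s s']
        coset(4)[OF single_pair_closed[OF M.a_closed[OF m m'] n] F.a_closed[OF s s']] .
  next
    fix n' assume n': "n' \<in> carrier N"
    note s' = single_pair_closed[OF m n']
    have "single R (m, n \<oplus>\<^bsub>N\<^esub> n') \<ominus>\<^bsub>FMN\<^esub> (single R (m, n) \<oplus>\<^bsub>FMN\<^esub> single R (m, n')) \<in> KMN"
      by (rule relation_in_K) (use m n n' in \<open>unfold tensor_relations_def Let_def, blast\<close>)
    then show "pMN m (n \<oplus>\<^bsub>N\<^esub> n') = pMN m n \<oplus>\<^bsub>TMN\<^esub> pMN m n'"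
      unfolding pure_tensor_def coset(2)[OF s s']
        coset(4)[OF single_pair_closed[OF m N.a_closed[OF n n']] F.a_closed[OF s s']] .
  next
    fix r assume r: "r \<in> carrier R"
    have "single R (r \<odot>\<^bsub>M\<^esub> m, n) \<ominus>\<^bsub>FMN\<^esub> r \<odot>\<^bsub>FMN\<^esub> single R (m, n) \<in> KMN"
      by (rule relation_in_K) (use r m n in \<open>unfold tensor_relations_def Let_def, blast\<close>)
    then show "pMN (r \<odot>\<^bsub>M\<^esub> m) n = r \<odot>\<^bsub>TMN\<^esub> pMN m n"
      unfolding pure_tensor_def coset(3)[OF r s]
        coset(4)[OF single_pair_closed[OF M.smult_closed[OF r m] n] F.smult_closed[OF r s]] .
    have "single R (m, r \<odot>\<^bsub>N\<^esub> n) \<ominus>\<^bsub>FMN\<^esub> r \<odot>\<^bsub>FMN\<^esub> single R (m, n) \<in> KMN"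
      by (rule relation_in_K) (use r m n in \<open>unfold tensor_relations_def Let_def, blast\<close>)
    then show "pMN m (r \<odot>\<^bsub>N\<^esub> n) = r \<odot>\<^bsub>TMN\<^esub> pMN m n"
      unfolding pure_tensor_def coset(3)[OF r s]
        coset(4)[OF single_pair_closed[OF m N.smult_closed[OF r n]] F.smult_closed[OF r s]] .
  }
qed

text \<open>
  Every tensor is a sum of pure ones; no case for scalars arises because a pure tensor absorbs
  them.
\<close>

lemma tensor_induct [consumes 1, case_names pure add]:
  assumes t: "t \<in> carrier TMN"
    and pure: "\<And>m n. \<lbrakk>m \<in> carrier M; n \<in> carrier N\<rbrakk> \<Longrightarrow> P (pMN m n)"
    and add: "\<And>s t. \<lbrakk>s \<in> carrier TMN; t \<in> carrier TMN; P s; P t\<rbrakk> \<Longrightarrow> P (s \<oplus>\<^bsub>TMN\<^esub> t)"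
  shows "P t"
proof -
  have "P (KMN +>\<^bsub>FMN\<^esub> q)" if "q \<in> carrier FMN" for q
    using M.R.is_cring that
  proof (induction q rule: free_module_induct)
    case zero
    have "pMN \<zero>\<^bsub>M\<^esub> \<zero>\<^bsub>N\<^esub> = \<zero>\<^bsub>TMN\<^esub>"
      using linear_map_zero[OF N T.module_axioms bilinear_map_right[OF pure_tensor_bilinear]] by simp
    also have "\<dots> = KMN +>\<^bsub>FMN\<^esub> \<zero>\<^bsub>FMN\<^esub>"
      using coset_zero[OF F.module_axioms K] by (simp only: tensor_product_def)
    finally show ?case using pure[OF M.M.zero_closed N.M.zero_closed] by simp
  next
    case (step r s q)
    obtain m n where s: "s = (m, n)" "m \<in> carrier M" "n \<in> carrier N" using step(2) by auto
    note sc = single_pair_closed[OF s(2,3)]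
    have "KMN +>\<^bsub>FMN\<^esub> (r \<odot>\<^bsub>FMN\<^esub> single R s \<oplus>\<^bsub>FMN\<^esub> q) = pMN (r \<odot>\<^bsub>M\<^esub> m) n \<oplus>\<^bsub>TMN\<^esub> (KMN +>\<^bsub>FMN\<^esub> q)"
      unfolding s(1) coset(2)[OF F.smult_closed[OF step(1) sc] step(3), symmetric]
        coset(3)[OF step(1) sc, symmetric] bilinear_map_smult_left[OF pure_tensor_bilinear s(2,3) step(1)]
      by (simp add: pure_tensor_def)
    moreover have "P (pMN (r \<odot>\<^bsub>M\<^esub> m) n \<oplus>\<^bsub>TMN\<^esub> (KMN +>\<^bsub>FMN\<^esub> q))"
      using step s by (intro add pure coset(1) bilinear_map_closed[OF pure_tensor_bilinear]) auto
    ultimately show ?case by simp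
  qed
  then show ?thesis
    using t by (auto simp: tensor_product_def quotient_module_simps)
qed

lemma tensor_linear_eq:
  assumes f: "linear_map R TMN P f" and g: "linear_map R TMN P g"
    and eq: "\<And>m n. \<lbrakk>m \<in> carrier M; n \<in> carrier N\<rbrakk> \<Longrightarrow> f (pMN m n) = g (pMN m n)"
    and t: "t \<in> carrier TMN"
  shows "f t = g t"
  using t by (induction t rule: tensor_induct) (auto simp: eq linear_map_add[OF f] linear_map_add[OF g])

lemma tensor_product_universal:
  assumes P: "module R P" and f: "bilinear_map R M N P f"
  obtains h where "linear_map R TMN P h" "\<And>m n. \<lbrakk>m \<in> carrier M; n \<in> carrier N\<rbrakk> \<Longrightarrow> h (pMN m n) = f m n"
proof -
  interpret P: module R P by fact
  note fc = bilinear_map_closed[OF f]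
  obtain k where k: "linear_map R FMN P k"
    and kf': "\<And>s. s \<in> carrier M \<times> carrier N \<Longrightarrow> k (single R s) = (\<lambda>(m, n). f m n) s"
    by (rule free_module_universal[OF M.R.is_cring P, of "\<lambda>(m, n). f m n" "carrier M \<times> carrier N"])
      (use fc in \<open>auto intro: that\<close>)
  have kf: "k (single R (m, n)) = f m n" if "m \<in> carrier M" "n \<in> carrier N" for m n
    using kf'[of "(m, n)"] that by simp
  note minus = linear_map_minus[OF F.module_axioms P k]
  have "k q = \<zero>\<^bsub>P\<^esub>" if "q \<in> tensor_relations R M N" for q
    using that
  proof (cases rule: tensor_relation_cases)
    case (add_left m m' n)
    note s = single_pair_closed[OF add_left(1,3)] single_pair_closed[OF add_left(2,3)]
      single_pair_closed[OF M.a_closed[OF add_left(1,2)] add_left(3)]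
    show ?thesis
      unfolding add_left(4) minus[OF s(3) F.a_closed[OF s(1,2)]] linear_map_add[OF k s(1,2)]
      using add_left fc by (simp add: kf bilinear_map_add_left[OF f] P.minus_eq P.r_neg)
  next
    case (add_right m n n')
    note s = single_pair_closed[OF add_right(1,2)] single_pair_closed[OF add_right(1,3)]
      single_pair_closed[OF add_right(1) N.a_closed[OF add_right(2,3)]]
    show ?thesis
      unfolding add_right(4) minus[OF s(3) F.a_closed[OF s(1,2)]] linear_map_add[OF k s(1,2)]
      using add_right fc by (simp add: kf bilinear_map_add_right[OF f] P.minus_eq P.r_neg)
  next
    case (smult_left r m n)
    note s = single_pair_closed[OF smult_left(2,3)]
      single_pair_closed[OF M.smult_closed[OF smult_left(1,2)] smult_left(3)]
    show ?thesis
      unfolding smult_left(4) minus[OF s(2) F.smult_closed[OF smult_left(1) s(1)]]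
        linear_map_smult[OF k smult_left(1) s(1)]
      using smult_left fc by (simp add: kf bilinear_map_smult_left[OF f] P.minus_eq P.r_neg)
  next
    case (smult_right r m n)
    note s = single_pair_closed[OF smult_right(2,3)]
      single_pair_closed[OF smult_right(2) N.smult_closed[OF smult_right(1,3)]]
    show ?thesis
      unfolding smult_right(4) minus[OF s(2) F.smult_closed[OF smult_right(1) s(1)]]
        linear_map_smult[OF k smult_right(1) s(1)]
      using smult_right fc by (simp add: kf bilinear_map_smult_right[OF f] P.minus_eq P.r_neg)
  qed
  then have "tensor_relations R M N \<subseteq> {q \<in> carrier FMN. k q = \<zero>\<^bsub>P\<^esub>}"
    using tensor_relations_closed by blast
  moreover have "submodule {q \<in> carrier FMN. k q = \<zero>\<^bsub>P\<^esub>} R FMN"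
    using linear_map_zero[OF F.module_axioms P k] linear_map_add[OF k] linear_map_smult[OF k]
    by (intro submodule_CollectI[OF F.module_axioms]) (simp_all del: free_module_simps)
  ultimately have "KMN \<subseteq> {q \<in> carrier FMN. k q = \<zero>\<^bsub>P\<^esub>}"
    unfolding tensor_submodule_def
    by (intro submodule_span_minimal[OF F.module_axioms tensor_relations_closed])
  then have van: "k q = \<zero>\<^bsub>P\<^esub>" if "q \<in> KMN" for q using that by blast
  obtain h where h: "linear_map R (quotient_module FMN KMN) P h"
    and hq: "\<And>q. q \<in> carrier FMN \<Longrightarrow> h (KMN +>\<^bsub>FMN\<^esub> q) = k q"
    by (rule quotient_module_factor[OF F.module_axioms K P k], erule van) (rule that)
  have "h (pMN m n) = f m n" if "m \<in> carrier M" "n \<in> carrier N" for m n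
    unfolding pure_tensor_def hq[OF single_pair_closed[OF that]] by (rule kf[OF that])
  then show thesis by (rule that[OF h[folded tensor_product_def]])
qed

lemma tensor_lift:
  assumes P: "module R P" and f: "bilinear_map R M N P f"
  shows tensor_lift_linear: "linear_map R TMN P (tensor_lift R M N P f)"
    and tensor_lift_pure:
      "\<lbrakk>m \<in> carrier M; n \<in> carrier N\<rbrakk> \<Longrightarrow> tensor_lift R M N P f (pMN m n) = f m n"
proof -
  let ?P = "\<lambda>h. linear_map R TMN P h \<and> (\<forall>m\<in>carrier M. \<forall>n\<in>carrier N. h (pMN m n) = f m n)"
  obtain h where "linear_map R TMN P h" "\<And>m n. \<lbrakk>m \<in> carrier M; n \<in> carrier N\<rbrakk> \<Longrightarrow> h (pMN m n) = f m n"
    by (rule tensor_product_universal[OF P f]) (rule that)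
  then have h: "?P h" by simp
  have "?P (tensor_lift R M N P f)"
    unfolding tensor_lift_def
  proof (rule THE_extensional[where P = ?P, OF h])
    show "h' x \<in> carrier P" if "?P h'" "x \<in> carrier TMN" for h' x
      using that(1)[THEN conjunct1, THEN linear_map_closed] that(2) .
    show "?P h2" if "?P h1" "\<And>x. x \<in> carrier TMN \<Longrightarrow> h2 x = h1 x" for h1 h2
      using that linear_map_cong[OF T.module_axioms, of h2 h1 P]
        bilinear_map_closed[OF pure_tensor_bilinear] by auto
    show "h1 x = h2 x" if "?P h1" "?P h2" "x \<in> carrier TMN" for h1 h2 x
      by (rule tensor_linear_eq[OF that(1)[THEN conjunct1] that(2)[THEN conjunct1] _ that(3)])
        (simp add: that(1,2)[THEN conjunct2, rule_format])
  qed
  then show "linear_map R TMN P (tensor_lift R M N P f)"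
    "\<lbrakk>m \<in> carrier M; n \<in> carrier N\<rbrakk> \<Longrightarrow> tensor_lift R M N P f (pMN m n) = f m n" by auto
qed

text \<open>
  Lifting depends linearly on the map that is lifted. Operations on tensors, such as the product of the smash
  product, are lifts in one argument of lifts in the other, so bilinearity of the inner lift in its parameters is
  what makes the outer one well defined.
\<close>

lemma tensor_lift_linear_parameter:
  assumes P: "module R P" and X: "module R X"
    and f: "\<And>x. x \<in> carrier X \<Longrightarrow> bilinear_map R M N P (f x)"
    and lin: "\<And>m n. \<lbrakk>m \<in> carrier M; n \<in> carrier N\<rbrakk> \<Longrightarrow> linear_map R X P (\<lambda>x. f x m n)"
    and t: "t \<in> carrier TMN"
  shows "linear_map R X P (\<lambda>x. tensor_lift R M N P (f x) t)"
proof -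
  interpret P: module R P by fact
  interpret X: module R X by fact
  note l = tensor_lift_linear[OF P f]
  note lc = linear_map_closed[OF l]
  show ?thesis
    using t
  proof (induction t rule: tensor_induct)
    case (pure m n)
    show ?case
      using lin[OF pure]
      by (subst linear_map_cong[OF X.module_axioms]) (auto simp: tensor_lift_pure[OF P f] pure)
  next
    case (add s t)
    show ?case
    proof (rule linear_mapI)
      fix x y assume x: "x \<in> carrier X" and y: "y \<in> carrier X"
      show "tensor_lift R M N P (f (x \<oplus>\<^bsub>X\<^esub> y)) (s \<oplus>\<^bsub>TMN\<^esub> t) =
        tensor_lift R M N P (f x) (s \<oplus>\<^bsub>TMN\<^esub> t) \<oplus>\<^bsub>P\<^esub> tensor_lift R M N P (f y) (s \<oplus>\<^bsub>TMN\<^esub> t)"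
        using add x y lc by (simp add: linear_map_add[OF l] linear_map_add[OF add(3)]
            linear_map_add[OF add(4)] P.a_ac)
    next
      fix r x assume r: "r \<in> carrier R" and x: "x \<in> carrier X"
      show "tensor_lift R M N P (f (r \<odot>\<^bsub>X\<^esub> x)) (s \<oplus>\<^bsub>TMN\<^esub> t) =
        r \<odot>\<^bsub>P\<^esub> tensor_lift R M N P (f x) (s \<oplus>\<^bsub>TMN\<^esub> t)"
        using add r x lc by (simp add: linear_map_add[OF l] linear_map_smult[OF add(3)]
            linear_map_smult[OF add(4)] P.smult_r_distr)
    qed (use lc add in simp)
  qed
qed

lemma tensor_lift2:
  assumes P: "module R P"
    and f1: "\<And>m n. \<lbrakk>m \<in> carrier M; n \<in> carrier N\<rbrakk> \<Longrightarrow> bilinear_map R M N P (f m n)"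
    and f2: "\<And>m n. \<lbrakk>m \<in> carrier M; n \<in> carrier N\<rbrakk> \<Longrightarrow> bilinear_map R M N P (\<lambda>m' n'. f m' n' m n)"
  shows tensor_lift2_bilinear: "bilinear_map R TMN TMN P (tensor_lift2 R M N P f)"
    and tensor_lift2_pure:
      "\<lbrakk>m \<in> carrier M; n \<in> carrier N; m' \<in> carrier M; n' \<in> carrier N\<rbrakk> \<Longrightarrow>
        tensor_lift2 R M N P f (pMN m n) (pMN m' n') = f m n m' n'"
proof -
  have inner: "bilinear_map R M N P (\<lambda>m n. tensor_lift R M N P (f m n) t)" if t: "t \<in> carrier TMN" for t
    unfolding bilinear_map_def
  proof (intro conjI ballI)
    fix m assume m: "m \<in> carrier M"
    show "linear_map R N P (\<lambda>n. tensor_lift R M N P (f m n) t)"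
      by (rule tensor_lift_linear_parameter[OF P N f1[OF m] bilinear_map_right[OF f2 m] t])
  next
    fix n assume n: "n \<in> carrier N"
    show "linear_map R M P (\<lambda>m. tensor_lift R M N P (f m n) t)"
      by (rule tensor_lift_linear_parameter[OF P M f1[OF _ n] bilinear_map_left[OF f2 n] t])
  qed
  show "bilinear_map R TMN TMN P (tensor_lift2 R M N P f)"
    unfolding bilinear_map_def tensor_lift2_def
  proof (intro conjI ballI)
    fix t assume t: "t \<in> carrier TMN"
    show "linear_map R TMN P (tensor_lift R M N P (\<lambda>m n. tensor_lift R M N P (f m n) t))"
      by (rule tensor_lift_linear[OF P inner[OF t]])
    show "linear_map R TMN P (\<lambda>s. tensor_lift R M N P (\<lambda>m n. tensor_lift R M N P (f m n) s) t)"
      by (rule tensor_lift_linear_parameter[OF P T.module_axioms inner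
            tensor_lift_linear[OF P f1] t])
  qed
  assume mn: "m \<in> carrier M" "n \<in> carrier N" "m' \<in> carrier M" "n' \<in> carrier N"
  then show "tensor_lift2 R M N P f (pMN m n) (pMN m' n') = f m n m' n'"
    unfolding tensor_lift2_def
    by (simp add: tensor_lift_pure[OF P inner] tensor_lift_pure[OF P f1]
        bilinear_map_closed[OF pure_tensor_bilinear])
qed

end

lemma bilinear_map_comp:
  assumes "bilinear_map R M N P f" "linear_map R M' M g" "linear_map R N' N h"
  shows "bilinear_map R M' N' P (\<lambda>x y. f (g x) (h y))"
  using assms(1)[unfolded bilinear_map_def] linear_map_closed[OF assms(2)] linear_map_closed[OF assms(3)]
    linear_map_comp[OF assms(2)] linear_map_comp[OF assms(3)]
  unfolding bilinear_map_def by blast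

lemma linear_map_bilinear_comp:
  assumes "bilinear_map R M N P f" "linear_map R P Q g"
  shows "bilinear_map R M N Q (\<lambda>x y. g (f x y))"
  unfolding bilinear_map_def
  by (intro conjI ballI linear_map_comp[OF bilinear_map_right[OF assms(1)] assms(2)]
      linear_map_comp[OF bilinear_map_left[OF assms(1)] assms(2)])

lemma tensor_product_algebra_simps [simp]:
  "carrier (tensor_product_algebra R A B) = carrier (tensor_product R A B)"
  "zero (tensor_product_algebra R A B) = zero (tensor_product R A B)"
  "add (tensor_product_algebra R A B) = add (tensor_product R A B)"
  "smult (tensor_product_algebra R A B) = smult (tensor_product R A B)"
  "one (tensor_product_algebra R A B) = pure_tensor R A B \<one>\<^bsub>A\<^esub> \<one>\<^bsub>B\<^esub>"
  by (simp_all add: tensor_product_algebra_def)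

context
  fixes R :: "('r, 'e) ring_scheme" and A :: "('r, 'a) module" and B :: "('r, 'b) module"
  assumes A: "assoc_algebra R A" and B: "assoc_algebra R B"
begin

interpretation A: assoc_algebra R A by (rule A)
interpretation B: assoc_algebra R B by (rule B)

private abbreviation "TAB \<equiv> tensor_product R A B"
private abbreviation "WAB \<equiv> tensor_product_algebra R A B"
private abbreviation "pAB a b \<equiv> pure_tensor R A B a b"

interpretation T: module R TAB by (rule module_tensor_product[OF A.module_axioms B.module_axioms])

private lemma pure_bilinear: "bilinear_map R A B TAB (pure_tensor R A B)"
  by (rule pure_tensor_bilinear[OF A.module_axioms B.module_axioms])

private lemma mult_multilinear:
  assumes "a \<in> carrier A" "b \<in> carrier B"
  shows "bilinear_map R A B TAB (\<lambda>a' b'. pAB (a \<otimes>\<^bsub>A\<^esub> a') (b \<otimes>\<^bsub>B\<^esub> b'))"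
    and "bilinear_map R A B TAB (\<lambda>a' b'. pAB (a' \<otimes>\<^bsub>A\<^esub> a) (b' \<otimes>\<^bsub>B\<^esub> b))"
  using assms
  by (auto intro!: bilinear_map_comp[OF pure_bilinear] bilinear_map_left[OF A.mult_bilinear]
      bilinear_map_left[OF B.mult_bilinear] bilinear_map_right[OF A.mult_bilinear]
      bilinear_map_right[OF B.mult_bilinear])

lemma tensor_product_algebra_mult_pure:
  "\<lbrakk>a \<in> carrier A; b \<in> carrier B; a' \<in> carrier A; b' \<in> carrier B\<rbrakk> \<Longrightarrow>
    pAB a b \<otimes>\<^bsub>WAB\<^esub> pAB a' b' = pAB (a \<otimes>\<^bsub>A\<^esub> a') (b \<otimes>\<^bsub>B\<^esub> b')"
  unfolding tensor_product_algebra_def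
  by (simp add: tensor_lift2_pure[OF A.module_axioms B.module_axioms T.module_axioms mult_multilinear])

private lemma mult_bilinear_T: "bilinear_map R TAB TAB TAB (\<otimes>\<^bsub>WAB\<^esub>)"
  unfolding tensor_product_algebra_def
  using tensor_lift2_bilinear[OF A.module_axioms B.module_axioms T.module_axioms mult_multilinear]
  by simp

lemma assoc_algebra_tensor_product_algebra: "assoc_algebra R WAB"
proof (rule assoc_algebraI)
  note pc [simp] = bilinear_map_closed[OF pure_bilinear]
  note mc [simp] = bilinear_map_closed[OF mult_bilinear_T]
  note [simp] = bilinear_map_add_left[OF mult_bilinear_T] bilinear_map_add_right[OF mult_bilinear_T]
  note induct = tensor_induct[OF A.module_axioms B.module_axioms, consumes 1, case_names pure add]
  show "module R WAB" by (rule module_cong[OF T.module_axioms]) simp_all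
  show "bilinear_map R WAB WAB WAB (\<otimes>\<^bsub>WAB\<^esub>)"
    using mult_bilinear_T by (simp add: bilinear_map_def linear_map_def)
  have assoc: "s \<otimes>\<^bsub>WAB\<^esub> t \<otimes>\<^bsub>WAB\<^esub> u = s \<otimes>\<^bsub>WAB\<^esub> (t \<otimes>\<^bsub>WAB\<^esub> u)"
    if "s \<in> carrier TAB" "t \<in> carrier TAB" "u \<in> carrier TAB" for s t u
    using that(1)
  proof (induction s rule: induct)
    case (pure a b)
    show ?case using that(2)
    proof (induction t rule: induct)
      case (pure a' b')
      show ?case using that(3)
      proof (induction u rule: induct)
        case (pure a'' b'')
        show ?case using pure \<open>a \<in> _\<close> \<open>b \<in> _\<close> \<open>a' \<in> _\<close> \<open>b' \<in> _\<close>
          by (simp add: tensor_product_algebra_mult_pure A.m_assoc B.m_assoc)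
      qed (use pure \<open>a \<in> _\<close> \<open>b \<in> _\<close> in simp)
    qed (use pure that in simp)
  qed (use that in simp)
  have one: "pAB \<one>\<^bsub>A\<^esub> \<one>\<^bsub>B\<^esub> \<otimes>\<^bsub>WAB\<^esub> t = t \<and> t \<otimes>\<^bsub>WAB\<^esub> pAB \<one>\<^bsub>A\<^esub> \<one>\<^bsub>B\<^esub> = t" if "t \<in> carrier TAB" for t
    using that by (induction t rule: induct) (auto simp: tensor_product_algebra_mult_pure)
  show "monoid WAB" using assoc one by (intro monoidI) auto
qed

end

lemma base_algebra_simps [simp]:
  "carrier (base_algebra R) = carrier R" "zero (base_algebra R) = \<zero>\<^bsub>R\<^esub>" "add (base_algebra R) = add R"
  "mult (base_algebra R) = mult R" "one (base_algebra R) = \<one>\<^bsub>R\<^esub>" "smult (base_algebra R) = mult R"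
  by (simp_all add: base_algebra_def)

lemma assoc_algebra_base_algebra:
  assumes "cring R"
  shows "assoc_algebra R (base_algebra R)"
proof -
  interpret cring R by fact
  have "abelian_group (base_algebra R)"
    by (intro abelian_groupI) (auto simp: a_ac intro: bexI[of _ "\<ominus>\<^bsub>R\<^esub> _"] l_neg)
  then have "module R (base_algebra R)"
    by (intro moduleI assms) (auto simp: l_distr r_distr m_assoc)
  then show ?thesis
    by (rule assoc_algebraI)
      (auto intro!: monoidI bilinear_mapI simp: m_assoc l_distr r_distr m_lcomm)
qed

context
  fixes R :: "('r, 'e) ring_scheme" and L :: "('r, 'g) lie"
  assumes L: "lie_algebra R L"
begin

interpretation L: lie_algebra R L by (rule L)

private abbreviation "UL \<equiv> ULie R L"
private abbreviation "\<iota>L \<equiv> ULie_gen R L"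
private abbreviation "UUL \<equiv> tensor_product_algebra R UL UL"
private abbreviation "pL \<equiv> pure_tensor R UL UL"

interpretation U: assoc_algebra R UL by (rule assoc_algebra_ULie[OF L])

interpretation UU: assoc_algebra R UUL
  by (rule assoc_algebra_tensor_product_algebra[OF U.assoc_algebra_axioms U.assoc_algebra_axioms])

private lemma iota_closed: "x \<in> carrier L \<Longrightarrow> \<iota>L x \<in> carrier UL"
  by (rule linear_map_closed[OF ULie_gen_linear[OF L]])

private lemma p_bilinear: "bilinear_map R UL UL UUL pL"
  using pure_tensor_bilinear[OF U.module_axioms U.module_axioms]
  by (simp add: bilinear_map_def linear_map_def)

text \<open>
  The map \<open>x \<mapsto> \<one> \<otimes> x + x \<otimes> \<one>\<close> respects brackets: in the product of its values at \<open>x\<close> and \<open>y\<close> the mixed terms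
  \<open>x \<otimes> y + y \<otimes> x\<close> are symmetric, so they cancel in the commutator.
\<close>

lemma ULie_comult:
  shows ULie_comult_hom: "algebra_hom R UL UUL (ULie_comult R L)"
    and ULie_comult_gen: "x \<in> carrier L \<Longrightarrow> ULie_comult R L (\<iota>L x) =
      pL \<one>\<^bsub>UL\<^esub> (\<iota>L x) \<oplus>\<^bsub>UUL\<^esub> pL (\<iota>L x) \<one>\<^bsub>UL\<^esub>"
proof -
  let ?\<delta> = "\<lambda>x. pL \<one>\<^bsub>UL\<^esub> (\<iota>L x) \<oplus>\<^bsub>UUL\<^esub> pL (\<iota>L x) \<one>\<^bsub>UL\<^esub>"
  let ?P = "\<lambda>\<Delta>. algebra_hom R UL UUL \<Delta> \<and> (\<forall>x\<in>carrier L. \<Delta> (\<iota>L x) = ?\<delta> x)"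
  note pc = bilinear_map_closed[OF p_bilinear]
  have bc: "bracket L x y \<in> carrier L" if "x \<in> carrier L" "y \<in> carrier L" for x y
    by (rule bilinear_map_closed[OF L.bracket_bilinear that])
  have mult: "pL a b \<otimes>\<^bsub>UUL\<^esub> pL a' b' = pL (a \<otimes>\<^bsub>UL\<^esub> a') (b \<otimes>\<^bsub>UL\<^esub> b')"
    if "a \<in> carrier UL" "b \<in> carrier UL" "a' \<in> carrier UL" "b' \<in> carrier UL" for a b a' b'
    using that by (rule tensor_product_algebra_mult_pure[OF U.assoc_algebra_axioms U.assoc_algebra_axioms])
  note lin = ULie_gen_linear[OF L]
  have \<delta>_lin: "linear_map R L UUL ?\<delta>"
    using pc iota_closed
    by (intro linear_mapI)
      (simp_all del: tensor_product_algebra_simps add: linear_map_add[OF lin] linear_map_smult[OF lin]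
        bilinear_map_add_left[OF p_bilinear] bilinear_map_add_right[OF p_bilinear]
        bilinear_map_smult_left[OF p_bilinear] bilinear_map_smult_right[OF p_bilinear]
        UU.smult_r_distr UU.a_ac)
  have \<delta>_comm: "?\<delta> x \<otimes>\<^bsub>UUL\<^esub> ?\<delta> y = ?\<delta> (bracket L x y) \<oplus>\<^bsub>UUL\<^esub> ?\<delta> y \<otimes>\<^bsub>UUL\<^esub> ?\<delta> x"
    if x: "x \<in> carrier L" and y: "y \<in> carrier L" for x y
  proof -
    note c = iota_closed[OF x] iota_closed[OF y] iota_closed[OF bc[OF x y]]
    have expand: "?\<delta> x \<otimes>\<^bsub>UUL\<^esub> ?\<delta> y = (pL \<one>\<^bsub>UL\<^esub> (\<iota>L x \<otimes>\<^bsub>UL\<^esub> \<iota>L y) \<oplus>\<^bsub>UUL\<^esub> pL (\<iota>L x \<otimes>\<^bsub>UL\<^esub> \<iota>L y) \<one>\<^bsub>UL\<^esub>) \<oplus>\<^bsub>UUL\<^esub>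
      (pL (\<iota>L x) (\<iota>L y) \<oplus>\<^bsub>UUL\<^esub> pL (\<iota>L y) (\<iota>L x))" if "\<iota>L x \<in> carrier UL" "\<iota>L y \<in> carrier UL" for x y
      using that pc
      by (simp del: tensor_product_algebra_simps add: UU.l_distr UU.r_distr mult UU.a_ac)
    have "pL \<one>\<^bsub>UL\<^esub> (\<iota>L x \<otimes>\<^bsub>UL\<^esub> \<iota>L y) = pL \<one>\<^bsub>UL\<^esub> (\<iota>L (bracket L x y)) \<oplus>\<^bsub>UUL\<^esub> pL \<one>\<^bsub>UL\<^esub> (\<iota>L y \<otimes>\<^bsub>UL\<^esub> \<iota>L x)"
      unfolding ULie_gen_bracket[OF L x y] using c
      by (intro bilinear_map_add_right[OF p_bilinear]) auto
    moreover have "pL (\<iota>L x \<otimes>\<^bsub>UL\<^esub> \<iota>L y) \<one>\<^bsub>UL\<^esub> = pL (\<iota>L (bracket L x y)) \<one>\<^bsub>UL\<^esub> \<oplus>\<^bsub>UUL\<^esub> pL (\<iota>L y \<otimes>\<^bsub>UL\<^esub> \<iota>L x) \<one>\<^bsub>UL\<^esub>"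
      unfolding ULie_gen_bracket[OF L x y] using c
      by (intro bilinear_map_add_left[OF p_bilinear]) auto
    ultimately show ?thesis
      unfolding expand[OF c(1,2)] expand[OF c(2,1)] using c pc
      by (simp del: tensor_product_algebra_simps add: UU.a_ac)
  qed
  obtain \<Delta> where "algebra_hom R UL UUL \<Delta>" "\<And>x. x \<in> carrier L \<Longrightarrow> \<Delta> (\<iota>L x) = ?\<delta> x"
    by (rule ULie_universal[OF L UU.assoc_algebra_axioms \<delta>_lin \<delta>_comm]) (assumption+, rule that)
  then have \<Delta>: "?P \<Delta>" by simp
  have "?P (ULie_comult R L)"
    unfolding ULie_comult_def Let_def
  proof (rule THE_extensional[where P = ?P, OF \<Delta>])
    show "h x \<in> carrier UUL" if "?P h" "x \<in> carrier UL" for h x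
      using that(1)[THEN conjunct1, THEN algebra_hom_linear, THEN linear_map_closed] that(2) .
    show "?P h'" if "?P h" "\<And>x. x \<in> carrier UL \<Longrightarrow> h' x = h x" for h h'
      using that algebra_hom_cong[OF U.assoc_algebra_axioms, of UUL h h'] iota_closed by auto
    show "h x = h' x" if "?P h" "?P h'" "x \<in> carrier UL" for h h' x
      by (rule algebra_hom_unique[OF U.assoc_algebra_axioms generates_ULie[OF L]
            that(1)[THEN conjunct1] that(2)[THEN conjunct1] _ that(3)])
        (use that(1,2)[THEN conjunct2] in auto)
  qed
  then show "algebra_hom R UL UUL (ULie_comult R L)"
    "x \<in> carrier L \<Longrightarrow> ULie_comult R L (\<iota>L x) = ?\<delta> x" by auto
qed

lemma ULie_counit:
  shows ULie_counit_hom: "algebra_hom R UL (base_algebra R) (ULie_counit R L)"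
    and ULie_counit_gen: "x \<in> carrier L \<Longrightarrow> ULie_counit R L (\<iota>L x) = \<zero>\<^bsub>R\<^esub>"
proof -
  let ?P = "\<lambda>\<epsilon>. algebra_hom R UL (base_algebra R) \<epsilon> \<and> (\<forall>x\<in>carrier L. \<epsilon> (\<iota>L x) = \<zero>\<^bsub>R\<^esub>)"
  interpret B: assoc_algebra R "base_algebra R"
    by (rule assoc_algebra_base_algebra[OF L.R.is_cring])
  have lin: "linear_map R L (base_algebra R) (\<lambda>_. \<zero>\<^bsub>R\<^esub>)" by (auto intro: linear_mapI)
  obtain \<epsilon> where "algebra_hom R UL (base_algebra R) \<epsilon>" "\<And>x. x \<in> carrier L \<Longrightarrow> \<epsilon> (\<iota>L x) = \<zero>\<^bsub>R\<^esub>"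
    by (rule ULie_universal[OF L B.assoc_algebra_axioms lin]) (simp, rule that)
  then have \<epsilon>: "?P \<epsilon>" by simp
  have "?P (ULie_counit R L)"
    unfolding ULie_counit_def Let_def
  proof (rule THE_extensional[where P = ?P, OF \<epsilon>])
    show "h x \<in> carrier R" if "?P h" "x \<in> carrier UL" for h x
      using that(1)[THEN conjunct1, THEN algebra_hom_linear, THEN linear_map_closed] that(2) by simp
    show "?P h'" if "?P h" "\<And>x. x \<in> carrier UL \<Longrightarrow> h' x = h x" for h h'
      using that algebra_hom_cong[OF U.assoc_algebra_axioms, of "base_algebra R" h h'] iota_closed by auto
    show "h x = h' x" if "?P h" "?P h'" "x \<in> carrier UL" for h h' x
      by (rule algebra_hom_unique[OF U.assoc_algebra_axioms generates_ULie[OF L]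
            that(1)[THEN conjunct1] that(2)[THEN conjunct1] _ that(3)])
        (use that(1,2)[THEN conjunct2] in auto)
  qed
  then show "algebra_hom R UL (base_algebra R) (ULie_counit R L)"
    "x \<in> carrier L \<Longrightarrow> ULie_counit R L (\<iota>L x) = \<zero>\<^bsub>R\<^esub>" by auto
qed

text \<open>
  A Sweedler sum over a product \<open>x u\<close> with \<open>x\<close> primitive, in terms of one over \<open>u\<close>. As the enveloping algebra is
  generated under left multiplication by the elements of the Lie algebra, inductions over it see the
  coproduct through this formula, linearity and the value at \<open>\<one>\<close>.
\<close>

lemma sweedler_mult_gen:
  assumes P: "module R P" and f: "bilinear_map R UL UL P f" and x: "x \<in> carrier L" and u: "u \<in> carrier UL"
  shows "tensor_lift R UL UL P f (ULie_comult R L (\<iota>L x \<otimes>\<^bsub>UL\<^esub> u)) =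
    tensor_lift R UL UL P (\<lambda>u\<^sub>1 u\<^sub>2. f u\<^sub>1 (\<iota>L x \<otimes>\<^bsub>UL\<^esub> u\<^sub>2) \<oplus>\<^bsub>P\<^esub> f (\<iota>L x \<otimes>\<^bsub>UL\<^esub> u\<^sub>1) u\<^sub>2) (ULie_comult R L u)"
proof -
  interpret P: module R P by fact
  let ?\<delta> = "pL \<one>\<^bsub>UL\<^esub> (\<iota>L x) \<oplus>\<^bsub>UUL\<^esub> pL (\<iota>L x) \<one>\<^bsub>UL\<^esub>"
  let ?f = "\<lambda>u\<^sub>1 u\<^sub>2. f u\<^sub>1 (\<iota>L x \<otimes>\<^bsub>UL\<^esub> u\<^sub>2) \<oplus>\<^bsub>P\<^esub> f (\<iota>L x \<otimes>\<^bsub>UL\<^esub> u\<^sub>1) u\<^sub>2"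
  note c = iota_closed[OF x] and fc = bilinear_map_closed[OF f]
  note pc = bilinear_map_closed[OF p_bilinear]
  have \<delta>: "?\<delta> \<in> carrier UUL" using pc c by (simp del: tensor_product_algebra_simps)
  have f': "bilinear_map R UL UL P ?f"
    using c fc
    by (intro bilinear_mapI)
      (simp_all add: bilinear_map_add_left[OF f] bilinear_map_add_right[OF f] U.r_distr
        bilinear_map_smult_left[OF f] bilinear_map_smult_right[OF f] U.smult_mult_right P.a_ac
        P.smult_r_distr)
  note l = tensor_lift_linear[OF U.module_axioms U.module_axioms P f]
  note l' = tensor_lift_linear[OF U.module_axioms U.module_axioms P f']
  have lift: "tensor_lift R UL UL P f (?\<delta> \<otimes>\<^bsub>UUL\<^esub> t) = tensor_lift R UL UL P ?f t"
    if "t \<in> carrier (tensor_product R UL UL)" for t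
  proof (rule tensor_linear_eq[OF U.module_axioms U.module_axioms _ l' _ that])
    have "linear_map R (tensor_product R UL UL) (tensor_product R UL UL) (\<lambda>t. ?\<delta> \<otimes>\<^bsub>UUL\<^esub> t)"
      using bilinear_map_right[OF UU.mult_bilinear \<delta>] by (simp add: linear_map_def)
    then show "linear_map R (tensor_product R UL UL) P (\<lambda>t. tensor_lift R UL UL P f (?\<delta> \<otimes>\<^bsub>UUL\<^esub> t))"
      by (rule linear_map_comp[OF _ l])
    fix u\<^sub>1 u\<^sub>2 assume u: "u\<^sub>1 \<in> carrier UL" "u\<^sub>2 \<in> carrier UL"
    have "?\<delta> \<otimes>\<^bsub>UUL\<^esub> pL u\<^sub>1 u\<^sub>2 = pL u\<^sub>1 (\<iota>L x \<otimes>\<^bsub>UL\<^esub> u\<^sub>2) \<oplus>\<^bsub>UUL\<^esub> pL (\<iota>L x \<otimes>\<^bsub>UL\<^esub> u\<^sub>1) u\<^sub>2"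
      using u c pc
      by (simp del: tensor_product_algebra_simps add: UU.l_distr
          tensor_product_algebra_mult_pure[OF U.assoc_algebra_axioms U.assoc_algebra_axioms])
    then show "tensor_lift R UL UL P f (?\<delta> \<otimes>\<^bsub>UUL\<^esub> pL u\<^sub>1 u\<^sub>2) = tensor_lift R UL UL P ?f (pL u\<^sub>1 u\<^sub>2)"
      using u c pc
      by (simp add: linear_map_add[OF l] tensor_lift_pure[OF U.module_axioms U.module_axioms P f]
          tensor_lift_pure[OF U.module_axioms U.module_axioms P f'])
  qed
  have "ULie_comult R L u \<in> carrier UUL"
    by (rule linear_map_closed[OF algebra_hom_linear[OF ULie_comult_hom] u])
  then show ?thesis
    using lift by (simp add: algebra_hom_mult[OF ULie_comult_hom c u] ULie_comult_gen[OF x])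
qed

lemma sweedler_one:
  assumes P: "module R P" and f: "bilinear_map R UL UL P f"
  shows "tensor_lift R UL UL P f (ULie_comult R L \<one>\<^bsub>UL\<^esub>) = f \<one>\<^bsub>UL\<^esub> \<one>\<^bsub>UL\<^esub>"
  using tensor_lift_pure[OF U.module_axioms U.module_axioms P f, of "\<one>\<^bsub>UL\<^esub>" "\<one>\<^bsub>UL\<^esub>"]
  by (simp add: algebra_hom_one[OF ULie_comult_hom])

lemma sweedler_linear:
  assumes P: "module R P" and f: "bilinear_map R UL UL P f"
  shows "linear_map R UL P (\<lambda>u. tensor_lift R UL UL P f (ULie_comult R L u))"
proof (rule linear_map_comp[OF _ tensor_lift_linear[OF U.module_axioms U.module_axioms P f]])
  show "linear_map R UL (tensor_product R UL UL) (ULie_comult R L)"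
    using algebra_hom_linear[OF ULie_comult_hom] by (simp add: linear_map_def)
qed

end

section \<open>Derivations of the symmetric algebra\<close>

definition derivation ::
  "('r, 'e) ring_scheme \<Rightarrow> ('r, 's) module \<Rightarrow> ('r, 'm) module \<Rightarrow> ('s \<Rightarrow> 'm \<Rightarrow> 'm) \<Rightarrow> ('s \<Rightarrow> 'm) \<Rightarrow> bool"
  where "derivation R S M \<rho> D \<longleftrightarrow> linear_map R S M D \<and>
    (\<forall>a\<in>carrier S. \<forall>b\<in>carrier S. D (a \<otimes>\<^bsub>S\<^esub> b) = \<rho> a (D b) \<oplus>\<^bsub>M\<^esub> \<rho> b (D a))"

lemma derivationD:
  assumes "derivation R S M \<rho> D"
  shows derivation_linear: "linear_map R S M D"
    and derivation_mult: "\<lbrakk>a \<in> carrier S; b \<in> carrier S\<rbrakk> \<Longrightarrow>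
      D (a \<otimes>\<^bsub>S\<^esub> b) = \<rho> a (D b) \<oplus>\<^bsub>M\<^esub> \<rho> b (D a)"
  using assms by (auto simp: derivation_def)

lemma derivationI:
  assumes "linear_map R S M D"
    and "\<And>a b. \<lbrakk>a \<in> carrier S; b \<in> carrier S\<rbrakk> \<Longrightarrow> D (a \<otimes>\<^bsub>S\<^esub> b) = \<rho> a (D b) \<oplus>\<^bsub>M\<^esub> \<rho> b (D a)"
  shows "derivation R S M \<rho> D"
  using assms by (auto simp: derivation_def)

lemma left_module_actionD:
  assumes "left_module_action R H A act"
  shows left_module_action_bilinear: "bilinear_map R H A A act"
    and left_module_action_one: "a \<in> carrier A \<Longrightarrow> act \<one>\<^bsub>H\<^esub> a = a"
    and left_module_action_mult:
      "\<lbrakk>u \<in> carrier H; v \<in> carrier H; a \<in> carrier A\<rbrakk> \<Longrightarrow> act (u \<otimes>\<^bsub>H\<^esub> v) a = act u (act v a)"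
  using assms by (auto simp: left_module_action_def)

lemma left_module_actionI:
  assumes "bilinear_map R H A A act" "\<And>a. a \<in> carrier A \<Longrightarrow> act \<one>\<^bsub>H\<^esub> a = a"
    and "\<And>u v a. \<lbrakk>u \<in> carrier H; v \<in> carrier H; a \<in> carrier A\<rbrakk> \<Longrightarrow> act (u \<otimes>\<^bsub>H\<^esub> v) a = act u (act v a)"
  shows "left_module_action R H A act"
  using assms by (auto simp: left_module_action_def)

lemma left_module_action_hom:
  assumes S: "assoc_algebra R S" and V: "assoc_algebra R V" and f: "algebra_hom R S V f"
  shows "left_module_action R S V (\<lambda>a v. f a \<otimes>\<^bsub>V\<^esub> v)"
proof -
  interpret V: assoc_algebra R V by fact
  note fc = linear_map_closed[OF algebra_hom_linear[OF f]]
  have "linear_map R V V (\<lambda>v. v)" by (simp add: linear_map_def)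
  from bilinear_map_comp[OF V.mult_bilinear algebra_hom_linear[OF f] this]
  show ?thesis
    by (intro left_module_actionI) (auto simp: algebra_hom_one[OF f] algebra_hom_mult[OF f] fc V.m_assoc)
qed

lemma assoc_algebra_commutative:
  assumes "algebra R S"
  shows "assoc_algebra R S"
proof -
  interpret S: algebra R S by fact
  have "x \<otimes>\<^bsub>S\<^esub> (r \<odot>\<^bsub>S\<^esub> y) = r \<odot>\<^bsub>S\<^esub> (x \<otimes>\<^bsub>S\<^esub> y)"
    if "r \<in> carrier R" "x \<in> carrier S" "y \<in> carrier S" for r x y
    using S.smult_assoc2[OF that(1,3,2)] that by (simp add: S.m_comm)
  then show ?thesis
    by (intro assoc_algebra.intro assoc_algebra_axioms.intro S.module_axioms S.ring_axioms)
      (auto simp: S.smult_assoc2)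
qed

text \<open>
  The square-zero extension of \<open>S\<close> by the module \<open>M\<close>. An algebra homomorphism from \<open>S\<close> into it that lifts
  the identity is the same as a derivation from \<open>S\<close> to \<open>M\<close>; this is how a universal property for
  homomorphisms becomes one for derivations.
\<close>

definition square_zero_extension ::
  "('r, 's) module \<Rightarrow> ('r, 'm) module \<Rightarrow> ('s \<Rightarrow> 'm \<Rightarrow> 'm) \<Rightarrow> ('r, 's \<times> 'm) module"
  where "square_zero_extension S M \<rho> =
    \<lparr>carrier = carrier S \<times> carrier M,
     mult = (\<lambda>(a, m) (b, n). (a \<otimes>\<^bsub>S\<^esub> b, \<rho> a n \<oplus>\<^bsub>M\<^esub> \<rho> b m)), one = (\<one>\<^bsub>S\<^esub>, \<zero>\<^bsub>M\<^esub>),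
     zero = (\<zero>\<^bsub>S\<^esub>, \<zero>\<^bsub>M\<^esub>), add = (\<lambda>(a, m) (b, n). (a \<oplus>\<^bsub>S\<^esub> b, m \<oplus>\<^bsub>M\<^esub> n)),
     smult = (\<lambda>r (a, m). (r \<odot>\<^bsub>S\<^esub> a, r \<odot>\<^bsub>M\<^esub> m))\<rparr>"

lemma square_zero_extension_simps [simp]:
  "carrier (square_zero_extension S M \<rho>) = carrier S \<times> carrier M"
  "(a, m) \<otimes>\<^bsub>square_zero_extension S M \<rho>\<^esub> (b, n) = (a \<otimes>\<^bsub>S\<^esub> b, \<rho> a n \<oplus>\<^bsub>M\<^esub> \<rho> b m)"
  "\<one>\<^bsub>square_zero_extension S M \<rho>\<^esub> = (\<one>\<^bsub>S\<^esub>, \<zero>\<^bsub>M\<^esub>)"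
  "\<zero>\<^bsub>square_zero_extension S M \<rho>\<^esub> = (\<zero>\<^bsub>S\<^esub>, \<zero>\<^bsub>M\<^esub>)"
  "(a, m) \<oplus>\<^bsub>square_zero_extension S M \<rho>\<^esub> (b, n) = (a \<oplus>\<^bsub>S\<^esub> b, m \<oplus>\<^bsub>M\<^esub> n)"
  "r \<odot>\<^bsub>square_zero_extension S M \<rho>\<^esub> (a, m) = (r \<odot>\<^bsub>S\<^esub> a, r \<odot>\<^bsub>M\<^esub> m)"
  by (simp_all add: square_zero_extension_def)

context
  fixes R :: "('r, 'e) ring_scheme" and S :: "('r, 's) module" and M :: "('r, 'm) module"
    and \<rho> :: "'s \<Rightarrow> 'm \<Rightarrow> 'm"
  assumes S: "algebra R S" and M: "module R M" and \<rho>: "left_module_action R S M \<rho>"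
begin

interpretation S: algebra R S by (rule S)
interpretation M: module R M by (rule M)

private lemmas \<rho>_bilinear = left_module_action_bilinear[OF \<rho>]

private lemma \<rho>_simps:
  "\<lbrakk>a \<in> carrier S; m \<in> carrier M\<rbrakk> \<Longrightarrow> \<rho> a m \<in> carrier M"
  "m \<in> carrier M \<Longrightarrow> \<rho> \<one>\<^bsub>S\<^esub> m = m"
  "\<lbrakk>a \<in> carrier S; b \<in> carrier S; m \<in> carrier M\<rbrakk> \<Longrightarrow> \<rho> (a \<otimes>\<^bsub>S\<^esub> b) m = \<rho> a (\<rho> b m)"
  "\<lbrakk>a \<in> carrier S; b \<in> carrier S; m \<in> carrier M\<rbrakk> \<Longrightarrow> \<rho> (a \<oplus>\<^bsub>S\<^esub> b) m = \<rho> a m \<oplus>\<^bsub>M\<^esub> \<rho> b m"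
  "\<lbrakk>a \<in> carrier S; m \<in> carrier M; n \<in> carrier M\<rbrakk> \<Longrightarrow> \<rho> a (m \<oplus>\<^bsub>M\<^esub> n) = \<rho> a m \<oplus>\<^bsub>M\<^esub> \<rho> a n"
  "\<lbrakk>a \<in> carrier S; r \<in> carrier R; m \<in> carrier M\<rbrakk> \<Longrightarrow> \<rho> (r \<odot>\<^bsub>S\<^esub> a) m = r \<odot>\<^bsub>M\<^esub> \<rho> a m"
  "\<lbrakk>a \<in> carrier S; r \<in> carrier R; m \<in> carrier M\<rbrakk> \<Longrightarrow> \<rho> a (r \<odot>\<^bsub>M\<^esub> m) = r \<odot>\<^bsub>M\<^esub> \<rho> a m"
  using left_module_actionD[OF \<rho>] bilinear_mapE[OF \<rho>_bilinear] by auto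

private lemma \<rho>_zero: "a \<in> carrier S \<Longrightarrow> \<rho> a \<zero>\<^bsub>M\<^esub> = \<zero>\<^bsub>M\<^esub>"
  by (rule linear_map_zero[OF M M bilinear_map_right[OF \<rho>_bilinear]])

private lemma \<rho>_comm:
  assumes "a \<in> carrier S" "b \<in> carrier S" "m \<in> carrier M"
  shows "\<rho> a (\<rho> b m) = \<rho> b (\<rho> a m)"
  using \<rho>_simps(3)[OF assms] \<rho>_simps(3)[OF assms(2,1,3)] S.m_comm[OF assms(1,2)] by simp

lemma assoc_algebra_square_zero_extension: "assoc_algebra R (square_zero_extension S M \<rho>)"
proof -
  interpret SA: assoc_algebra R S by (rule assoc_algebra_commutative[OF S])
  let ?E = "square_zero_extension S M \<rho>"
  have inv: "\<exists>y\<in>carrier ?E. y \<oplus>\<^bsub>?E\<^esub> x = \<zero>\<^bsub>?E\<^esub>" if "x \<in> carrier ?E" for x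
    using that by (intro bexI[of _ "(\<ominus>\<^bsub>S\<^esub> fst x, \<ominus>\<^bsub>M\<^esub> snd x)"]) (auto simp: S.l_neg M.l_neg)
  have "abelian_group ?E"
    using inv by (intro abelian_groupI) (auto simp: S.a_ac M.a_ac)
  then have mod: "module R ?E"
    by (intro moduleI S.R.is_cring)
      (auto simp: S.smult_l_distr S.smult_r_distr S.smult_assoc1
        M.smult_l_distr M.smult_r_distr M.smult_assoc1)
  have mon: "monoid ?E"
    by (rule monoidI) (auto simp: \<rho>_simps \<rho>_zero S.m_ac M.a_ac \<rho>_comm)
  have bil: "bilinear_map R ?E ?E ?E (\<otimes>\<^bsub>?E\<^esub>)"
    by (rule bilinear_mapI)
      (auto simp: \<rho>_simps S.l_distr S.r_distr M.a_ac SA.smult_mult_left SA.smult_mult_right M.smult_r_distr)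
  show ?thesis by (rule assoc_algebraI[OF mod mon bil])
qed

lemma derivation_one:
  assumes "derivation R S M \<rho> D"
  shows "D \<one>\<^bsub>S\<^esub> = \<zero>\<^bsub>M\<^esub>"
proof -
  have D1: "D \<one>\<^bsub>S\<^esub> \<in> carrier M" using linear_map_closed[OF derivation_linear[OF assms]] by simp
  have "D \<one>\<^bsub>S\<^esub> = D \<one>\<^bsub>S\<^esub> \<oplus>\<^bsub>M\<^esub> D \<one>\<^bsub>S\<^esub>"
    using derivation_mult[OF assms S.one_closed S.one_closed] D1 by (simp add: \<rho>_simps)
  then show ?thesis using D1 by (metis M.add.l_cancel_one')
qed

lemma derivation_eq:
  assumes g: "generates R S X" and D: "derivation R S M \<rho> D" and E: "derivation R S M \<rho> E"
    and eq: "\<And>x. x \<in> X \<Longrightarrow> D x = E x" and a: "a \<in> carrier S"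
  shows "D a = E a"
  using assoc_algebra_commutative[OF S] g a
proof (induction a rule: generates_induct)
  case one then show ?case using D E by (simp add: derivation_one)
next
  case (mult x a) then show ?case by (simp add: derivation_mult[OF D] derivation_mult[OF E] eq)
next
  case (add a b) then show ?case
    by (simp add: linear_map_add[OF derivation_linear[OF D]] linear_map_add[OF derivation_linear[OF E]])
next
  case (smult r a) then show ?case
    by (simp add: linear_map_smult[OF derivation_linear[OF D]] linear_map_smult[OF derivation_linear[OF E]])
qed

lemma derivation_add:
  assumes D: "derivation R S M \<rho> D" and E: "derivation R S M \<rho> E"
  shows "derivation R S M \<rho> (\<lambda>a. D a \<oplus>\<^bsub>M\<^esub> E a)"
proof (intro derivationI linear_mapI)
  note [simp] = linear_mapD[OF derivation_linear[OF D]] linear_mapD[OF derivation_linear[OF E]]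
    derivation_mult[OF D] derivation_mult[OF E]
  show "x \<in> carrier S \<Longrightarrow> D x \<oplus>\<^bsub>M\<^esub> E x \<in> carrier M" for x by simp
  show "D (x \<oplus>\<^bsub>S\<^esub> y) \<oplus>\<^bsub>M\<^esub> E (x \<oplus>\<^bsub>S\<^esub> y) = D x \<oplus>\<^bsub>M\<^esub> E x \<oplus>\<^bsub>M\<^esub> (D y \<oplus>\<^bsub>M\<^esub> E y)"
    if "x \<in> carrier S" "y \<in> carrier S" for x y using that by (simp add: M.a_ac)
  show "D (r \<odot>\<^bsub>S\<^esub> x) \<oplus>\<^bsub>M\<^esub> E (r \<odot>\<^bsub>S\<^esub> x) = r \<odot>\<^bsub>M\<^esub> (D x \<oplus>\<^bsub>M\<^esub> E x)"
    if "r \<in> carrier R" "x \<in> carrier S" for r x using that by (simp add: M.smult_r_distr)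
  show "D (a \<otimes>\<^bsub>S\<^esub> b) \<oplus>\<^bsub>M\<^esub> E (a \<otimes>\<^bsub>S\<^esub> b) = \<rho> a (D b \<oplus>\<^bsub>M\<^esub> E b) \<oplus>\<^bsub>M\<^esub> \<rho> b (D a \<oplus>\<^bsub>M\<^esub> E a)"
    if "a \<in> carrier S" "b \<in> carrier S" for a b using that by (simp add: M.a_ac \<rho>_simps)
qed

lemma derivation_smult:
  assumes D: "derivation R S M \<rho> D" and r: "r \<in> carrier R"
  shows "derivation R S M \<rho> (\<lambda>a. r \<odot>\<^bsub>M\<^esub> D a)"
proof (intro derivationI linear_mapI)
  note [simp] = linear_mapD[OF derivation_linear[OF D]] derivation_mult[OF D] r
  show "x \<in> carrier S \<Longrightarrow> r \<odot>\<^bsub>M\<^esub> D x \<in> carrier M" for x by simp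
  show "r \<odot>\<^bsub>M\<^esub> D (x \<oplus>\<^bsub>S\<^esub> y) = r \<odot>\<^bsub>M\<^esub> D x \<oplus>\<^bsub>M\<^esub> r \<odot>\<^bsub>M\<^esub> D y"
    if "x \<in> carrier S" "y \<in> carrier S" for x y using that by (simp add: M.smult_r_distr)
  show "r \<odot>\<^bsub>M\<^esub> D (s \<odot>\<^bsub>S\<^esub> x) = s \<odot>\<^bsub>M\<^esub> (r \<odot>\<^bsub>M\<^esub> D x)"
    if "s \<in> carrier R" "x \<in> carrier S" for s x
    using that by (simp add: M.smult_assoc1[symmetric] S.R.m_comm)
  show "r \<odot>\<^bsub>M\<^esub> D (a \<otimes>\<^bsub>S\<^esub> b) = \<rho> a (r \<odot>\<^bsub>M\<^esub> D b) \<oplus>\<^bsub>M\<^esub> \<rho> b (r \<odot>\<^bsub>M\<^esub> D a)"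
    if "a \<in> carrier S" "b \<in> carrier S" for a b using that by (simp add: M.smult_r_distr \<rho>_simps)
qed

lemma derivation_scale:
  assumes D: "derivation R S M \<rho> D" and c: "c \<in> carrier S"
  shows "derivation R S M \<rho> (\<lambda>a. \<rho> c (D a))"
proof (intro derivationI linear_mapI)
  note [simp] = linear_mapD[OF derivation_linear[OF D]] derivation_mult[OF D] c
  show "x \<in> carrier S \<Longrightarrow> \<rho> c (D x) \<in> carrier M" for x by (simp add: \<rho>_simps)
  show "\<rho> c (D (x \<oplus>\<^bsub>S\<^esub> y)) = \<rho> c (D x) \<oplus>\<^bsub>M\<^esub> \<rho> c (D y)"
    if "x \<in> carrier S" "y \<in> carrier S" for x y using that by (simp add: \<rho>_simps)
  show "\<rho> c (D (r \<odot>\<^bsub>S\<^esub> x)) = r \<odot>\<^bsub>M\<^esub> \<rho> c (D x)"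
    if "r \<in> carrier R" "x \<in> carrier S" for r x using that by (simp add: \<rho>_simps)
  show "\<rho> c (D (a \<otimes>\<^bsub>S\<^esub> b)) = \<rho> a (\<rho> c (D b)) \<oplus>\<^bsub>M\<^esub> \<rho> b (\<rho> c (D a))"
    if "a \<in> carrier S" "b \<in> carrier S" for a b
    using that \<rho>_comm[of a c "D b"] \<rho>_comm[of b c "D a"] by (simp add: \<rho>_simps)
qed

end

text \<open>
  The first component of the lift to the square-zero extension is the identity, as it is so on generators;
  the second component is the derivation.
\<close>

lemma Sym_derivation_exists:
  fixes L :: "('r, 'g, 'x) module_scheme"
  assumes L: "module R L" and M: "module R M" and \<rho>: "left_module_action R (Sym R L) M \<rho>"
    and f: "linear_map R L M f"
  obtains D where "derivation R (Sym R L) M \<rho> D" "\<And>x. x \<in> carrier L \<Longrightarrow> D (Sym_gen R L x) = f x"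
proof -
  let ?S = "Sym R L" and ?\<iota> = "Sym_gen R L"
  note A = algebra_Sym[OF L]
  interpret S: algebra R ?S by (rule A)
  interpret M: module R M by (rule M)
  let ?E = "square_zero_extension ?S M \<rho>"
  note E = assoc_algebra_square_zero_extension[OF A M \<rho>]
  note lin = Sym_gen_linear[OF L]
  note fc = linear_map_closed[OF f] and \<iota>c = linear_map_closed[OF lin]
  note \<rho>c = bilinear_map_closed[OF left_module_action_bilinear[OF \<rho>]]
  have lin': "linear_map R L ?E (\<lambda>x. (?\<iota> x, f x))"
    using fc \<iota>c by (intro linear_mapI)
      (auto simp: linear_map_add[OF lin] linear_map_add[OF f] linear_map_smult[OF lin] linear_map_smult[OF f])
  have comm: "(?\<iota> x, f x) \<otimes>\<^bsub>?E\<^esub> (?\<iota> y, f y) = (?\<iota> y, f y) \<otimes>\<^bsub>?E\<^esub> (?\<iota> x, f x)"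
    if "x \<in> carrier L" "y \<in> carrier L" for x y
    using fc[OF that(1)] fc[OF that(2)] \<iota>c[OF that(1)] \<iota>c[OF that(2)]
    by (auto simp: S.m_comm intro!: M.a_comm \<rho>c)
  obtain h where h: "algebra_hom R ?S ?E h"
    and hx: "\<And>x. x \<in> carrier L \<Longrightarrow> h (?\<iota> x) = (?\<iota> x, f x)"
    by (rule Sym_universal[OF L E lin' comm]) (assumption+, rule that)
  note hl = algebra_hom_linear[OF h]
  have fst_lin: "linear_map R ?E ?S fst" and snd_lin: "linear_map R ?E M snd"
    by (auto intro!: linear_mapI)
  have "algebra_hom R ?E ?S fst" by (rule algebra_homI[OF fst_lin]) auto
  then have fst_hom: "algebra_hom R ?S ?S (\<lambda>a. fst (h a))" by (rule algebra_hom_comp[OF h])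
  have id: "algebra_hom R ?S ?S (\<lambda>a. a)" by (intro algebra_homI linear_mapI) auto
  have fst: "fst (h a) = a" if "a \<in> carrier ?S" for a
    by (rule algebra_hom_unique[OF assoc_algebra_Sym[OF L] generates_Sym[OF L] fst_hom id _ that])
      (auto simp: hx)
  have "derivation R ?S M \<rho> (\<lambda>a. snd (h a))"
  proof (intro derivationI linear_map_comp[OF hl snd_lin])
    fix a b assume ab: "a \<in> carrier ?S" "b \<in> carrier ?S"
    have "h a = (a, snd (h a))" "h b = (b, snd (h b))" using fst ab by (simp_all add: prod_eq_iff)
    then show "snd (h (a \<otimes>\<^bsub>?S\<^esub> b)) = \<rho> a (snd (h b)) \<oplus>\<^bsub>M\<^esub> \<rho> b (snd (h a))"
      using algebra_hom_mult[OF h ab] by (metis square_zero_extension_simps(2) snd_conv)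
  qed
  then show thesis by (rule that) (simp add: hx)
qed

section \<open>The modified Lie-Poisson bracket\<close>

lemma with_bracket_simps [simp]:
  "carrier (with_bracket A br) = carrier A" "zero (with_bracket A br) = zero A"
  "add (with_bracket A br) = add A" "smult (with_bracket A br) = smult A"
  "mult (with_bracket A br) = mult A" "one (with_bracket A br) = one A"
  "bracket (with_bracket A br) = br"
  by (simp_all add: with_bracket_def module.defs lie.defs)

locale lie_cocycle = L: lie_algebra R L for R :: "('r, 'e) ring_scheme" and L :: "('r, 'g) lie" +
  fixes \<sigma> :: "'g \<Rightarrow> 'g \<Rightarrow> 'r"
  assumes two_cocycle: "two_cocycle R L \<sigma>"
begin

abbreviation "S \<equiv> Sym R L"
abbreviation "U \<equiv> ULie R L"
abbreviation "\<iota> \<equiv> Sym_gen R L"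
abbreviation "\<upsilon> \<equiv> ULie_gen R L"

sublocale S: algebra R S by (rule algebra_Sym[OF L.module_axioms])
sublocale SA: assoc_algebra R S by (rule assoc_algebra_Sym[OF L.module_axioms])
sublocale U: assoc_algebra R U by (rule assoc_algebra_ULie[OF L.lie_algebra_axioms])

lemmas iota_linear = Sym_gen_linear[OF L.module_axioms]
lemmas iota_closed = linear_map_closed[OF iota_linear]
lemmas Sym_generates = generates_Sym[OF L.module_axioms]
lemmas upsilon_linear = ULie_gen_linear[OF L.lie_algebra_axioms]
lemmas upsilon_closed = linear_map_closed[OF upsilon_linear]
lemmas U_generates = generates_ULie[OF L.lie_algebra_axioms]
lemmas bracket_closed = bilinear_map_closed[OF L.bracket_bilinear]

lemma cocycle_bilinear: "bilinear_map R L L (base_algebra R) \<sigma>"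
  using two_cocycle by (simp add: two_cocycle_def)

lemma cocycle_closed: "\<lbrakk>x \<in> carrier L; y \<in> carrier L\<rbrakk> \<Longrightarrow> \<sigma> x y \<in> carrier R"
  using bilinear_map_closed[OF cocycle_bilinear] by simp

lemma cocycle_alternating: "x \<in> carrier L \<Longrightarrow> \<sigma> x x = \<zero>\<^bsub>R\<^esub>"
  using two_cocycle by (simp add: two_cocycle_def)

lemma cocycle_identity:
  "\<lbrakk>x \<in> carrier L; y \<in> carrier L; z \<in> carrier L\<rbrakk> \<Longrightarrow>
    \<sigma> (bracket L x y) z \<oplus>\<^bsub>R\<^esub> \<sigma> (bracket L y z) x \<oplus>\<^bsub>R\<^esub> \<sigma> (bracket L z x) y = \<zero>\<^bsub>R\<^esub>"
  using two_cocycle by (simp add: two_cocycle_def)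

definition gen_bracket :: "'g \<Rightarrow> 'g \<Rightarrow> ('g list \<Rightarrow> 'r) set set"
  where "gen_bracket x y = \<iota> (bracket L x y) \<oplus>\<^bsub>S\<^esub> \<sigma> x y \<odot>\<^bsub>S\<^esub> \<one>\<^bsub>S\<^esub>"

lemma smult_one_linear: "linear_map R (base_algebra R) S (\<lambda>r. r \<odot>\<^bsub>S\<^esub> \<one>\<^bsub>S\<^esub>)"
  by (intro linear_mapI) (auto simp: S.smult_l_distr S.smult_assoc1)

lemma gen_bracket_bilinear: "bilinear_map R L L S gen_bracket"
proof -
  have 1: "bilinear_map R L L S (\<lambda>x y. \<iota> (bracket L x y))"
    by (rule linear_map_bilinear_comp[OF L.bracket_bilinear iota_linear])
  have 2: "bilinear_map R L L S (\<lambda>x y. \<sigma> x y \<odot>\<^bsub>S\<^esub> \<one>\<^bsub>S\<^esub>)"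
    by (rule linear_map_bilinear_comp[OF cocycle_bilinear smult_one_linear])
  show ?thesis
    using bilinear_map_closed[OF 1] bilinear_map_closed[OF 2]
    unfolding gen_bracket_def
    by (intro bilinear_mapI)
      (simp_all add: bilinear_map_add_left[OF 1] bilinear_map_add_right[OF 1] bilinear_map_smult_left[OF 1]
        bilinear_map_smult_right[OF 1] bilinear_map_add_left[OF 2] bilinear_map_add_right[OF 2]
        bilinear_map_smult_left[OF 2] bilinear_map_smult_right[OF 2] S.a_ac S.smult_r_distr)
qed

abbreviation "der \<equiv> derivation R S S (\<otimes>\<^bsub>S\<^esub>)"

lemma Sym_self_action: "left_module_action R S S (\<otimes>\<^bsub>S\<^esub>)"
  by (intro left_module_actionI SA.mult_bilinear) (auto simp: S.m_assoc)

lemmas der_exists = Sym_derivation_exists[OF L.module_axioms S.module_axioms Sym_self_action]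
lemmas der_one = derivation_one[OF S.algebra_axioms S.module_axioms Sym_self_action]
lemmas der_add = derivation_add[OF S.algebra_axioms S.module_axioms Sym_self_action]
lemmas der_smult = derivation_smult[OF S.algebra_axioms S.module_axioms Sym_self_action]
lemmas der_scale = derivation_scale[OF S.algebra_axioms S.module_axioms Sym_self_action]

lemma der_eq:
  assumes "der D" "der E" "\<And>x. x \<in> carrier L \<Longrightarrow> D (\<iota> x) = E (\<iota> x)" "a \<in> carrier S"
  shows "D a = E a"
  by (rule derivation_eq[OF S.algebra_axioms S.module_axioms Sym_self_action Sym_generates assms(1,2) _ assms(4)])
    (use assms(3) in auto)

text \<open>
  The mixed products \<open>D(a) E(b)\<close> and \<open>E(a) D(b)\<close> occur in both composites and cancel.
\<close>

lemma der_commutator: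
  assumes D: "der D" and E: "der E"
  shows "der (\<lambda>a. D (E a) \<ominus>\<^bsub>S\<^esub> E (D a))"
proof (intro derivationI linear_mapI)
  note [simp] = linear_mapD[OF derivation_linear[OF D]] linear_mapD[OF derivation_linear[OF E]]
    derivation_mult[OF D] derivation_mult[OF E]
  show "x \<in> carrier S \<Longrightarrow> D (E x) \<ominus>\<^bsub>S\<^esub> E (D x) \<in> carrier S" for x by simp
  show "D (E (x \<oplus>\<^bsub>S\<^esub> y)) \<ominus>\<^bsub>S\<^esub> E (D (x \<oplus>\<^bsub>S\<^esub> y)) = D (E x) \<ominus>\<^bsub>S\<^esub> E (D x) \<oplus>\<^bsub>S\<^esub> (D (E y) \<ominus>\<^bsub>S\<^esub> E (D y))"
    if "x \<in> carrier S" "y \<in> carrier S" for x y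
    using that by (simp add: S.minus_eq S.minus_add S.a_ac)
  show "D (E (r \<odot>\<^bsub>S\<^esub> x)) \<ominus>\<^bsub>S\<^esub> E (D (r \<odot>\<^bsub>S\<^esub> x)) = r \<odot>\<^bsub>S\<^esub> (D (E x) \<ominus>\<^bsub>S\<^esub> E (D x))"
    if "r \<in> carrier R" "x \<in> carrier S" for r x
    using that by (simp add: S.minus_eq S.smult_r_distr S.smult_r_minus)
  show "D (E (a \<otimes>\<^bsub>S\<^esub> b)) \<ominus>\<^bsub>S\<^esub> E (D (a \<otimes>\<^bsub>S\<^esub> b)) =
      a \<otimes>\<^bsub>S\<^esub> (D (E b) \<ominus>\<^bsub>S\<^esub> E (D b)) \<oplus>\<^bsub>S\<^esub> b \<otimes>\<^bsub>S\<^esub> (D (E a) \<ominus>\<^bsub>S\<^esub> E (D a))"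
    if ab: "a \<in> carrier S" "b \<in> carrier S" for a b
  proof -
    have c: "D a \<in> carrier S" "D b \<in> carrier S" "E a \<in> carrier S" "E b \<in> carrier S"
      "D (E a) \<in> carrier S" "D (E b) \<in> carrier S" "E (D a) \<in> carrier S" "E (D b) \<in> carrier S"
      using ab by simp_all
    have "D (E (a \<otimes>\<^bsub>S\<^esub> b)) = a \<otimes>\<^bsub>S\<^esub> D (E b) \<oplus>\<^bsub>S\<^esub> E b \<otimes>\<^bsub>S\<^esub> D a \<oplus>\<^bsub>S\<^esub> (b \<otimes>\<^bsub>S\<^esub> D (E a) \<oplus>\<^bsub>S\<^esub> E a \<otimes>\<^bsub>S\<^esub> D b)"
      "E (D (a \<otimes>\<^bsub>S\<^esub> b)) = a \<otimes>\<^bsub>S\<^esub> E (D b) \<oplus>\<^bsub>S\<^esub> D b \<otimes>\<^bsub>S\<^esub> E a \<oplus>\<^bsub>S\<^esub> (b \<otimes>\<^bsub>S\<^esub> E (D a) \<oplus>\<^bsub>S\<^esub> D a \<otimes>\<^bsub>S\<^esub> E b)"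
      using ab c by simp_all
    moreover have "p \<oplus>\<^bsub>S\<^esub> q \<oplus>\<^bsub>S\<^esub> (r \<oplus>\<^bsub>S\<^esub> t) \<ominus>\<^bsub>S\<^esub> (p' \<oplus>\<^bsub>S\<^esub> t \<oplus>\<^bsub>S\<^esub> (r' \<oplus>\<^bsub>S\<^esub> q)) =
        (p \<ominus>\<^bsub>S\<^esub> p') \<oplus>\<^bsub>S\<^esub> (r \<ominus>\<^bsub>S\<^esub> r')"
      if "p \<in> carrier S" "q \<in> carrier S" "r \<in> carrier S" "t \<in> carrier S" "p' \<in> carrier S" "r' \<in> carrier S"
      for p q r t p' r'
      using that by algebra
    moreover have "z \<otimes>\<^bsub>S\<^esub> (p \<ominus>\<^bsub>S\<^esub> q) = z \<otimes>\<^bsub>S\<^esub> p \<ominus>\<^bsub>S\<^esub> z \<otimes>\<^bsub>S\<^esub> q"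
      if "z \<in> carrier S" "p \<in> carrier S" "q \<in> carrier S" for z p q
      using that by algebra
    ultimately show ?thesis using ab c by (simp add: S.m_comm[of "E b"] S.m_comm[of "E a"])
  qed
qed

lemma biderivation_der:
  assumes d: "biderivation R S d" and b: "b \<in> carrier S"
  shows biderivation_left: "der (\<lambda>a. d a b)" and biderivation_right: "der (d b)"
proof -
  from d have bil: "bilinear_map R S S S d"
    and m: "\<And>a b c. \<lbrakk>a \<in> carrier S; b \<in> carrier S; c \<in> carrier S\<rbrakk> \<Longrightarrow>
      d (a \<otimes>\<^bsub>S\<^esub> b) c = a \<otimes>\<^bsub>S\<^esub> d b c \<oplus>\<^bsub>S\<^esub> b \<otimes>\<^bsub>S\<^esub> d a c \<and>
      d c (a \<otimes>\<^bsub>S\<^esub> b) = a \<otimes>\<^bsub>S\<^esub> d c b \<oplus>\<^bsub>S\<^esub> b \<otimes>\<^bsub>S\<^esub> d c a"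
    by (auto simp: biderivation_def)
  show "der (\<lambda>a. d a b)" using m b by (intro derivationI bilinear_map_left[OF bil b]) auto
  show "der (d b)" using m b by (intro derivationI bilinear_map_right[OF bil b]) auto
qed

lemma biderivationI:
  assumes "\<And>b. b \<in> carrier S \<Longrightarrow> der (\<lambda>a. d a b)" "\<And>a. a \<in> carrier S \<Longrightarrow> der (d a)"
  shows "biderivation R S d"
  using derivationD[OF assms(1)] derivationD[OF assms(2)]
  by (simp add: biderivation_def bilinear_map_def)

text \<open>A biderivation is determined on generators, by extending in one argument after the other.\<close>

lemma biderivation_eq:
  assumes d: "biderivation R S d" and e: "biderivation R S e"
    and eq: "\<And>x y. \<lbrakk>x \<in> carrier L; y \<in> carrier L\<rbrakk> \<Longrightarrow> d (\<iota> x) (\<iota> y) = e (\<iota> x) (\<iota> y)"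
    and a: "a \<in> carrier S" and b: "b \<in> carrier S"
  shows "d a b = e a b"
proof (rule der_eq[OF biderivation_right[OF d a] biderivation_right[OF e a] _ b])
  fix y assume y: "y \<in> carrier L"
  show "d a (\<iota> y) = e a (\<iota> y)"
    using der_eq[OF biderivation_left[OF d iota_closed[OF y]] biderivation_left[OF e iota_closed[OF y]] eq[OF _ y] a] .
qed

text \<open>
  For a generator \<open>x\<close> let \<open>h x\<close> be the derivation that is to become \<open>{x, \<cdot>}\<close>. For fixed \<open>b\<close>, the value \<open>h x b\<close> is
  linear in \<open>x\<close> and extends to a derivation \<open>e b\<close>, which is to become \<open>{\<cdot>, b}\<close>. Its dependence on \<open>b\<close> is again a
  derivation, because this is so on generators.
\<close>

lemma biderivation_exists:
  obtains d where "biderivation R S d"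
    "\<And>x y. \<lbrakk>x \<in> carrier L; y \<in> carrier L\<rbrakk> \<Longrightarrow> d (\<iota> x) (\<iota> y) = gen_bracket x y"
proof -
  have "\<exists>D. der D \<and> (\<forall>y\<in>carrier L. D (\<iota> y) = gen_bracket x y)" if x: "x \<in> carrier L" for x
  proof -
    obtain D where "der D" "\<And>y. y \<in> carrier L \<Longrightarrow> D (\<iota> y) = gen_bracket x y"
      by (rule der_exists[OF bilinear_map_right[OF gen_bracket_bilinear x]]) (rule that)
    then show ?thesis by auto
  qed
  then obtain h where h: "\<And>x. x \<in> carrier L \<Longrightarrow> der (h x)"
    and hy: "\<And>x y. \<lbrakk>x \<in> carrier L; y \<in> carrier L\<rbrakk> \<Longrightarrow> h x (\<iota> y) = gen_bracket x y"
    by metis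
  note gb = gen_bracket_bilinear
  have h_add: "h (x \<oplus>\<^bsub>L\<^esub> x') b = h x b \<oplus>\<^bsub>S\<^esub> h x' b"
    if "x \<in> carrier L" "x' \<in> carrier L" "b \<in> carrier S" for x x' b
    by (rule der_eq[OF h[OF L.M.a_closed[OF that(1,2)]] der_add[OF h[OF that(1)] h[OF that(2)]] _ that(3)])
      (simp add: that hy bilinear_map_add_left[OF gb])
  have h_smult: "h (r \<odot>\<^bsub>L\<^esub> x) b = r \<odot>\<^bsub>S\<^esub> h x b"
    if "r \<in> carrier R" "x \<in> carrier L" "b \<in> carrier S" for r x b
    by (rule der_eq[OF h[OF L.smult_closed[OF that(1,2)]] der_smult[OF h[OF that(2)] that(1)] _ that(3)])
      (simp add: that hy bilinear_map_smult_left[OF gb])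
  have lin: "linear_map R L S (\<lambda>x. h x b)" if "b \<in> carrier S" for b
    using that linear_map_closed[OF derivation_linear[OF h]]
    by (intro linear_mapI) (simp_all add: h_add h_smult)
  have "\<exists>D. der D \<and> (\<forall>x\<in>carrier L. D (\<iota> x) = h x b)" if b: "b \<in> carrier S" for b
  proof -
    obtain D where "der D" "\<And>x. x \<in> carrier L \<Longrightarrow> D (\<iota> x) = h x b"
      by (rule der_exists[OF lin[OF b]]) (rule that)
    then show ?thesis by auto
  qed
  then obtain e where e: "\<And>b. b \<in> carrier S \<Longrightarrow> der (e b)"
    and ex: "\<And>b x. \<lbrakk>b \<in> carrier S; x \<in> carrier L\<rbrakk> \<Longrightarrow> e b (\<iota> x) = h x b"
    by metis
  have e_add: "e (b \<oplus>\<^bsub>S\<^esub> c) a = e b a \<oplus>\<^bsub>S\<^esub> e c a"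
    if "a \<in> carrier S" "b \<in> carrier S" "c \<in> carrier S" for a b c
    by (rule der_eq[OF e[OF S.a_closed[OF that(2,3)]] der_add[OF e[OF that(2)] e[OF that(3)]] _ that(1)])
      (simp add: that ex linear_map_add[OF derivation_linear[OF h]])
  have e_smult: "e (r \<odot>\<^bsub>S\<^esub> b) a = r \<odot>\<^bsub>S\<^esub> e b a"
    if "a \<in> carrier S" "b \<in> carrier S" "r \<in> carrier R" for a b r
    by (rule der_eq[OF e[OF S.smult_closed[OF that(3,2)]] der_smult[OF e[OF that(2)] that(3)] _ that(1)])
      (simp add: that ex linear_map_smult[OF derivation_linear[OF h]])
  have e_mult: "e (b \<otimes>\<^bsub>S\<^esub> c) a = b \<otimes>\<^bsub>S\<^esub> e c a \<oplus>\<^bsub>S\<^esub> c \<otimes>\<^bsub>S\<^esub> e b a"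
    if "a \<in> carrier S" "b \<in> carrier S" "c \<in> carrier S" for a b c
    by (rule der_eq[OF e[OF S.m_closed[OF that(2,3)]] der_add[OF der_scale[OF e[OF that(3)] that(2)]
          der_scale[OF e[OF that(2)] that(3)]] _ that(1)])
      (simp add: that ex derivation_mult[OF h])
  have "biderivation R S (\<lambda>a b. e b a)"
  proof (rule biderivationI)
    show "der (\<lambda>b. e b a)" if "a \<in> carrier S" for a
      using that linear_map_closed[OF derivation_linear[OF e]]
      by (intro derivationI linear_mapI) (simp_all add: e_add e_smult e_mult)
  qed (rule e)
  then show thesis by (rule that) (simp add: ex hy iota_closed)
qed

definition pb :: "('g list \<Rightarrow> 'r) set set \<Rightarrow> ('g list \<Rightarrow> 'r) set set \<Rightarrow> ('g list \<Rightarrow> 'r) set set"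
  where "pb = lie_poisson_bracket R L \<sigma>"

lemma
  shows pb_biderivation: "biderivation R S pb"
    and pb_gen: "\<lbrakk>x \<in> carrier L; y \<in> carrier L\<rbrakk> \<Longrightarrow>
      pb (\<iota> x) (\<iota> y) = \<iota> (bracket L x y) \<oplus>\<^bsub>S\<^esub> \<sigma> x y \<odot>\<^bsub>S\<^esub> \<one>\<^bsub>S\<^esub>"
proof -
  let ?P = "\<lambda>d. biderivation R S d \<and> (\<forall>x\<in>carrier L. \<forall>y\<in>carrier L.
    d (\<iota> x) (\<iota> y) = \<iota> (bracket L x y) \<oplus>\<^bsub>S\<^esub> \<sigma> x y \<odot>\<^bsub>S\<^esub> \<one>\<^bsub>S\<^esub>)"
  obtain d where "biderivation R S d"
    "\<And>x y. \<lbrakk>x \<in> carrier L; y \<in> carrier L\<rbrakk> \<Longrightarrow> d (\<iota> x) (\<iota> y) = gen_bracket x y"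
    by (rule biderivation_exists) (rule that)
  then have d: "?P d" by (simp add: gen_bracket_def)
  have "?P pb"
    unfolding pb_def lie_poisson_bracket_def Let_def
  proof (rule THE_extensional2[where P = ?P, OF d])
    show "h x y \<in> carrier S" if "?P h" "x \<in> carrier S" "y \<in> carrier S" for h x y
      by (rule linear_map_closed[OF derivation_linear[OF biderivation_right[OF that(1)[THEN conjunct1] that(2)]] that(3)])
    show "h x y = h' x y" if "?P h" "?P h'" "x \<in> carrier S" "y \<in> carrier S" for h h' x y
      by (rule biderivation_eq[OF that(1)[THEN conjunct1] that(2)[THEN conjunct1] _ that(3,4)])
        (simp add: that(1,2)[THEN conjunct2, rule_format])
    show "?P h'" if h: "?P h" and eq: "\<And>x y. x \<in> carrier S \<Longrightarrow> y \<in> carrier S \<Longrightarrow> h' x y = h x y" for h h'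
    proof
      note l = derivationD[OF biderivation_left[OF h[THEN conjunct1]]]
        and r = derivationD[OF biderivation_right[OF h[THEN conjunct1]]]
      show "biderivation R S h'"
        by (intro biderivationI derivationI linear_mapI)
          (simp_all add: eq l(2) r(2) linear_mapD[OF l(1)] linear_mapD[OF r(1)])
      show "\<forall>x\<in>carrier L. \<forall>y\<in>carrier L.
        h' (\<iota> x) (\<iota> y) = \<iota> (bracket L x y) \<oplus>\<^bsub>S\<^esub> \<sigma> x y \<odot>\<^bsub>S\<^esub> \<one>\<^bsub>S\<^esub>"
        using h[THEN conjunct2] by (simp add: eq iota_closed)
    qed
  qed
  then show "biderivation R S pb" "\<lbrakk>x \<in> carrier L; y \<in> carrier L\<rbrakk> \<Longrightarrow>
      pb (\<iota> x) (\<iota> y) = \<iota> (bracket L x y) \<oplus>\<^bsub>S\<^esub> \<sigma> x y \<odot>\<^bsub>S\<^esub> \<one>\<^bsub>S\<^esub>" by auto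
qed

lemmas pb_left = biderivation_left[OF pb_biderivation]
lemmas pb_right = biderivation_right[OF pb_biderivation]

lemma pb_bilinear: "bilinear_map R S S S pb"
  using pb_biderivation by (simp add: biderivation_def)

lemmas pb_closed = bilinear_map_closed[OF pb_bilinear]
lemmas pb_add_left = bilinear_map_add_left[OF pb_bilinear]
lemmas pb_add_right = bilinear_map_add_right[OF pb_bilinear]
lemmas pb_smult_left = bilinear_map_smult_left[OF pb_bilinear]
lemmas pb_smult_right = bilinear_map_smult_right[OF pb_bilinear]

lemma pb_mult_left:
  "\<lbrakk>a \<in> carrier S; b \<in> carrier S; c \<in> carrier S\<rbrakk> \<Longrightarrow>
    pb (a \<otimes>\<^bsub>S\<^esub> b) c = a \<otimes>\<^bsub>S\<^esub> pb b c \<oplus>\<^bsub>S\<^esub> b \<otimes>\<^bsub>S\<^esub> pb a c"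
  by (rule derivation_mult[OF pb_left])

lemma pb_mult_right:
  "\<lbrakk>a \<in> carrier S; b \<in> carrier S; c \<in> carrier S\<rbrakk> \<Longrightarrow>
    pb c (a \<otimes>\<^bsub>S\<^esub> b) = a \<otimes>\<^bsub>S\<^esub> pb c b \<oplus>\<^bsub>S\<^esub> b \<otimes>\<^bsub>S\<^esub> pb c a"
  by (rule derivation_mult[OF pb_right])

lemma pb_one: "a \<in> carrier S \<Longrightarrow> pb \<one>\<^bsub>S\<^esub> a = \<zero>\<^bsub>S\<^esub>" "a \<in> carrier S \<Longrightarrow> pb a \<one>\<^bsub>S\<^esub> = \<zero>\<^bsub>S\<^esub>"
  using der_one[OF pb_left] der_one[OF pb_right] by auto

lemma bracket_skew:
  assumes "x \<in> carrier L" "y \<in> carrier L"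
  shows "bracket L y x = \<ominus>\<^bsub>L\<^esub> bracket L x y"
proof -
  note b = L.bracket_bilinear
  have "bracket L (x \<oplus>\<^bsub>L\<^esub> y) (x \<oplus>\<^bsub>L\<^esub> y) =
    bracket L x x \<oplus>\<^bsub>L\<^esub> bracket L x y \<oplus>\<^bsub>L\<^esub> (bracket L y x \<oplus>\<^bsub>L\<^esub> bracket L y y)"
    using assms bracket_closed by (simp add: bilinear_map_add_left[OF b] bilinear_map_add_right[OF b] L.M.a_ac)
  then have "bracket L y x \<oplus>\<^bsub>L\<^esub> bracket L x y = \<zero>\<^bsub>L\<^esub>"
    using assms bracket_closed by (simp add: L.bracket_alternating L.M.a_comm)
  then show ?thesis using assms bracket_closed by (simp add: L.M.minus_equality)
qed

lemma cocycle_skew: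
  assumes "x \<in> carrier L" "y \<in> carrier L"
  shows "\<sigma> y x = \<ominus>\<^bsub>R\<^esub> \<sigma> x y"
proof -
  note b = cocycle_bilinear
  have "\<sigma> (x \<oplus>\<^bsub>L\<^esub> y) (x \<oplus>\<^bsub>L\<^esub> y) = \<sigma> x x \<oplus>\<^bsub>R\<^esub> \<sigma> x y \<oplus>\<^bsub>R\<^esub> (\<sigma> y x \<oplus>\<^bsub>R\<^esub> \<sigma> y y)"
    using assms cocycle_closed bilinear_map_add_left[OF b] bilinear_map_add_right[OF b] by (simp add: L.R.a_ac)
  then have "\<sigma> y x \<oplus>\<^bsub>R\<^esub> \<sigma> x y = \<zero>\<^bsub>R\<^esub>"
    using assms cocycle_closed by (simp add: cocycle_alternating L.R.a_comm)
  then show ?thesis using assms cocycle_closed by (simp add: L.R.minus_equality)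
qed

text \<open>
  Both sides are biderivations in \<open>a\<close> and \<open>b\<close>, and they agree on generators because the bracket and the cocycle
  of the Lie algebra are skew.
\<close>

lemma pb_skew:
  assumes a: "a \<in> carrier S" and b: "b \<in> carrier S"
  shows "pb b a = \<ominus>\<^bsub>S\<^esub> pb a b"
proof (rule biderivation_eq[OF pb_biderivation _ _ b a])
  let ?neg = "\<lambda>a b. \<ominus>\<^bsub>S\<^esub> pb b a"
  show "biderivation R S ?neg"
    by (intro biderivationI derivationI linear_mapI)
      (simp_all add: pb_closed pb_add_left pb_add_right pb_smult_left pb_smult_right pb_mult_left
        pb_mult_right S.minus_add S.smult_r_minus S.r_minus)
  fix x y assume x: "x \<in> carrier L" and y: "y \<in> carrier L"
  have "\<iota> (\<ominus>\<^bsub>L\<^esub> bracket L x y) = \<ominus>\<^bsub>S\<^esub> \<iota> (bracket L x y)"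
    by (rule linear_map_a_inv[OF L.module_axioms S.module_axioms iota_linear bracket_closed[OF x y]])
  then show "pb (\<iota> y) (\<iota> x) = \<ominus>\<^bsub>S\<^esub> pb (\<iota> x) (\<iota> y)" 
    using x y bracket_closed[OF x y] cocycle_closed[OF x y]
    by (simp add: pb_gen bracket_skew[OF x y] cocycle_skew[OF x y] iota_closed S.smult_l_minus S.minus_add)
qed

text \<open>
  As \<open>2\<close> may be a zero divisor, this does not follow from skew-symmetry. But \<open>{a, a} = 0\<close> passes to sums
  and products, where skew-symmetry cancels the mixed terms.
\<close>

lemma pb_alternating:
  assumes "a \<in> carrier S"
  shows "pb a a = \<zero>\<^bsub>S\<^esub>"
  using SA.assoc_algebra_axioms Sym_generates assms
proof (induction a rule: generates_induct)
  case one then show ?case by (simp add: pb_one)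
next
  case (mult x a)
  then obtain y where y: "y \<in> carrier L" "x = \<iota> y" by auto
  have x: "pb x x = \<zero>\<^bsub>S\<^esub>"
    using y linear_map_zero[OF L.module_axioms S.module_axioms iota_linear]
    by (simp add: pb_gen L.bracket_alternating cocycle_alternating)
  have "pb (x \<otimes>\<^bsub>S\<^esub> a) (x \<otimes>\<^bsub>S\<^esub> a) = x \<otimes>\<^bsub>S\<^esub> (a \<otimes>\<^bsub>S\<^esub> pb x a) \<oplus>\<^bsub>S\<^esub> a \<otimes>\<^bsub>S\<^esub> (x \<otimes>\<^bsub>S\<^esub> pb a x)"
    using mult by (simp add: pb_mult_left pb_mult_right pb_closed x S.a_comm)
  also have "\<dots> = \<zero>\<^bsub>S\<^esub>"
    unfolding pb_skew[OF mult(2,3)] using mult(2,3) pb_closed[OF mult(2,3)] by algebra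
  finally show ?case .
next
  case (add a b)
  then show ?case using pb_skew[of a b]
    by (simp add: pb_add_left pb_add_right pb_closed S.l_neg S.r_neg)
next
  case (smult r a) then show ?case by (simp add: pb_smult_left pb_smult_right pb_closed)
qed

text \<open>
  The Jacobi identity says that \<open>a \<mapsto> {a, \<cdot>}\<close> turns brackets into commutators. In this form both sides are
  derivations in \<open>c\<close>, and cyclic symmetry moves each argument in turn into that position.
\<close>

definition jac :: "('g list \<Rightarrow> 'r) set set \<Rightarrow> ('g list \<Rightarrow> 'r) set set \<Rightarrow> ('g list \<Rightarrow> 'r) set set \<Rightarrow> bool"
  where "jac a b c \<longleftrightarrow> pb (pb a b) c = pb a (pb b c) \<ominus>\<^bsub>S\<^esub> pb b (pb a c)"

lemma jac_iff:
  assumes "a \<in> carrier S" "b \<in> carrier S" "c \<in> carrier S"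
  shows "jac a b c \<longleftrightarrow> pb (pb a b) c \<oplus>\<^bsub>S\<^esub> pb (pb b c) a \<oplus>\<^bsub>S\<^esub> pb (pb c a) b = \<zero>\<^bsub>S\<^esub>"
proof -
  have neg: "pb b (\<ominus>\<^bsub>S\<^esub> pb a c) = \<ominus>\<^bsub>S\<^esub> pb b (pb a c)"
    using linear_map_a_inv[OF S.module_axioms S.module_axioms derivation_linear[OF pb_right]] assms pb_closed
    by simp
  have "pb (pb b c) a = \<ominus>\<^bsub>S\<^esub> pb a (pb b c)" "pb (pb c a) b = pb b (pb a c)"
    using assms pb_closed neg pb_skew[of a "pb b c"] pb_skew[of b "pb c a"] pb_skew[of a c] by simp_all
  moreover have "p = q \<ominus>\<^bsub>S\<^esub> r \<longleftrightarrow> p \<oplus>\<^bsub>S\<^esub> \<ominus>\<^bsub>S\<^esub> q \<oplus>\<^bsub>S\<^esub> r = \<zero>\<^bsub>S\<^esub>"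
    if "p \<in> carrier S" "q \<in> carrier S" "r \<in> carrier S" for p q r
  proof
    assume "p = q \<ominus>\<^bsub>S\<^esub> r" then show "p \<oplus>\<^bsub>S\<^esub> \<ominus>\<^bsub>S\<^esub> q \<oplus>\<^bsub>S\<^esub> r = \<zero>\<^bsub>S\<^esub>" using that by (simp, algebra)
  next
    assume "p \<oplus>\<^bsub>S\<^esub> \<ominus>\<^bsub>S\<^esub> q \<oplus>\<^bsub>S\<^esub> r = \<zero>\<^bsub>S\<^esub>"
    then have "p \<oplus>\<^bsub>S\<^esub> \<ominus>\<^bsub>S\<^esub> q \<oplus>\<^bsub>S\<^esub> r \<oplus>\<^bsub>S\<^esub> (q \<ominus>\<^bsub>S\<^esub> r) = q \<ominus>\<^bsub>S\<^esub> r" using that by simp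
    moreover have "p \<oplus>\<^bsub>S\<^esub> \<ominus>\<^bsub>S\<^esub> q \<oplus>\<^bsub>S\<^esub> r \<oplus>\<^bsub>S\<^esub> (q \<ominus>\<^bsub>S\<^esub> r) = p" using that by algebra
    ultimately show "p = q \<ominus>\<^bsub>S\<^esub> r" by simp
  qed
  ultimately show ?thesis using assms pb_closed by (simp add: jac_def)
qed

lemma jac_cyclic:
  assumes "a \<in> carrier S" "b \<in> carrier S" "c \<in> carrier S" "jac a b c"
  shows "jac c a b"
  using assms pb_closed by (simp add: jac_iff S.a_ac)

lemma jac_extend:
  assumes a: "a \<in> carrier S" and b: "b \<in> carrier S"
    and gen: "\<And>x. x \<in> carrier L \<Longrightarrow> jac a b (\<iota> x)" and c: "c \<in> carrier S"
  shows "jac a b c"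
  unfolding jac_def
  by (rule der_eq[OF pb_right[OF pb_closed[OF a b]] der_commutator[OF pb_right[OF a] pb_right[OF b]] _ c])
    (use gen in \<open>simp add: jac_def\<close>)

lemma pb_scalar: "\<lbrakk>r \<in> carrier R; a \<in> carrier S\<rbrakk> \<Longrightarrow> pb (r \<odot>\<^bsub>S\<^esub> \<one>\<^bsub>S\<^esub>) a = \<zero>\<^bsub>S\<^esub>"
  by (simp add: pb_smult_left pb_one)

lemma pb_gen_left:
  assumes "x \<in> carrier L" "y \<in> carrier L" "a \<in> carrier S"
  shows "pb (pb (\<iota> x) (\<iota> y)) a = pb (\<iota> (bracket L x y)) a"
  using assms bracket_closed[OF assms(1,2)] cocycle_closed[OF assms(1,2)]
  by (simp add: pb_gen pb_add_left iota_closed pb_scalar pb_closed)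

lemma jac_gen:
  assumes "x \<in> carrier L" "y \<in> carrier L" "z \<in> carrier L"
  shows "jac (\<iota> x) (\<iota> y) (\<iota> z)"
proof -
  let ?b = "bracket L"
  have c: "?b x y \<in> carrier L" "?b y z \<in> carrier L" "?b z x \<in> carrier L"
    "?b (?b x y) z \<in> carrier L" "?b (?b y z) x \<in> carrier L" "?b (?b z x) y \<in> carrier L"
    using assms bracket_closed by auto
  have i: "\<iota> (?b (?b x y) z) \<oplus>\<^bsub>S\<^esub> \<iota> (?b (?b y z) x) \<oplus>\<^bsub>S\<^esub> \<iota> (?b (?b z x) y) = \<zero>\<^bsub>S\<^esub>"
    using L.jacobi[OF assms] c linear_map_zero[OF L.module_axioms S.module_axioms iota_linear]
    by (simp add: linear_map_add[OF iota_linear, symmetric])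
  have s: "\<sigma> (?b x y) z \<odot>\<^bsub>S\<^esub> \<one>\<^bsub>S\<^esub> \<oplus>\<^bsub>S\<^esub> \<sigma> (?b y z) x \<odot>\<^bsub>S\<^esub> \<one>\<^bsub>S\<^esub> \<oplus>\<^bsub>S\<^esub> \<sigma> (?b z x) y \<odot>\<^bsub>S\<^esub> \<one>\<^bsub>S\<^esub> = \<zero>\<^bsub>S\<^esub>"
    using cocycle_identity[OF assms] assms c cocycle_closed
    by (simp add: S.smult_l_distr[symmetric])
  have "p \<oplus>\<^bsub>S\<^esub> p' \<oplus>\<^bsub>S\<^esub> (q \<oplus>\<^bsub>S\<^esub> q') \<oplus>\<^bsub>S\<^esub> (r \<oplus>\<^bsub>S\<^esub> r') = \<zero>\<^bsub>S\<^esub>"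
    if "p \<oplus>\<^bsub>S\<^esub> q \<oplus>\<^bsub>S\<^esub> r = \<zero>\<^bsub>S\<^esub>" "p' \<oplus>\<^bsub>S\<^esub> q' \<oplus>\<^bsub>S\<^esub> r' = \<zero>\<^bsub>S\<^esub>"
      "p \<in> carrier S" "q \<in> carrier S" "r \<in> carrier S" "p' \<in> carrier S" "q' \<in> carrier S" "r' \<in> carrier S"
    for p q r p' q' r'
  proof -
    have "p \<oplus>\<^bsub>S\<^esub> p' \<oplus>\<^bsub>S\<^esub> (q \<oplus>\<^bsub>S\<^esub> q') \<oplus>\<^bsub>S\<^esub> (r \<oplus>\<^bsub>S\<^esub> r') =
      (p \<oplus>\<^bsub>S\<^esub> q \<oplus>\<^bsub>S\<^esub> r) \<oplus>\<^bsub>S\<^esub> (p' \<oplus>\<^bsub>S\<^esub> q' \<oplus>\<^bsub>S\<^esub> r')" using that(3-) by (simp add: S.a_ac)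
    then show ?thesis using that(1,2) by simp
  qed
  from this[OF i s] show ?thesis
    using assms c
    by (simp add: jac_iff pb_closed pb_gen_left iota_closed)
      (simp add: pb_gen iota_closed cocycle_closed)
qed

lemma pb_jacobi:
  assumes a: "a \<in> carrier S" and b: "b \<in> carrier S" and c: "c \<in> carrier S"
  shows "jac a b c"
proof -
  have 1: "jac (\<iota> x) (\<iota> y) c" if "x \<in> carrier L" "y \<in> carrier L" "c \<in> carrier S" for x y c
    by (rule jac_extend[OF iota_closed[OF that(1)] iota_closed[OF that(2)] jac_gen[OF that(1,2)] that(3)])
  have 2: "jac c (\<iota> x) d" if "x \<in> carrier L" "c \<in> carrier S" "d \<in> carrier S" for x c d
  proof (rule jac_extend[OF that(2) iota_closed[OF that(1)] _ that(3)])
    fix y assume y: "y \<in> carrier L"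
    show "jac c (\<iota> x) (\<iota> y)"
      by (rule jac_cyclic[OF iota_closed[OF that(1)] iota_closed[OF y] that(2) 1[OF that(1) y that(2)]])
  qed
  show ?thesis
  proof (rule jac_extend[OF a b _ c])
    fix x assume x: "x \<in> carrier L"
    show "jac a b (\<iota> x)" by (rule jac_cyclic[OF b iota_closed[OF x] a 2[OF x b a]])
  qed
qed

lemma poisson_algebra_Sym: "poisson_algebra R (Sym_poisson R L \<sigma>)"
proof -
  let ?P = "with_bracket S pb"
  have mod: "module R ?P" by (rule module_cong[OF S.module_axioms]) simp_all
  have "comm_monoid ?P"
    by (rule comm_monoidI) (simp_all add: S.m_ac)
  then have cr: "cring ?P"
    using mod by (intro cringI) (simp_all add: S.l_distr module_def)
  have alg: "algebra R ?P"
    using mod cr by (simp add: algebra_def algebra_axioms_def S.smult_assoc2)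
  have "bilinear_map R ?P ?P ?P pb"
    using pb_bilinear by (simp add: bilinear_map_def linear_map_def)
  then have lie: "lie_algebra R ?P"
    using mod pb_alternating pb_jacobi
    by (simp add: lie_algebra_def lie_algebra_axioms_def jac_iff)
  have "poisson_algebra R ?P"
    using alg lie by (simp add: poisson_algebra_def poisson_algebra_axioms_def pb_mult_left)
  then show ?thesis by (simp add: Sym_poisson_def pb_def)
qed

end

section \<open>The action of the enveloping algebra\<close>

text \<open>
  Operators are taken to be extensional, so that equality of operators is equality on \<open>M\<close>.
\<close>

definition End_algebra :: "('r, 'e) ring_scheme \<Rightarrow> ('r, 'a) module \<Rightarrow> ('r, 'a \<Rightarrow> 'a) module"
  where "End_algebra R M =
    \<lparr>carrier = {f \<in> carrier M \<rightarrow>\<^sub>E carrier M. linear_map R M M f},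
     mult = (\<lambda>f g. \<lambda>x\<in>carrier M. f (g x)), one = (\<lambda>x\<in>carrier M. x),
     zero = (\<lambda>x\<in>carrier M. \<zero>\<^bsub>M\<^esub>), add = (\<lambda>f g. \<lambda>x\<in>carrier M. f x \<oplus>\<^bsub>M\<^esub> g x),
     smult = (\<lambda>r f. \<lambda>x\<in>carrier M. r \<odot>\<^bsub>M\<^esub> f x)\<rparr>"

lemma End_algebra_simps:
  "f \<in> carrier (End_algebra R M) \<longleftrightarrow> f \<in> carrier M \<rightarrow>\<^sub>E carrier M \<and> linear_map R M M f"
  "f \<otimes>\<^bsub>End_algebra R M\<^esub> g = (\<lambda>x\<in>carrier M. f (g x))"
  "\<one>\<^bsub>End_algebra R M\<^esub> = (\<lambda>x\<in>carrier M. x)"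
  "\<zero>\<^bsub>End_algebra R M\<^esub> = (\<lambda>x\<in>carrier M. \<zero>\<^bsub>M\<^esub>)"
  "f \<oplus>\<^bsub>End_algebra R M\<^esub> g = (\<lambda>x\<in>carrier M. f x \<oplus>\<^bsub>M\<^esub> g x)"
  "r \<odot>\<^bsub>End_algebra R M\<^esub> f = (\<lambda>x\<in>carrier M. r \<odot>\<^bsub>M\<^esub> f x)"
  by (simp_all add: End_algebra_def)

lemma End_algebra_memI:
  assumes "module R M" "linear_map R M M f"
  shows "(\<lambda>x\<in>carrier M. f x) \<in> carrier (End_algebra R M)"
  using assms(2) linear_map_cong[OF assms(1), of "\<lambda>x\<in>carrier M. f x" f M]
  by (auto simp: End_algebra_simps linear_map_closed)

lemma assoc_algebra_End_algebra:
  fixes M :: "('r, 'a) module"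
  assumes M: "module R M"
  shows "assoc_algebra R (End_algebra R M)"
proof -
  interpret M: module R M by fact
  let ?E = "End_algebra R M"
  note mem = End_algebra_memI[OF M]
  have lin: "linear_map R M M f" and c: "\<And>x. x \<in> carrier M \<Longrightarrow> f x \<in> carrier M" 
    and undef: "f \<in> extensional (carrier M)" if "f \<in> carrier ?E" for f
    using that linear_map_closed by (auto simp: End_algebra_simps PiE_def)
  have eqI: "f = g" if "f \<in> extensional (carrier M)" "g \<in> extensional (carrier M)"
    "\<And>x. x \<in> carrier M \<Longrightarrow> f x = g x" for f g :: "'a \<Rightarrow> 'a"
    by (rule extensionalityI[OF that(1,2)]) (rule that(3))
  have mult: "f \<otimes>\<^bsub>?E\<^esub> g \<in> carrier ?E" if "f \<in> carrier ?E" "g \<in> carrier ?E" for f g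
    unfolding End_algebra_simps(2) by (rule mem[OF linear_map_comp[OF lin[OF that(2)] lin[OF that(1)]]])
  have add: "f \<oplus>\<^bsub>?E\<^esub> g \<in> carrier ?E" if "f \<in> carrier ?E" "g \<in> carrier ?E" for f g
    unfolding End_algebra_simps(5)
    by (intro mem linear_mapI)
      (simp_all add: c[OF that(1)] c[OF that(2)] linear_map_add[OF lin[OF that(1)]]
        linear_map_add[OF lin[OF that(2)]] linear_map_smult[OF lin[OF that(1)]]
        linear_map_smult[OF lin[OF that(2)]] M.a_ac M.smult_r_distr)
  have smult: "r \<odot>\<^bsub>?E\<^esub> f \<in> carrier ?E" if "r \<in> carrier R" "f \<in> carrier ?E" for r f
    unfolding End_algebra_simps(6)
    by (intro mem linear_mapI)
      (simp_all add: that(1) c[OF that(2)] linear_map_add[OF lin[OF that(2)]] M.smult_r_distr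
        linear_map_smult[OF lin[OF that(2)]] M.smult_assoc1[symmetric] M.R.m_comm)
  have one: "\<one>\<^bsub>?E\<^esub> \<in> carrier ?E" unfolding End_algebra_simps(3)
    by (intro mem linear_mapI) simp_all
  have zero: "\<zero>\<^bsub>?E\<^esub> \<in> carrier ?E" unfolding End_algebra_simps(4)
    by (intro mem linear_mapI) simp_all
  have inv: "\<exists>g\<in>carrier ?E. g \<oplus>\<^bsub>?E\<^esub> f = \<zero>\<^bsub>?E\<^esub>" if "f \<in> carrier ?E" for f
  proof (rule bexI)
    show "(\<ominus>\<^bsub>R\<^esub> \<one>\<^bsub>R\<^esub>) \<odot>\<^bsub>?E\<^esub> f \<in> carrier ?E" by (rule smult[OF _ that]) simp
    show "(\<ominus>\<^bsub>R\<^esub> \<one>\<^bsub>R\<^esub>) \<odot>\<^bsub>?E\<^esub> f \<oplus>\<^bsub>?E\<^esub> f = \<zero>\<^bsub>?E\<^esub>"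
      using c[OF that] by (intro eqI) (simp_all add: End_algebra_simps M.smult_l_minus M.l_neg)
  qed
  have grp: "abelian_group ?E"
  proof (rule abelian_groupI)
    show "f \<oplus>\<^bsub>?E\<^esub> g \<oplus>\<^bsub>?E\<^esub> h = f \<oplus>\<^bsub>?E\<^esub> (g \<oplus>\<^bsub>?E\<^esub> h)"
      if "f \<in> carrier ?E" "g \<in> carrier ?E" "h \<in> carrier ?E" for f g h
      using c[OF that(1)] c[OF that(2)] c[OF that(3)]
      by (intro eqI) (simp_all add: End_algebra_simps M.a_assoc)
    show "f \<oplus>\<^bsub>?E\<^esub> g = g \<oplus>\<^bsub>?E\<^esub> f" if "f \<in> carrier ?E" "g \<in> carrier ?E" for f g
      using c[OF that(1)] c[OF that(2)] by (intro eqI) (simp_all add: End_algebra_simps M.a_comm)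
    show "\<zero>\<^bsub>?E\<^esub> \<oplus>\<^bsub>?E\<^esub> f = f" if "f \<in> carrier ?E" for f
      using c[OF that] undef[OF that] by (intro eqI) (simp_all add: End_algebra_simps)
  qed (fact add zero inv)+
  have mod: "module R ?E"
  proof (rule moduleI[OF M.R.is_cring grp smult])
    fix r s f assume r: "r \<in> carrier R" and s: "s \<in> carrier R" and f: "f \<in> carrier ?E"
    show "(r \<oplus>\<^bsub>R\<^esub> s) \<odot>\<^bsub>?E\<^esub> f = r \<odot>\<^bsub>?E\<^esub> f \<oplus>\<^bsub>?E\<^esub> s \<odot>\<^bsub>?E\<^esub> f"
      using c[OF f] r s by (intro eqI) (simp_all add: End_algebra_simps M.smult_l_distr)
    show "(r \<otimes>\<^bsub>R\<^esub> s) \<odot>\<^bsub>?E\<^esub> f = r \<odot>\<^bsub>?E\<^esub> (s \<odot>\<^bsub>?E\<^esub> f)"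
      using c[OF f] r s by (intro eqI) (simp_all add: End_algebra_simps M.smult_assoc1)
  next
    fix r f g assume r: "r \<in> carrier R" and f: "f \<in> carrier ?E" and g: "g \<in> carrier ?E"
    show "r \<odot>\<^bsub>?E\<^esub> (f \<oplus>\<^bsub>?E\<^esub> g) = r \<odot>\<^bsub>?E\<^esub> f \<oplus>\<^bsub>?E\<^esub> r \<odot>\<^bsub>?E\<^esub> g"
      using c[OF f] c[OF g] r by (intro eqI) (simp_all add: End_algebra_simps M.smult_r_distr)
  next
    fix f assume f: "f \<in> carrier ?E"
    show "\<one>\<^bsub>R\<^esub> \<odot>\<^bsub>?E\<^esub> f = f"
      using c[OF f] undef[OF f] by (intro eqI) (simp_all add: End_algebra_simps)
  qed
  have mon: "monoid ?E"
  proof (rule monoidI)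
    show "f \<otimes>\<^bsub>?E\<^esub> g \<otimes>\<^bsub>?E\<^esub> h = f \<otimes>\<^bsub>?E\<^esub> (g \<otimes>\<^bsub>?E\<^esub> h)"
      if "f \<in> carrier ?E" "g \<in> carrier ?E" "h \<in> carrier ?E" for f g h
      using c[OF that(2)] c[OF that(3)] by (intro eqI) (simp_all add: End_algebra_simps)
    show "\<one>\<^bsub>?E\<^esub> \<otimes>\<^bsub>?E\<^esub> f = f" "f \<otimes>\<^bsub>?E\<^esub> \<one>\<^bsub>?E\<^esub> = f" if "f \<in> carrier ?E" for f
      using c[OF that] undef[OF that] by (intro eqI; simp add: End_algebra_simps)+
  qed (fact mult one)+
  have bil: "bilinear_map R ?E ?E ?E (\<otimes>\<^bsub>?E\<^esub>)"
  proof (rule bilinear_mapI[OF mult])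
    fix f g h assume f: "f \<in> carrier ?E" and g: "g \<in> carrier ?E" and h: "h \<in> carrier ?E"
    show "(f \<oplus>\<^bsub>?E\<^esub> g) \<otimes>\<^bsub>?E\<^esub> h = f \<otimes>\<^bsub>?E\<^esub> h \<oplus>\<^bsub>?E\<^esub> g \<otimes>\<^bsub>?E\<^esub> h"
      using c[OF h] by (intro eqI) (simp_all add: End_algebra_simps)
    show "f \<otimes>\<^bsub>?E\<^esub> (g \<oplus>\<^bsub>?E\<^esub> h) = f \<otimes>\<^bsub>?E\<^esub> g \<oplus>\<^bsub>?E\<^esub> f \<otimes>\<^bsub>?E\<^esub> h"
      using c[OF g] c[OF h] linear_map_add[OF lin[OF f]] by (intro eqI) (simp_all add: End_algebra_simps)
  next
    fix r f g assume r: "r \<in> carrier R" and f: "f \<in> carrier ?E" and g: "g \<in> carrier ?E"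
    show "(r \<odot>\<^bsub>?E\<^esub> f) \<otimes>\<^bsub>?E\<^esub> g = r \<odot>\<^bsub>?E\<^esub> (f \<otimes>\<^bsub>?E\<^esub> g)"
      using c[OF g] by (intro eqI) (simp_all add: End_algebra_simps)
    show "f \<otimes>\<^bsub>?E\<^esub> (r \<odot>\<^bsub>?E\<^esub> g) = r \<odot>\<^bsub>?E\<^esub> (f \<otimes>\<^bsub>?E\<^esub> g)"
      using c[OF g] r linear_map_smult[OF lin[OF f] r] by (intro eqI) (simp_all add: End_algebra_simps)
  qed
  show ?thesis by (rule assoc_algebraI[OF mod mon bil])
qed

lemma tensor_lift_cong:
  assumes "\<And>m n. \<lbrakk>m \<in> carrier M; n \<in> carrier N\<rbrakk> \<Longrightarrow> f m n = g m n"
  shows "tensor_lift R M N P f = tensor_lift R M N P g"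
  using assms by (simp add: tensor_lift_def cong: ball_cong)

lemma tensor_lift_comp:
  assumes M: "module R M" and N: "module R N" and P: "module R P" and Q: "module R Q"
    and f: "bilinear_map R M N P f" and D: "linear_map R P Q D" and g: "bilinear_map R M N Q g"
    and eq: "\<And>m n. \<lbrakk>m \<in> carrier M; n \<in> carrier N\<rbrakk> \<Longrightarrow> D (f m n) = g m n"
    and t: "t \<in> carrier (tensor_product R M N)"
  shows "D (tensor_lift R M N P f t) = tensor_lift R M N Q g t"
  by (rule tensor_linear_eq[OF M N linear_map_comp[OF tensor_lift_linear[OF M N P f] D]
        tensor_lift_linear[OF M N Q g] _ t])
    (simp add: tensor_lift_pure[OF M N P f] tensor_lift_pure[OF M N Q g] eq)

lemma tensor_lift_add:
  assumes M: "module R M" and N: "module R N" and P: "module R P"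
    and f: "bilinear_map R M N P f" and g: "bilinear_map R M N P g" and h: "bilinear_map R M N P h"
    and eq: "\<And>m n. \<lbrakk>m \<in> carrier M; n \<in> carrier N\<rbrakk> \<Longrightarrow> h m n = f m n \<oplus>\<^bsub>P\<^esub> g m n"
    and t: "t \<in> carrier (tensor_product R M N)"
  shows "tensor_lift R M N P h t = tensor_lift R M N P f t \<oplus>\<^bsub>P\<^esub> tensor_lift R M N P g t"
proof -
  interpret P: module R P by fact
  note lf = tensor_lift_linear[OF M N P f] and lg = tensor_lift_linear[OF M N P g]
  have "linear_map R (tensor_product R M N) P
      (\<lambda>t. tensor_lift R M N P f t \<oplus>\<^bsub>P\<^esub> tensor_lift R M N P g t)"
    using linear_map_closed[OF lf] linear_map_closed[OF lg]
    by (intro linear_mapI)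
      (simp_all add: linear_map_add[OF lf] linear_map_add[OF lg] linear_map_smult[OF lf]
        linear_map_smult[OF lg] P.a_ac P.smult_r_distr)
  from tensor_linear_eq[OF M N tensor_lift_linear[OF M N P h] this _ t]
  show ?thesis
    by (simp add: tensor_lift_pure[OF M N P f] tensor_lift_pure[OF M N P g] tensor_lift_pure[OF M N P h] eq)
qed

lemma left_module_action_unique:
  assumes H: "assoc_algebra R H" and g: "generates R H X"
    and f: "left_module_action R H A f" and h: "left_module_action R H A h"
    and eq: "\<And>x a. \<lbrakk>x \<in> X; a \<in> carrier A\<rbrakk> \<Longrightarrow> f x a = h x a"
    and u: "u \<in> carrier H" and a: "a \<in> carrier A"
  shows "f u a = h u a"
  using H g u a
proof (induction u arbitrary: a rule: generates_induct)
  note bf = left_module_action_bilinear[OF f] and bh = left_module_action_bilinear[OF h]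
  {
    case one then show ?case by (simp add: left_module_action_one[OF f] left_module_action_one[OF h])
  next
    case (mult x u)
    then show ?case
      by (simp add: left_module_action_mult[OF f] left_module_action_mult[OF h] eq bilinear_map_closed[OF bh])
  next
    case (add u v) then show ?case
      by (simp add: bilinear_map_add_left[OF bf] bilinear_map_add_left[OF bh])
  next
    case (smult r u) then show ?case
      by (simp add: bilinear_map_smult_left[OF bf] bilinear_map_smult_left[OF bh])
  }
qed

context lie_cocycle
begin

text \<open>
  By the Jacobi identity the operators \<open>{x, \<cdot>}\<close> with \<open>x\<close> in the Lie algebra satisfy the relations of the
  enveloping algebra; the cocycle drops out of them because constants are central.
\<close>

lemma pb_gen_commutator:
  assumes x: "x \<in> carrier L" and y: "y \<in> carrier L" and a: "a \<in> carrier S"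
  shows "pb (\<iota> x) (pb (\<iota> y) a) = pb (\<iota> (bracket L x y)) a \<oplus>\<^bsub>S\<^esub> pb (\<iota> y) (pb (\<iota> x) a)"
proof -
  have "pb (\<iota> (bracket L x y)) a = pb (\<iota> x) (pb (\<iota> y) a) \<ominus>\<^bsub>S\<^esub> pb (\<iota> y) (pb (\<iota> x) a)"
    using pb_jacobi[OF iota_closed[OF x] iota_closed[OF y] a] pb_gen_left[OF assms] by (simp add: jac_def)
  then show ?thesis
    using pb_closed iota_closed[OF x] iota_closed[OF y] a
    by (simp add: S.minus_eq S.a_assoc S.l_neg)
qed

text \<open>
  The action is the homomorphism into the operators on \<open>Sym(\<gg>)\<close> that sends \<open>x\<close> to \<open>{x, \<cdot>}\<close>. The compatibility of
  \<open>u\<close> with products passes from \<open>u\<close> to \<open>x u\<close>, because \<open>x\<close> is primitive and acts by a derivation; that with the unit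
  because a derivation kills \<open>\<one>\<close>.
\<close>

lemma module_algebra_action_exists:
  obtains act where "module_algebra_action R U (ULie_comult R L) (ULie_counit R L) S act"
    "\<And>x a. \<lbrakk>x \<in> carrier L; a \<in> carrier S\<rbrakk> \<Longrightarrow> act (\<upsilon> x) a = pb (\<iota> x) a"
proof -
  let ?E = "End_algebra R S" and ?f = "\<lambda>x. \<lambda>a\<in>carrier S. pb (\<iota> x) a"
  have E: "assoc_algebra R ?E" by (rule assoc_algebra_End_algebra[OF S.module_axioms])
  have fE: "?f x \<in> carrier ?E" if "x \<in> carrier L" for x
    by (rule End_algebra_memI[OF S.module_axioms derivation_linear[OF pb_right[OF iota_closed[OF that]]]])
  have lin: "linear_map R L ?E ?f"
  proof (rule linear_mapI[OF fE])
    show "?f (x \<oplus>\<^bsub>L\<^esub> y) = ?f x \<oplus>\<^bsub>?E\<^esub> ?f y" if "x \<in> carrier L" "y \<in> carrier L" for x y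
      unfolding End_algebra_simps
      by (rule restrict_ext) (simp add: that linear_map_add[OF iota_linear] pb_add_left iota_closed)
    show "?f (r \<odot>\<^bsub>L\<^esub> x) = r \<odot>\<^bsub>?E\<^esub> ?f x" if "r \<in> carrier R" "x \<in> carrier L" for r x
      unfolding End_algebra_simps
      by (rule restrict_ext) (simp add: that linear_map_smult[OF iota_linear] pb_smult_left iota_closed)
  qed
  have comm: "?f x \<otimes>\<^bsub>?E\<^esub> ?f y = ?f (bracket L x y) \<oplus>\<^bsub>?E\<^esub> ?f y \<otimes>\<^bsub>?E\<^esub> ?f x"
    if "x \<in> carrier L" "y \<in> carrier L" for x y
    unfolding End_algebra_simps
    by (rule restrict_ext) (simp add: that pb_gen_commutator[OF that] pb_closed iota_closed)
  obtain act where act: "algebra_hom R U ?E act"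
    and act_gen: "\<And>x. x \<in> carrier L \<Longrightarrow> act (\<upsilon> x) = ?f x"
    by (rule ULie_universal[OF L.lie_algebra_axioms E lin comm]) (assumption+, rule that)
  note al = algebra_hom_linear[OF act]
  have actE: "act u \<in> carrier ?E" if "u \<in> carrier U" for u by (rule linear_map_closed[OF al that])
  have act_lin: "linear_map R S S (act u)" if "u \<in> carrier U" for u
    using actE[OF that] by (simp add: End_algebra_simps)
  note actc = linear_map_closed[OF act_lin]
  have bil: "bilinear_map R U S S act"
    using actc by (intro bilinear_mapI)
      (simp_all add: linear_map_add[OF al] linear_map_smult[OF al] linear_map_add[OF act_lin]
        linear_map_smult[OF act_lin] End_algebra_simps)
  have lm: "left_module_action R U S act"
    using bil by (rule left_module_actionI)
      (simp_all add: algebra_hom_one[OF act] algebra_hom_mult[OF act] End_algebra_simps)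
  have gen: "act (\<upsilon> x \<otimes>\<^bsub>U\<^esub> u) a = pb (\<iota> x) (act u a)"
    if "x \<in> carrier L" "u \<in> carrier U" "a \<in> carrier S" for x u a
    using that by (simp add: left_module_action_mult[OF lm] upsilon_closed act_gen actc)
  have fbil: "bilinear_map R U U S (\<lambda>u\<^sub>1 u\<^sub>2. act u\<^sub>1 a \<otimes>\<^bsub>S\<^esub> act u\<^sub>2 b)"
    if "a \<in> carrier S" "b \<in> carrier S" for a b
    by (rule bilinear_map_comp[OF SA.mult_bilinear bilinear_map_left[OF bil that(1)]
          bilinear_map_left[OF bil that(2)]])
  note DU = linear_map_closed[OF algebra_hom_linear[OF ULie_comult_hom[OF L.lie_algebra_axioms]]]
  have sweedler: "act u (a \<otimes>\<^bsub>S\<^esub> b) =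
      tensor_lift R U U S (\<lambda>u\<^sub>1 u\<^sub>2. act u\<^sub>1 a \<otimes>\<^bsub>S\<^esub> act u\<^sub>2 b) (ULie_comult R L u)"
    if u: "u \<in> carrier U" and a: "a \<in> carrier S" and b: "b \<in> carrier S" for u a b
    using U.assoc_algebra_axioms U_generates u
  proof (induction u rule: generates_induct)
    case one
    show ?case using a b
      by (simp add: sweedler_one[OF L.lie_algebra_axioms S.module_axioms fbil[OF a b]] left_module_action_one[OF lm])
  next
    case (mult x u)
    then obtain y where y: "y \<in> carrier L" "x = \<upsilon> y" by auto
    let ?f = "\<lambda>u\<^sub>1 u\<^sub>2. act u\<^sub>1 a \<otimes>\<^bsub>S\<^esub> act u\<^sub>2 b"
    let ?g = "\<lambda>u\<^sub>1 u\<^sub>2. ?f u\<^sub>1 (\<upsilon> y \<otimes>\<^bsub>U\<^esub> u\<^sub>2) \<oplus>\<^bsub>S\<^esub> ?f (\<upsilon> y \<otimes>\<^bsub>U\<^esub> u\<^sub>1) u\<^sub>2"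
    let ?D = "pb (\<iota> y)"
    note i = iota_closed[OF y(1)]
    have D: "linear_map R S S ?D" by (rule derivation_linear[OF pb_right[OF i]])
    have eq: "?D (?f u\<^sub>1 u\<^sub>2) = ?g u\<^sub>1 u\<^sub>2" if "u\<^sub>1 \<in> carrier U" "u\<^sub>2 \<in> carrier U" for u\<^sub>1 u\<^sub>2
      using that a b i y by (simp add: pb_mult_right actc gen pb_closed S.m_comm)
    have g: "bilinear_map R U U S ?g"
      using linear_map_bilinear_comp[OF fbil[OF a b] D] eq
      by (simp add: bilinear_map_def linear_map_def Pi_iff)
    have "act (x \<otimes>\<^bsub>U\<^esub> u) (a \<otimes>\<^bsub>S\<^esub> b) = ?D (act u (a \<otimes>\<^bsub>S\<^esub> b))"
      using y mult a b by (simp add: gen)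
    also have "\<dots> = tensor_lift R U U S ?g (ULie_comult R L u)"
      unfolding mult(4)
      by (rule tensor_lift_comp[OF U.module_axioms U.module_axioms S.module_axioms S.module_axioms
            fbil[OF a b] D g eq]) (use DU[OF mult(3)] in simp_all)
    also have "\<dots> = tensor_lift R U U S ?f (ULie_comult R L (x \<otimes>\<^bsub>U\<^esub> u))"
      unfolding y(2)
      by (rule sweedler_mult_gen[OF L.lie_algebra_axioms S.module_axioms fbil[OF a b] y(1) mult(3), symmetric])
    finally show ?case .
  next
    case (add u v)
    then show ?case using a b linear_map_add[OF sweedler_linear[OF L.lie_algebra_axioms S.module_axioms fbil[OF a b]]]
      by (simp add: bilinear_map_add_left[OF bil])
  next
    case (smult r u)
    then show ?case using a b linear_map_smult[OF sweedler_linear[OF L.lie_algebra_axioms S.module_axioms fbil[OF a b]]]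
      by (simp add: bilinear_map_smult_left[OF bil])
  qed
  note eps = ULie_counit_hom[OF L.lie_algebra_axioms]
  have eps_closed: "ULie_counit R L u \<in> carrier R" if "u \<in> carrier U" for u
    using linear_map_closed[OF algebra_hom_linear[OF eps] that] by simp
  have counit: "act u \<one>\<^bsub>S\<^esub> = ULie_counit R L u \<odot>\<^bsub>S\<^esub> \<one>\<^bsub>S\<^esub>" if u: "u \<in> carrier U" for u
    using U.assoc_algebra_axioms U_generates u
  proof (induction u rule: generates_induct)
    case one show ?case by (simp add: left_module_action_one[OF lm] algebra_hom_one[OF eps])
  next
    case (mult x u)
    then obtain y where y: "y \<in> carrier L" "x = \<upsilon> y" by auto
    have "ULie_counit R L (x \<otimes>\<^bsub>U\<^esub> u) = \<zero>\<^bsub>R\<^esub>"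
      using algebra_hom_mult[OF eps mult(2,3)] y eps_closed[OF mult(3)]
      by (simp add: ULie_counit_gen[OF L.lie_algebra_axioms])
    moreover have "act (x \<otimes>\<^bsub>U\<^esub> u) \<one>\<^bsub>S\<^esub> = \<zero>\<^bsub>S\<^esub>"
      using y mult eps_closed[OF mult(3)] by (simp add: gen pb_smult_right iota_closed pb_one)
    ultimately show ?case by simp
  next
    case (add u v)
    then show ?case using eps_closed linear_map_add[OF algebra_hom_linear[OF eps]]
      by (simp add: bilinear_map_add_left[OF bil] S.smult_l_distr)
  next
    case (smult r u)
    then show ?case using eps_closed linear_map_smult[OF algebra_hom_linear[OF eps]]
      by (simp add: bilinear_map_smult_left[OF bil] S.smult_assoc1)
  qed
  have "module_algebra_action R U (ULie_comult R L) (ULie_counit R L) S act"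
    using lm sweedler counit by (simp add: module_algebra_action_def)
  then show thesis by (rule that) (simp add: act_gen)
qed

definition act :: "('g list \<Rightarrow> 'r) set set \<Rightarrow> ('g list \<Rightarrow> 'r) set set \<Rightarrow> ('g list \<Rightarrow> 'r) set set"
  where "act = Sym_action R L \<sigma>"

lemma
  shows act_action: "left_module_action R U S act"
    and act_gen: "\<lbrakk>x \<in> carrier L; a \<in> carrier S\<rbrakk> \<Longrightarrow> act (\<upsilon> x) a = pb (\<iota> x) a"
proof -
  let ?Q = "module_algebra_action R U (ULie_comult R L) (ULie_counit R L) S"
  let ?P = "\<lambda>act. ?Q act \<and>
    (\<forall>x\<in>carrier L. \<forall>a\<in>carrier S. act (\<upsilon> x) a = lie_poisson_bracket R L \<sigma> (\<iota> x) a)"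
  obtain h where "?Q h" "\<And>x a. \<lbrakk>x \<in> carrier L; a \<in> carrier S\<rbrakk> \<Longrightarrow> h (\<upsilon> x) a = pb (\<iota> x) a"
    by (rule module_algebra_action_exists) (rule that)
  then have h: "?P h" by (simp add: pb_def)
  have lm: "left_module_action R U S h" if "?P h" for h
    using that by (simp add: module_algebra_action_def)
  have "?P act"
    unfolding act_def Sym_action_def Let_def
  proof (rule THE_extensional2[where P = ?P, OF h])
    show "h x y \<in> carrier S" if "?P h" "x \<in> carrier U" "y \<in> carrier S" for h x y
      by (rule bilinear_map_closed[OF left_module_action_bilinear[OF lm[OF that(1)]] that(2,3)])
    show "h x y = h' x y" if "?P h" "?P h'" "x \<in> carrier U" "y \<in> carrier S" for h h' x y
      by (rule left_module_action_unique[OF U.assoc_algebra_axioms U_generates lm[OF that(1)] lm[OF that(2)] _ that(3,4)])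
        (use that(1)[THEN conjunct2] that(2)[THEN conjunct2] in auto)
    show "?P h'" if h: "?P h" and eq: "\<And>x y. x \<in> carrier U \<Longrightarrow> y \<in> carrier S \<Longrightarrow> h' x y = h x y" for h h'
    proof
      note lh = left_module_actionD[OF lm[OF h]] and bh = bilinear_mapE[OF left_module_action_bilinear[OF lm[OF h]]]
      have "left_module_action R U S h'"
        by (intro left_module_actionI bilinear_mapI) (simp_all add: eq lh(2,3) bh)
      moreover have "tensor_lift R U U S (\<lambda>u\<^sub>1 u\<^sub>2. h' u\<^sub>1 a \<otimes>\<^bsub>S\<^esub> h' u\<^sub>2 b) =
          tensor_lift R U U S (\<lambda>u\<^sub>1 u\<^sub>2. h u\<^sub>1 a \<otimes>\<^bsub>S\<^esub> h u\<^sub>2 b)"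
        if "a \<in> carrier S" "b \<in> carrier S" for a b
        by (rule tensor_lift_cong) (simp add: eq that)
      ultimately show "?Q h'"
        using h[THEN conjunct1] by (simp add: module_algebra_action_def eq)
      show "\<forall>x\<in>carrier L. \<forall>a\<in>carrier S. h' (\<upsilon> x) a = lie_poisson_bracket R L \<sigma> (\<iota> x) a"
        using h[THEN conjunct2] by (simp add: eq upsilon_closed)
    qed
  qed
  then show "left_module_action R U S act"
    "\<lbrakk>x \<in> carrier L; a \<in> carrier S\<rbrakk> \<Longrightarrow> act (\<upsilon> x) a = pb (\<iota> x) a"
    using lm by (auto simp: pb_def)
qed

lemmas act_bilinear = left_module_action_bilinear[OF act_action]
lemmas act_closed = bilinear_map_closed[OF act_bilinear]
lemmas act_one = left_module_action_one[OF act_action]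

lemma act_gen_mult:
  "\<lbrakk>x \<in> carrier L; u \<in> carrier U; a \<in> carrier S\<rbrakk> \<Longrightarrow> act (\<upsilon> x \<otimes>\<^bsub>U\<^esub> u) a = pb (\<iota> x) (act u a)"
  by (simp add: left_module_action_mult[OF act_action] upsilon_closed act_gen act_closed)

end

section \<open>The smash product\<close>

context lie_cocycle
begin

abbreviation "TP \<equiv> tensor_product R S U"
abbreviation "pt \<equiv> pure_tensor R S U"
abbreviation "W \<equiv> Sym_smash_ULie R L \<sigma>"

sublocale TP: module R TP by (rule module_tensor_product[OF S.module_axioms U.module_axioms])

lemmas pt_bilinear = pure_tensor_bilinear[OF S.module_axioms U.module_axioms]
lemmas pt_closed = bilinear_map_closed[OF pt_bilinear]
lemmas pt_add_left = bilinear_map_add_left[OF pt_bilinear]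
lemmas pt_add_right = bilinear_map_add_right[OF pt_bilinear]
lemmas pt_smult_right = bilinear_map_smult_right[OF pt_bilinear]
lemmas TP_induct = tensor_induct[OF S.module_axioms U.module_axioms, consumes 1, case_names pure add]
lemmas TP_linear_eq = tensor_linear_eq[OF S.module_axioms U.module_axioms]

lemma pt_zero_left: "u \<in> carrier U \<Longrightarrow> pt \<zero>\<^bsub>S\<^esub> u = \<zero>\<^bsub>TP\<^esub>"
  by (rule linear_map_zero[OF S.module_axioms TP.module_axioms bilinear_map_left[OF pt_bilinear]])

lemma comult_closed: "u \<in> carrier U \<Longrightarrow> ULie_comult R L u \<in> carrier (tensor_product R U U)"
  using linear_map_closed[OF algebra_hom_linear[OF ULie_comult_hom[OF L.lie_algebra_axioms]]] by simp

text \<open>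
  The summand of the Sweedler sum for \<open>(a # u) (b # v)\<close> as a function of \<open>u\<^sub>1\<close> and \<open>u\<^sub>2\<close>.
\<close>

definition smash_term ::
  "('g list \<Rightarrow> 'r) set set \<Rightarrow> ('g list \<Rightarrow> 'r) set set \<Rightarrow> ('g list \<Rightarrow> 'r) set set \<Rightarrow>
   ('g list \<Rightarrow> 'r) set set \<Rightarrow> ('g list \<Rightarrow> 'r) set set \<Rightarrow>
   (('g list \<Rightarrow> 'r) set set \<times> ('g list \<Rightarrow> 'r) set set \<Rightarrow> 'r) set"
  where "smash_term a b v = (\<lambda>u\<^sub>1 u\<^sub>2. pt (a \<otimes>\<^bsub>S\<^esub> act u\<^sub>1 b) (u\<^sub>2 \<otimes>\<^bsub>U\<^esub> v))"

definition smash_value ::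
  "('g list \<Rightarrow> 'r) set set \<Rightarrow> ('g list \<Rightarrow> 'r) set set \<Rightarrow> ('g list \<Rightarrow> 'r) set set \<Rightarrow>
   ('g list \<Rightarrow> 'r) set set \<Rightarrow> (('g list \<Rightarrow> 'r) set set \<times> ('g list \<Rightarrow> 'r) set set \<Rightarrow> 'r) set"
  where "smash_value a u b v = tensor_lift R U U TP (smash_term a b v) (ULie_comult R L u)"

lemma W_simps:
  "carrier W = carrier TP" "zero W = zero TP" "add W = add TP" "smult W = smult TP"
  "one W = pt \<one>\<^bsub>S\<^esub> \<one>\<^bsub>U\<^esub>" "mult W = tensor_lift2 R S U TP smash_value"
  by (simp_all add: Sym_smash_ULie_def smash_product_def smash_value_def[abs_def] smash_term_def act_def)

lemma smash_term_linear:
  assumes "u\<^sub>1 \<in> carrier U" "u\<^sub>2 \<in> carrier U"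
  shows "\<lbrakk>b \<in> carrier S; v \<in> carrier U\<rbrakk> \<Longrightarrow> linear_map R S TP (\<lambda>a. smash_term a b v u\<^sub>1 u\<^sub>2)"
    and "\<lbrakk>a \<in> carrier S; v \<in> carrier U\<rbrakk> \<Longrightarrow> linear_map R S TP (\<lambda>b. smash_term a b v u\<^sub>1 u\<^sub>2)"
    and "\<lbrakk>a \<in> carrier S; b \<in> carrier S\<rbrakk> \<Longrightarrow> linear_map R U TP (\<lambda>v. smash_term a b v u\<^sub>1 u\<^sub>2)"
  unfolding smash_term_def
proof -
  note u = assms
  assume b: "b \<in> carrier S" and v: "v \<in> carrier U"
  show "linear_map R S TP (\<lambda>a. pt (a \<otimes>\<^bsub>S\<^esub> act u\<^sub>1 b) (u\<^sub>2 \<otimes>\<^bsub>U\<^esub> v))"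
    by (rule linear_map_comp[OF bilinear_map_left[OF SA.mult_bilinear act_closed[OF u(1) b]]
          bilinear_map_left[OF pt_bilinear U.m_closed[OF u(2) v]]])
next
  note u = assms
  assume a: "a \<in> carrier S" and v: "v \<in> carrier U"
  show "linear_map R S TP (\<lambda>b. pt (a \<otimes>\<^bsub>S\<^esub> act u\<^sub>1 b) (u\<^sub>2 \<otimes>\<^bsub>U\<^esub> v))"
    by (rule linear_map_comp[OF linear_map_comp[OF bilinear_map_right[OF act_bilinear u(1)]
            bilinear_map_right[OF SA.mult_bilinear a]] bilinear_map_left[OF pt_bilinear U.m_closed[OF u(2) v]]])
next
  note u = assms
  assume a: "a \<in> carrier S" and b: "b \<in> carrier S"
  show "linear_map R U TP (\<lambda>v. pt (a \<otimes>\<^bsub>S\<^esub> act u\<^sub>1 b) (u\<^sub>2 \<otimes>\<^bsub>U\<^esub> v))"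
    by (rule linear_map_comp[OF bilinear_map_right[OF U.mult_bilinear u(2)]
          bilinear_map_right[OF pt_bilinear S.m_closed[OF a act_closed[OF u(1) b]]]])
qed

lemma smash_term_bilinear:
  assumes a: "a \<in> carrier S" and b: "b \<in> carrier S" and v: "v \<in> carrier U"
  shows "bilinear_map R U U TP (smash_term a b v)"
  unfolding smash_term_def
  by (rule bilinear_map_comp[OF pt_bilinear linear_map_comp[OF bilinear_map_left[OF act_bilinear b]
          bilinear_map_right[OF SA.mult_bilinear a]] bilinear_map_left[OF U.mult_bilinear v]])

lemmas UU_lift_parameter =
  tensor_lift_linear_parameter[OF U.module_axioms U.module_axioms TP.module_axioms]

lemma smash_value_bilinear_right:
  assumes a: "a \<in> carrier S" and u: "u \<in> carrier U"
  shows "bilinear_map R S U TP (smash_value a u)"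
  unfolding bilinear_map_def
proof (intro conjI ballI)
  note D = comult_closed[OF u]
  fix b assume b: "b \<in> carrier S"
  show "linear_map R U TP (smash_value a u b)"
    unfolding smash_value_def
    by (rule UU_lift_parameter[OF U.module_axioms smash_term_bilinear[OF a b] smash_term_linear(3)[OF _ _ a b] D])
next
  note D = comult_closed[OF u]
  fix v assume v: "v \<in> carrier U"
  show "linear_map R S TP (\<lambda>b. smash_value a u b v)"
    unfolding smash_value_def
    by (rule UU_lift_parameter[OF S.module_axioms smash_term_bilinear[OF a _ v] smash_term_linear(2)[OF _ _ a v] D])
qed

lemma smash_value_bilinear_left:
  assumes b: "b \<in> carrier S" and v: "v \<in> carrier U"
  shows "bilinear_map R S U TP (\<lambda>a u. smash_value a u b v)"
  unfolding bilinear_map_def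
proof (intro conjI ballI)
  fix a assume a: "a \<in> carrier S"
  show "linear_map R U TP (\<lambda>u. smash_value a u b v)"
    unfolding smash_value_def
    by (rule sweedler_linear[OF L.lie_algebra_axioms TP.module_axioms smash_term_bilinear[OF a b v]])
next
  fix u assume u: "u \<in> carrier U"
  show "linear_map R S TP (\<lambda>a. smash_value a u b v)"
    unfolding smash_value_def
    by (rule UU_lift_parameter[OF S.module_axioms smash_term_bilinear[OF _ b v]
          smash_term_linear(1)[OF _ _ b v] comult_closed[OF u]])
qed

lemma W_mult_bilinear_TP: "bilinear_map R TP TP TP (\<otimes>\<^bsub>W\<^esub>)"
  unfolding W_simps
  by (rule tensor_lift2_bilinear[OF S.module_axioms U.module_axioms TP.module_axioms
        smash_value_bilinear_right smash_value_bilinear_left])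

lemma W_mult_pure:
  "\<lbrakk>a \<in> carrier S; u \<in> carrier U; b \<in> carrier S; v \<in> carrier U\<rbrakk> \<Longrightarrow>
    pt a u \<otimes>\<^bsub>W\<^esub> pt b v = smash_value a u b v"
  unfolding W_simps
  by (rule tensor_lift2_pure[OF S.module_axioms U.module_axioms TP.module_axioms
        smash_value_bilinear_right smash_value_bilinear_left])

lemma module_W: "module R W"
  by (rule module_cong[OF TP.module_axioms]) (simp_all add: W_simps)

lemma W_mult_bilinear: "bilinear_map R W W W (\<otimes>\<^bsub>W\<^esub>)"
  using W_mult_bilinear_TP by (simp add: bilinear_map_def linear_map_def W_simps(1-4))

lemmas W_closed = bilinear_map_closed[OF W_mult_bilinear_TP]
lemmas W_add_left = bilinear_map_add_left[OF W_mult_bilinear_TP]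
lemmas W_add_right = bilinear_map_add_right[OF W_mult_bilinear_TP]
lemmas W_smult_left = bilinear_map_smult_left[OF W_mult_bilinear_TP]

text \<open>
  The two products that determine all others: multiplication by \<open>a # \<one>\<close> and by \<open>\<one> # x\<close> from the left. Once
  associativity is known they make the coproduct superfluous.
\<close>

lemma W_mult_Sym:
  assumes a: "a \<in> carrier S" and b: "b \<in> carrier S" and v: "v \<in> carrier U"
  shows "pt a \<one>\<^bsub>U\<^esub> \<otimes>\<^bsub>W\<^esub> pt b v = pt (a \<otimes>\<^bsub>S\<^esub> b) v"
  using assms
  by (simp add: W_mult_pure smash_value_def
      sweedler_one[OF L.lie_algebra_axioms TP.module_axioms smash_term_bilinear[OF a b v]])
    (simp add: smash_term_def act_one)

lemma smash_value_gen:
  assumes a: "a \<in> carrier S" and x: "x \<in> carrier L" and u: "u \<in> carrier U"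
    and b: "b \<in> carrier S" and v: "v \<in> carrier U"
  shows "smash_value a (\<upsilon> x \<otimes>\<^bsub>U\<^esub> u) b v = tensor_lift R U U TP
    (\<lambda>u\<^sub>1 u\<^sub>2. pt (a \<otimes>\<^bsub>S\<^esub> act u\<^sub>1 b) (\<upsilon> x \<otimes>\<^bsub>U\<^esub> u\<^sub>2 \<otimes>\<^bsub>U\<^esub> v) \<oplus>\<^bsub>TP\<^esub> pt (a \<otimes>\<^bsub>S\<^esub> pb (\<iota> x) (act u\<^sub>1 b)) (u\<^sub>2 \<otimes>\<^bsub>U\<^esub> v))
    (ULie_comult R L u)"
  unfolding smash_value_def
    sweedler_mult_gen[OF L.lie_algebra_axioms TP.module_axioms smash_term_bilinear[OF a b v] x u]
  by (rule arg_cong[of _ _ "\<lambda>h. h (ULie_comult R L u)"], rule tensor_lift_cong)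
    (simp add: smash_term_def act_gen_mult x b)

lemma W_mult_gen:
  assumes x: "x \<in> carrier L" and b: "b \<in> carrier S" and v: "v \<in> carrier U"
  shows "pt \<one>\<^bsub>S\<^esub> (\<upsilon> x) \<otimes>\<^bsub>W\<^esub> pt b v = pt (pb (\<iota> x) b) v \<oplus>\<^bsub>TP\<^esub> pt b (\<upsilon> x \<otimes>\<^bsub>U\<^esub> v)"
proof -
  note st = smash_term_bilinear[OF S.one_closed b v]
  have st': "bilinear_map R U U TP
      (\<lambda>u\<^sub>1 u\<^sub>2. smash_term \<one>\<^bsub>S\<^esub> b v u\<^sub>1 (\<upsilon> x \<otimes>\<^bsub>U\<^esub> u\<^sub>2) \<oplus>\<^bsub>TP\<^esub> smash_term \<one>\<^bsub>S\<^esub> b v (\<upsilon> x \<otimes>\<^bsub>U\<^esub> u\<^sub>1) u\<^sub>2)"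
    using bilinear_map_closed[OF st] upsilon_closed[OF x]
    by (intro bilinear_mapI)
      (simp_all add: U.r_distr U.smult_mult_right bilinear_map_add_left[OF st] bilinear_map_add_right[OF st]
        bilinear_map_smult_left[OF st] bilinear_map_smult_right[OF st] TP.a_ac TP.smult_r_distr)
  have "pt \<one>\<^bsub>S\<^esub> (\<upsilon> x) \<otimes>\<^bsub>W\<^esub> pt b v = smash_value \<one>\<^bsub>S\<^esub> (\<upsilon> x \<otimes>\<^bsub>U\<^esub> \<one>\<^bsub>U\<^esub>) b v"
    using assms by (simp add: W_mult_pure upsilon_closed)
  also have "\<dots> = smash_term \<one>\<^bsub>S\<^esub> b v \<one>\<^bsub>U\<^esub> (\<upsilon> x \<otimes>\<^bsub>U\<^esub> \<one>\<^bsub>U\<^esub>) \<oplus>\<^bsub>TP\<^esub> smash_term \<one>\<^bsub>S\<^esub> b v (\<upsilon> x \<otimes>\<^bsub>U\<^esub> \<one>\<^bsub>U\<^esub>) \<one>\<^bsub>U\<^esub>"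
    unfolding smash_value_def
      sweedler_mult_gen[OF L.lie_algebra_axioms TP.module_axioms st x U.one_closed]
    by (rule sweedler_one[OF L.lie_algebra_axioms TP.module_axioms st'])
  also have "\<dots> = pt (pb (\<iota> x) b) v \<oplus>\<^bsub>TP\<^esub> pt b (\<upsilon> x \<otimes>\<^bsub>U\<^esub> v)"
    using assms
    by (simp add: smash_term_def upsilon_closed act_gen act_one pt_closed pb_closed iota_closed TP.a_comm)
  finally show ?thesis .
qed

lemma W_mult_Sym_assoc:
  assumes a: "a \<in> carrier S" and b: "b \<in> carrier S" and u: "u \<in> carrier U" and t: "t \<in> carrier TP"
  shows "pt a \<one>\<^bsub>U\<^esub> \<otimes>\<^bsub>W\<^esub> (pt b u \<otimes>\<^bsub>W\<^esub> t) = pt (a \<otimes>\<^bsub>S\<^esub> b) u \<otimes>\<^bsub>W\<^esub> t"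
proof (rule TP_linear_eq[OF _ _ _ t])
  note R' = bilinear_map_right[OF W_mult_bilinear_TP]
  note a1 = R'[OF pt_closed[OF a U.one_closed]]
  show "linear_map R TP TP (\<lambda>t. pt a \<one>\<^bsub>U\<^esub> \<otimes>\<^bsub>W\<^esub> (pt b u \<otimes>\<^bsub>W\<^esub> t))"
    by (rule linear_map_comp[OF R'[OF pt_closed[OF b u]] a1])
  show "linear_map R TP TP ((\<otimes>\<^bsub>W\<^esub>) (pt (a \<otimes>\<^bsub>S\<^esub> b) u))"
    by (rule R'[OF pt_closed[OF S.m_closed[OF a b] u]])
  fix c v assume c: "c \<in> carrier S" and v: "v \<in> carrier U"
  have "pt a \<one>\<^bsub>U\<^esub> \<otimes>\<^bsub>W\<^esub> smash_value b u c v = smash_value (a \<otimes>\<^bsub>S\<^esub> b) u c v"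
    unfolding smash_value_def
  proof (rule tensor_lift_comp[OF U.module_axioms U.module_axioms TP.module_axioms TP.module_axioms
        smash_term_bilinear[OF b c v] a1 smash_term_bilinear[OF S.m_closed[OF a b] c v] _ comult_closed[OF u]])
    fix u\<^sub>1 u\<^sub>2 assume "u\<^sub>1 \<in> carrier U" "u\<^sub>2 \<in> carrier U"
    then show "pt a \<one>\<^bsub>U\<^esub> \<otimes>\<^bsub>W\<^esub> smash_term b c v u\<^sub>1 u\<^sub>2 = smash_term (a \<otimes>\<^bsub>S\<^esub> b) c v u\<^sub>1 u\<^sub>2"
      using a b c v by (simp add: smash_term_def W_mult_Sym act_closed S.m_assoc)
  qed
  then show "pt a \<one>\<^bsub>U\<^esub> \<otimes>\<^bsub>W\<^esub> (pt b u \<otimes>\<^bsub>W\<^esub> pt c v) = pt (a \<otimes>\<^bsub>S\<^esub> b) u \<otimes>\<^bsub>W\<^esub> pt c v"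
    using a b c u v by (simp add: W_mult_pure)
qed

text \<open>
  The heart of associativity: since \<open>x\<close> is primitive and acts on \<open>Sym(\<gg>)\<close> by a derivation, multiplication by
  \<open>\<one> # x\<close> can be carried past \<open>a # u\<close>.
\<close>

lemma W_mult_gen_assoc:
  assumes x: "x \<in> carrier L" and a: "a \<in> carrier S" and u: "u \<in> carrier U" and t: "t \<in> carrier TP"
  shows "pt \<one>\<^bsub>S\<^esub> (\<upsilon> x) \<otimes>\<^bsub>W\<^esub> (pt a u \<otimes>\<^bsub>W\<^esub> t) =
    pt (pb (\<iota> x) a) u \<otimes>\<^bsub>W\<^esub> t \<oplus>\<^bsub>TP\<^esub> pt a (\<upsilon> x \<otimes>\<^bsub>U\<^esub> u) \<otimes>\<^bsub>W\<^esub> t"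
proof -
  note R' = bilinear_map_right[OF W_mult_bilinear_TP]
  note i = iota_closed[OF x] and xc = upsilon_closed[OF x]
  note x1 = R'[OF pt_closed[OF S.one_closed xc]]
  note xa = pb_closed[OF i a] and xu = U.m_closed[OF xc u]
  note c1 = pt_closed[OF xa u] and c2 = pt_closed[OF a xu]
  show ?thesis
  proof (rule TP_linear_eq[OF linear_map_comp[OF R'[OF pt_closed[OF a u]] x1] _ _ t])
    show "linear_map R TP TP (\<lambda>t. pt (pb (\<iota> x) a) u \<otimes>\<^bsub>W\<^esub> t \<oplus>\<^bsub>TP\<^esub> pt a (\<upsilon> x \<otimes>\<^bsub>U\<^esub> u) \<otimes>\<^bsub>W\<^esub> t)"
      using linear_mapD[OF R'[OF c1]] linear_mapD[OF R'[OF c2]]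
      by (intro linear_mapI) (simp_all add: TP.a_ac TP.smult_r_distr)
    fix b v assume b: "b \<in> carrier S" and v: "v \<in> carrier U"
    let ?D = "ULie_comult R L u"
    let ?h = "\<lambda>u\<^sub>1 u\<^sub>2. pt (a \<otimes>\<^bsub>S\<^esub> act u\<^sub>1 b) (\<upsilon> x \<otimes>\<^bsub>U\<^esub> u\<^sub>2 \<otimes>\<^bsub>U\<^esub> v) \<oplus>\<^bsub>TP\<^esub> pt (a \<otimes>\<^bsub>S\<^esub> pb (\<iota> x) (act u\<^sub>1 b)) (u\<^sub>2 \<otimes>\<^bsub>U\<^esub> v)"
    let ?k = "\<lambda>u\<^sub>1 u\<^sub>2. pt \<one>\<^bsub>S\<^esub> (\<upsilon> x) \<otimes>\<^bsub>W\<^esub> smash_term a b v u\<^sub>1 u\<^sub>2"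
    note st = smash_term_bilinear[OF a b v] and st' = smash_term_bilinear[OF xa b v]
    have h: "bilinear_map R U U TP ?h"
      using a b v i xc
      by (intro bilinear_mapI)
        (simp_all add: bilinear_mapE[OF act_bilinear] act_closed pb_closed pb_add_right pb_smult_right
          S.r_distr U.r_distr U.l_distr SA.smult_mult_right U.smult_mult_left U.smult_mult_right
          bilinear_mapE[OF pt_bilinear] TP.a_ac TP.smult_r_distr)
    have k: "bilinear_map R U U TP ?k" by (rule linear_map_bilinear_comp[OF st x1])
    have "pt \<one>\<^bsub>S\<^esub> (\<upsilon> x) \<otimes>\<^bsub>W\<^esub> smash_value a u b v = tensor_lift R U U TP ?k ?D"
      unfolding smash_value_def
      by (rule tensor_lift_comp[OF U.module_axioms U.module_axioms TP.module_axioms TP.module_axioms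
            st x1 k refl comult_closed[OF u]])
    also have "\<dots> = tensor_lift R U U TP (smash_term (pb (\<iota> x) a) b v) ?D \<oplus>\<^bsub>TP\<^esub> tensor_lift R U U TP ?h ?D"
    proof (rule tensor_lift_add[OF U.module_axioms U.module_axioms TP.module_axioms st' h k _ comult_closed[OF u]])
      fix u\<^sub>1 u\<^sub>2 assume u': "u\<^sub>1 \<in> carrier U" "u\<^sub>2 \<in> carrier U"
      note ab = act_closed[OF u'(1) b]
      have "?k u\<^sub>1 u\<^sub>2 = pt (pb (\<iota> x) (a \<otimes>\<^bsub>S\<^esub> act u\<^sub>1 b)) (u\<^sub>2 \<otimes>\<^bsub>U\<^esub> v) \<oplus>\<^bsub>TP\<^esub>
          pt (a \<otimes>\<^bsub>S\<^esub> act u\<^sub>1 b) (\<upsilon> x \<otimes>\<^bsub>U\<^esub> (u\<^sub>2 \<otimes>\<^bsub>U\<^esub> v))"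
        unfolding smash_term_def by (rule W_mult_gen[OF x S.m_closed[OF a ab] U.m_closed[OF u'(2) v]])
      also have "pb (\<iota> x) (a \<otimes>\<^bsub>S\<^esub> act u\<^sub>1 b) = pb (\<iota> x) a \<otimes>\<^bsub>S\<^esub> act u\<^sub>1 b \<oplus>\<^bsub>S\<^esub> a \<otimes>\<^bsub>S\<^esub> pb (\<iota> x) (act u\<^sub>1 b)"
        using a ab i xa pb_closed by (simp add: pb_mult_right S.m_comm S.a_comm)
      finally show "?k u\<^sub>1 u\<^sub>2 = smash_term (pb (\<iota> x) a) b v u\<^sub>1 u\<^sub>2 \<oplus>\<^bsub>TP\<^esub> ?h u\<^sub>1 u\<^sub>2"
        using a v ab u' i xc xa pb_closed pt_closed
        by (simp add: smash_term_def pt_add_left U.m_assoc TP.a_ac)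
    qed
    also have "\<dots> = smash_value (pb (\<iota> x) a) u b v \<oplus>\<^bsub>TP\<^esub> smash_value a (\<upsilon> x \<otimes>\<^bsub>U\<^esub> u) b v"
      unfolding smash_value_gen[OF a x u b v] by (simp add: smash_value_def)
    finally show "pt \<one>\<^bsub>S\<^esub> (\<upsilon> x) \<otimes>\<^bsub>W\<^esub> (pt a u \<otimes>\<^bsub>W\<^esub> pt b v) =
        pt (pb (\<iota> x) a) u \<otimes>\<^bsub>W\<^esub> pt b v \<oplus>\<^bsub>TP\<^esub> pt a (\<upsilon> x \<otimes>\<^bsub>U\<^esub> u) \<otimes>\<^bsub>W\<^esub> pt b v"
      using a u b v xa xu by (simp add: W_mult_pure)
  qed
qed

text \<open>
  Elements \<open>w\<close> with \<open>(w s) t = w (s t)\<close> are closed under products and sums in any algebra, so associativity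
  has to be checked only for \<open>w\<close> among the generators \<open>a # \<one>\<close> and \<open>\<one> # x\<close>.
\<close>

definition left_nucleus :: "(('g list \<Rightarrow> 'r) set set \<times> ('g list \<Rightarrow> 'r) set set \<Rightarrow> 'r) set \<Rightarrow> bool"
  where "left_nucleus w \<longleftrightarrow>
    (\<forall>s\<in>carrier TP. \<forall>t\<in>carrier TP. w \<otimes>\<^bsub>W\<^esub> s \<otimes>\<^bsub>W\<^esub> t = w \<otimes>\<^bsub>W\<^esub> (s \<otimes>\<^bsub>W\<^esub> t))"

lemma left_nucleusI:
  assumes w: "w \<in> carrier TP"
    and pure: "\<And>a u t. \<lbrakk>a \<in> carrier S; u \<in> carrier U; t \<in> carrier TP\<rbrakk> \<Longrightarrow>
      w \<otimes>\<^bsub>W\<^esub> pt a u \<otimes>\<^bsub>W\<^esub> t = w \<otimes>\<^bsub>W\<^esub> (pt a u \<otimes>\<^bsub>W\<^esub> t)"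
  shows "left_nucleus w"
proof -
  have "w \<otimes>\<^bsub>W\<^esub> s \<otimes>\<^bsub>W\<^esub> t = w \<otimes>\<^bsub>W\<^esub> (s \<otimes>\<^bsub>W\<^esub> t)" if "s \<in> carrier TP" and t: "t \<in> carrier TP" for s t
    using that(1)
  proof (induction s rule: TP_induct)
    case (pure a u) then show ?case using assms(2) t by simp
  next
    case (add r s)
    then show ?case using w t by (simp add: W_add_left W_add_right W_closed)
  qed
  then show ?thesis by (simp add: left_nucleus_def)
qed

lemma left_nucleus_Sym:
  assumes "a \<in> carrier S"
  shows "left_nucleus (pt a \<one>\<^bsub>U\<^esub>)"
  using assms by (intro left_nucleusI) (simp_all add: pt_closed W_mult_Sym W_mult_Sym_assoc)

lemma left_nucleus_gen:
  assumes x: "x \<in> carrier L"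
  shows "left_nucleus (pt \<one>\<^bsub>S\<^esub> (\<upsilon> x))"
  using upsilon_closed[OF x] iota_closed[OF x]
  by (intro left_nucleusI)
    (simp_all add: pt_closed W_mult_gen[OF x] W_mult_gen_assoc[OF x] W_add_left pb_closed)

lemma left_nucleus_mult:
  "\<lbrakk>v \<in> carrier TP; w \<in> carrier TP; left_nucleus v; left_nucleus w\<rbrakk> \<Longrightarrow> left_nucleus (v \<otimes>\<^bsub>W\<^esub> w)"
  by (simp add: left_nucleus_def W_closed)

lemma left_nucleus_add:
  "\<lbrakk>v \<in> carrier TP; w \<in> carrier TP; left_nucleus v; left_nucleus w\<rbrakk> \<Longrightarrow> left_nucleus (v \<oplus>\<^bsub>TP\<^esub> w)"
  by (simp add: left_nucleus_def W_closed W_add_left)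

lemma left_nucleus_smult:
  "\<lbrakk>r \<in> carrier R; w \<in> carrier TP; left_nucleus w\<rbrakk> \<Longrightarrow> left_nucleus (r \<odot>\<^bsub>TP\<^esub> w)"
  by (simp add: left_nucleus_def W_closed W_smult_left)

lemma W_one_mult:
  assumes "t \<in> carrier TP"
  shows "pt \<one>\<^bsub>S\<^esub> \<one>\<^bsub>U\<^esub> \<otimes>\<^bsub>W\<^esub> t = t"
  using assms
proof (induction t rule: TP_induct)
  case (pure a u) then show ?case by (simp add: W_mult_Sym)
next
  case (add s t) then show ?case by (simp add: W_add_right pt_closed)
qed

lemma pt_factor:
  "\<lbrakk>a \<in> carrier S; u \<in> carrier U\<rbrakk> \<Longrightarrow> pt a u = pt a \<one>\<^bsub>U\<^esub> \<otimes>\<^bsub>W\<^esub> pt \<one>\<^bsub>S\<^esub> u"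
  by (simp add: W_mult_Sym)

lemma pt_gen_mult:
  assumes x: "x \<in> carrier L" and u: "u \<in> carrier U"
  shows "pt \<one>\<^bsub>S\<^esub> (\<upsilon> x \<otimes>\<^bsub>U\<^esub> u) = pt \<one>\<^bsub>S\<^esub> (\<upsilon> x) \<otimes>\<^bsub>W\<^esub> pt \<one>\<^bsub>S\<^esub> u"
  using u iota_closed[OF x] upsilon_closed[OF x]
  by (simp add: W_mult_gen[OF x] pb_one pt_zero_left pt_closed)

lemma left_nucleus_ULie:
  assumes "u \<in> carrier U"
  shows "left_nucleus (pt \<one>\<^bsub>S\<^esub> u)"
  using U.assoc_algebra_axioms U_generates assms
proof (induction u rule: generates_induct)
  case one show ?case by (rule left_nucleus_Sym) simp
next
  case (mult x u)
  then obtain y where y: "y \<in> carrier L" "x = \<upsilon> y" by auto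
  show ?case
    using mult left_nucleus_gen[OF y(1)]
    unfolding y(2) pt_gen_mult[OF y(1) mult(3)]
    by (intro left_nucleus_mult) (simp_all add: pt_closed)
next
  case (add u v) then show ?case by (simp add: pt_add_right left_nucleus_add pt_closed)
next
  case (smult r u) then show ?case by (simp add: pt_smult_right left_nucleus_smult pt_closed)
qed

lemma W_assoc:
  assumes r: "r \<in> carrier TP" and s: "s \<in> carrier TP" and t: "t \<in> carrier TP"
  shows "r \<otimes>\<^bsub>W\<^esub> s \<otimes>\<^bsub>W\<^esub> t = r \<otimes>\<^bsub>W\<^esub> (s \<otimes>\<^bsub>W\<^esub> t)"
proof -
  have "left_nucleus r"
    using r
  proof (induction r rule: TP_induct)
    case (pure a u)
    show ?case
      unfolding pt_factor[OF pure]
      using pure by (intro left_nucleus_mult left_nucleus_Sym left_nucleus_ULie) (simp_all add: pt_closed)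
  next
    case (add r s) then show ?case by (rule left_nucleus_add)
  qed
  then show ?thesis using s t by (simp add: left_nucleus_def)
qed

lemma W_mult_one:
  assumes "t \<in> carrier TP"
  shows "t \<otimes>\<^bsub>W\<^esub> pt \<one>\<^bsub>S\<^esub> \<one>\<^bsub>U\<^esub> = t"
proof -
  have one: "pt \<one>\<^bsub>S\<^esub> \<one>\<^bsub>U\<^esub> \<in> carrier TP" by (simp add: pt_closed)
  have 1: "pt \<one>\<^bsub>S\<^esub> u \<otimes>\<^bsub>W\<^esub> pt \<one>\<^bsub>S\<^esub> \<one>\<^bsub>U\<^esub> = pt \<one>\<^bsub>S\<^esub> u" if "u \<in> carrier U" for u
    using U.assoc_algebra_axioms U_generates that
  proof (induction u rule: generates_induct)
    case one show ?case by (simp add: W_mult_Sym)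
  next
    case (mult x u)
    then obtain y where y: "y \<in> carrier L" "x = \<upsilon> y" by auto
    show ?case
      unfolding y(2) pt_gen_mult[OF y(1) mult(3)]
      using mult y upsilon_closed[OF y(1)] by (simp add: W_assoc pt_closed)
  next
    case (add u v) then show ?case by (simp add: pt_add_right W_add_left pt_closed)
  next
    case (smult r u) then show ?case by (simp add: pt_smult_right W_smult_left pt_closed)
  qed
  show ?thesis
    using assms
  proof (induction t rule: TP_induct)
    case (pure a u)
    have c: "pt a \<one>\<^bsub>U\<^esub> \<in> carrier TP" "pt \<one>\<^bsub>S\<^esub> u \<in> carrier TP" using pure by (simp_all add: pt_closed)
    show ?case
      unfolding pt_factor[OF pure] W_assoc[OF c one] 1[OF pure(2)] by (rule refl)
  next
    case (add s t) then show ?case using one by (simp add: W_add_left)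
  qed
qed

lemma assoc_algebra_W: "assoc_algebra R W"
proof (rule assoc_algebraI[OF module_W _ W_mult_bilinear])
  show "monoid W"
    by (rule monoidI) (simp_all only: W_simps(1,5) W_closed W_assoc W_one_mult W_mult_one pt_closed
        S.one_closed U.one_closed)
qed

sublocale W: assoc_algebra R W by (rule assoc_algebra_W)

abbreviation "\<alpha> \<equiv> smash_alpha R L"

lemma alpha_hom: "algebra_hom R S W \<alpha>"
proof (rule algebra_homI)
  show "linear_map R S W \<alpha>"
    using bilinear_map_left[OF pt_bilinear U.one_closed]
    by (simp add: smash_alpha_def[abs_def] linear_map_def W_simps)
  show "\<alpha> \<one>\<^bsub>S\<^esub> = \<one>\<^bsub>W\<^esub>" by (simp add: smash_alpha_def W_simps)
  show "\<alpha> (a \<otimes>\<^bsub>S\<^esub> b) = \<alpha> a \<otimes>\<^bsub>W\<^esub> \<alpha> b" if "a \<in> carrier S" "b \<in> carrier S" for a b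
    using that by (simp add: smash_alpha_def W_mult_Sym)
qed

text \<open>
  By \<open>a # u = (a # \<one>) (\<one> # u)\<close> and \<open>\<one> # xu = (\<one> # x) (\<one> # u)\<close>.
\<close>

lemma W_generates:
  "generates R W (\<alpha> ` carrier S \<union> (\<lambda>x. pt \<one>\<^bsub>S\<^esub> (\<upsilon> x)) ` carrier L)"
  unfolding generates_def
proof (intro conjI allI impI)
  show "\<alpha> ` carrier S \<union> (\<lambda>x. pt \<one>\<^bsub>S\<^esub> (\<upsilon> x)) ` carrier L \<subseteq> carrier W"
    by (auto simp: W_simps smash_alpha_def intro!: pt_closed upsilon_closed)
  fix N assume N: "submodule N R W \<and> \<one>\<^bsub>W\<^esub> \<in> N \<and>
    (\<forall>x\<in>\<alpha> ` carrier S \<union> (\<lambda>x. pt \<one>\<^bsub>S\<^esub> (\<upsilon> x)) ` carrier L. \<forall>a\<in>N. x \<otimes>\<^bsub>W\<^esub> a \<in> N)"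
  note sub = W.submoduleE[OF N[THEN conjunct1]]
  have alpha: "pt a \<one>\<^bsub>U\<^esub> \<otimes>\<^bsub>W\<^esub> n \<in> N" if "a \<in> carrier S" "n \<in> N" for a n
    using N that by (auto simp: smash_alpha_def)
  have gen: "pt \<one>\<^bsub>S\<^esub> (\<upsilon> x) \<otimes>\<^bsub>W\<^esub> n \<in> N" if "x \<in> carrier L" "n \<in> N" for x n
    using N that by auto
  have U: "pt \<one>\<^bsub>S\<^esub> u \<in> N" if "u \<in> carrier U" for u
    using U.assoc_algebra_axioms U_generates that
  proof (induction u rule: generates_induct)
    case one show ?case using N by (simp add: W_simps)
  next
    case (mult x u)
    then obtain y where y: "y \<in> carrier L" "x = \<upsilon> y" by auto
    show ?case unfolding y(2) pt_gen_mult[OF y(1) mult(3)] by (rule gen[OF y(1) mult(4)])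
  next
    case (add u v)
    then show ?case using sub(5) by (simp add: pt_add_right W_simps(3))
  next
    case (smult r u)
    then show ?case using sub(4) by (simp add: pt_smult_right W_simps(4))
  qed
  have "t \<in> N" if "t \<in> carrier TP" for t
    using that
  proof (induction t rule: TP_induct)
    case (pure a u) show ?case unfolding pt_factor[OF pure] by (rule alpha[OF pure(1) U[OF pure(2)]])
  next
    case (add s t) then show ?case using sub(5) by (simp add: W_simps(3))
  qed
  then show "N = carrier W" using sub(1) by (auto simp: W_simps(1))
qed

end

section \<open>The derivation \<open>\<beta>\<close> and the universal property\<close>

text \<open>
  Commutator identities are used in the form \<open>x y = z + y x\<close>, which rewrites products without subtraction.
\<close>

lemma (in abelian_group) eq_minus_iff:
  "\<lbrakk>x \<in> carrier G; y \<in> carrier G; z \<in> carrier G\<rbrakk> \<Longrightarrow> z = x \<ominus> y \<longleftrightarrow> x = z \<oplus> y"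
  by (metis a_minus_def a_inv_closed a_assoc l_neg r_neg r_zero)

lemma poisson_enveloping_pair_iff:
  assumes A: "poisson_algebra R A" and V: "assoc_algebra R V"
  shows "poisson_enveloping_pair R A V \<alpha> \<beta> \<longleftrightarrow>
    algebra_hom R A V \<alpha> \<and> linear_map R A V \<beta> \<and>
    (\<forall>a\<in>carrier A. \<forall>b\<in>carrier A.
      \<beta> a \<otimes>\<^bsub>V\<^esub> \<beta> b = \<beta> (bracket A a b) \<oplus>\<^bsub>V\<^esub> \<beta> b \<otimes>\<^bsub>V\<^esub> \<beta> a \<and>
      \<alpha> a \<otimes>\<^bsub>V\<^esub> \<beta> b = \<alpha> (bracket A a b) \<oplus>\<^bsub>V\<^esub> \<beta> b \<otimes>\<^bsub>V\<^esub> \<alpha> a \<and>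
      \<beta> (a \<otimes>\<^bsub>A\<^esub> b) = \<alpha> a \<otimes>\<^bsub>V\<^esub> \<beta> b \<oplus>\<^bsub>V\<^esub> \<alpha> b \<otimes>\<^bsub>V\<^esub> \<beta> a)"
    (is "_ \<longleftrightarrow> ?rhs")
proof -
  interpret A: poisson_algebra R A by fact
  interpret V: assoc_algebra R V by fact
  have c: "bracket A a b \<in> carrier A" if "a \<in> carrier A" "b \<in> carrier A" for a b
    by (rule bilinear_map_closed[OF A.bracket_bilinear that])
  have lie: "linear_map R A (commutator_lie V) \<beta> \<longleftrightarrow> linear_map R A V \<beta>"
    by (simp add: commutator_lie_def linear_map_def)
  have com: "bracket (commutator_lie V) = (\<lambda>x y. x \<otimes>\<^bsub>V\<^esub> y \<ominus>\<^bsub>V\<^esub> y \<otimes>\<^bsub>V\<^esub> x)"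
    by (simp add: commutator_lie_def)
  show ?thesis
  proof (cases "algebra_hom R A V \<alpha> \<and> linear_map R A V \<beta>")
    case True
    note ac = linear_map_closed[OF algebra_hom_linear[OF True[THEN conjunct1]]]
      and bc = linear_map_closed[OF True[THEN conjunct2]]
    have minus_iff: "\<beta> (bracket A a b) = \<beta> a \<otimes>\<^bsub>V\<^esub> \<beta> b \<ominus>\<^bsub>V\<^esub> \<beta> b \<otimes>\<^bsub>V\<^esub> \<beta> a \<longleftrightarrow>
        \<beta> a \<otimes>\<^bsub>V\<^esub> \<beta> b = \<beta> (bracket A a b) \<oplus>\<^bsub>V\<^esub> \<beta> b \<otimes>\<^bsub>V\<^esub> \<beta> a"
      "\<alpha> (bracket A a b) = \<alpha> a \<otimes>\<^bsub>V\<^esub> \<beta> b \<ominus>\<^bsub>V\<^esub> \<beta> b \<otimes>\<^bsub>V\<^esub> \<alpha> a \<longleftrightarrow>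
        \<alpha> a \<otimes>\<^bsub>V\<^esub> \<beta> b = \<alpha> (bracket A a b) \<oplus>\<^bsub>V\<^esub> \<beta> b \<otimes>\<^bsub>V\<^esub> \<alpha> a"
      if "a \<in> carrier A" "b \<in> carrier A" for a b
      by (rule V.eq_minus_iff; use that c ac bc in simp)+
    then show ?thesis
      by (simp add: poisson_enveloping_pair_def lie_hom_def lie com True minus_iff ball_conj_distrib)
  next
    case False
    then show ?thesis by (auto simp: poisson_enveloping_pair_def lie_hom_def lie)
  qed
qed

context lie_cocycle
begin

lemma alpha_action: "left_module_action R S W (\<lambda>a w. \<alpha> a \<otimes>\<^bsub>W\<^esub> w)"
  by (rule left_module_action_hom[OF SA.assoc_algebra_axioms assoc_algebra_W alpha_hom])

lemma pt_gen_linear: "linear_map R L W (\<lambda>x. pt \<one>\<^bsub>S\<^esub> (\<upsilon> x))"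
  using linear_map_comp[OF upsilon_linear bilinear_map_right[OF pt_bilinear S.one_closed]]
  by (simp add: linear_map_def W_simps(1,3,4))

lemma Sym_monomial_simps:
  "Sym_monomial R L [] = \<one>\<^bsub>S\<^esub>" "Sym_monomial R L (x # xs) = \<iota> x \<otimes>\<^bsub>S\<^esub> Sym_monomial R L xs"
  by (simp_all add: Sym_monomial_def)

lemma Sym_monomial_closed: "xs \<in> lists (carrier L) \<Longrightarrow> Sym_monomial R L xs \<in> carrier S"
  by (induction xs rule: lists.induct) (auto simp: Sym_monomial_simps iota_closed)

lemma Sym_linear_eq:
  assumes M: "module R M" and f: "linear_map R S M f" and g: "linear_map R S M g"
    and eq: "\<And>xs. xs \<in> lists (carrier L) \<Longrightarrow> f (Sym_monomial R L xs) = g (Sym_monomial R L xs)"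
    and a: "a \<in> carrier S"
  shows "f a = g a"
proof -
  let ?m = "Sym_monomial R L"
  \<comment> \<open>Linearity alone does not survive multiplication by a generator; a monomial factor in front absorbs it.\<close>
  have "\<forall>xs\<in>lists (carrier L). f (?m xs \<otimes>\<^bsub>S\<^esub> a) = g (?m xs \<otimes>\<^bsub>S\<^esub> a)"
    using SA.assoc_algebra_axioms Sym_generates a
  proof (induction a rule: generates_induct)
    case one then show ?case by (simp add: eq Sym_monomial_closed)
  next
    case (mult x a)
    then obtain y where y: "y \<in> carrier L" "x = \<iota> y" by auto
    have "?m xs \<otimes>\<^bsub>S\<^esub> (x \<otimes>\<^bsub>S\<^esub> a) = ?m (y # xs) \<otimes>\<^bsub>S\<^esub> a" if "xs \<in> lists (carrier L)" for xs
      using mult y Sym_monomial_closed[OF that] by (simp add: Sym_monomial_simps S.m_ac)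
    then show ?case using mult(4) y(1) by simp
  next
    case (add a b)
    then show ?case
      by (simp add: S.r_distr Sym_monomial_closed linear_map_add[OF f] linear_map_add[OF g])
  next
    case (smult r a)
    then show ?case
      by (simp add: SA.smult_mult_right Sym_monomial_closed linear_map_smult[OF f] linear_map_smult[OF g])
  qed
  then have "f (?m [] \<otimes>\<^bsub>S\<^esub> a) = g (?m [] \<otimes>\<^bsub>S\<^esub> a)" by blast
  then show ?thesis using a by (simp add: Sym_monomial_simps)
qed

definition monomial_sum ::
  "'g list \<Rightarrow> (('g list \<Rightarrow> 'r) set set \<times> ('g list \<Rightarrow> 'r) set set \<Rightarrow> 'r) set"
  where "monomial_sum xs = (\<Oplus>\<^bsub>W\<^esub>i\<in>{..<length xs}.
    pt (Sym_monomial R L (take i xs @ drop (Suc i) xs)) (\<upsilon> (xs ! i)))"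

text \<open>
  The factor \<open>x\<close> is omitted in the second summand and stays in front of all terms of the first.
\<close>

lemma monomial_sum_Cons:
  assumes x: "x \<in> carrier L" and xs: "xs \<in> lists (carrier L)"
  shows "monomial_sum (x # xs) =
    \<alpha> (\<iota> x) \<otimes>\<^bsub>W\<^esub> monomial_sum xs \<oplus>\<^bsub>W\<^esub> \<alpha> (Sym_monomial R L xs) \<otimes>\<^bsub>W\<^esub> pt \<one>\<^bsub>S\<^esub> (\<upsilon> x)"
proof -
  let ?n = "length xs" and ?m = "Sym_monomial R L"
  let ?t = "\<lambda>xs i. pt (?m (take i xs @ drop (Suc i) xs)) (\<upsilon> (xs ! i))"
  have drop: "take i ys @ drop (Suc i) ys \<in> lists (carrier L)" if "ys \<in> lists (carrier L)" for i and ys :: "'g list"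
    using that by (auto dest: in_set_takeD in_set_dropD)
  have nth: "ys ! i \<in> carrier L" if "ys \<in> lists (carrier L)" "i < length ys" for ys i
    using that by (auto simp: in_lists_conv_set)
  have closed: "?t ys i \<in> carrier W" if "ys \<in> lists (carrier L)" "i < length ys" for ys i
    unfolding W_simps(1)
    by (intro pt_closed Sym_monomial_closed drop that upsilon_closed nth)
  have xxs: "x # xs \<in> lists (carrier L)" using x xs by simp
  have "monomial_sum (x # xs) = (\<Oplus>\<^bsub>W\<^esub>i\<in>insert 0 (Suc ` {..<?n}). ?t (x # xs) i)"
    by (simp add: monomial_sum_def lessThan_Suc_eq_insert_0)
  also have "\<dots> = ?t (x # xs) 0 \<oplus>\<^bsub>W\<^esub> (\<Oplus>\<^bsub>W\<^esub>i\<in>Suc ` {..<?n}. ?t (x # xs) i)"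
  proof (rule W.finsum_insert)
    show "?t (x # xs) \<in> Suc ` {..<?n} \<rightarrow> carrier W" by (intro Pi_I closed[OF xxs]) auto
    show "?t (x # xs) 0 \<in> carrier W" by (rule closed[OF xxs]) simp
  qed auto
  also have "(\<Oplus>\<^bsub>W\<^esub>i\<in>Suc ` {..<?n}. ?t (x # xs) i) = (\<Oplus>\<^bsub>W\<^esub>i\<in>{..<?n}. ?t (x # xs) (Suc i))"
  proof (rule W.finsum_reindex)
    show "?t (x # xs) \<in> Suc ` {..<?n} \<rightarrow> carrier W" by (intro Pi_I closed[OF xxs]) auto
  qed simp
  also have "\<dots> = (\<Oplus>\<^bsub>W\<^esub>i\<in>{..<?n}. \<alpha> (\<iota> x) \<otimes>\<^bsub>W\<^esub> ?t xs i)"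
  proof (rule W.finsum_cong')
    show "(\<lambda>i. \<alpha> (\<iota> x) \<otimes>\<^bsub>W\<^esub> ?t xs i) \<in> {..<?n} \<rightarrow> carrier W"
      using closed[OF xs] linear_map_closed[OF algebra_hom_linear[OF alpha_hom] iota_closed[OF x]] by auto
    show "?t (x # xs) (Suc i) = \<alpha> (\<iota> x) \<otimes>\<^bsub>W\<^esub> ?t xs i" if "i \<in> {..<?n}" for i
      using that Sym_monomial_closed[OF drop[OF xs]] upsilon_closed[OF nth[OF xs]] iota_closed[OF x]
      by (simp add: smash_alpha_def W_mult_Sym Sym_monomial_simps)
  qed simp
  also have "\<dots> = \<alpha> (\<iota> x) \<otimes>\<^bsub>W\<^esub> monomial_sum xs"
    unfolding monomial_sum_def
    by (rule W.finsum_rdistr[symmetric])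
      (use closed[OF xs] linear_map_closed[OF algebra_hom_linear[OF alpha_hom] iota_closed[OF x]] in auto)
  finally have "monomial_sum (x # xs) = ?t (x # xs) 0 \<oplus>\<^bsub>W\<^esub> \<alpha> (\<iota> x) \<otimes>\<^bsub>W\<^esub> monomial_sum xs" .
  moreover have "?t (x # xs) 0 = \<alpha> (?m xs) \<otimes>\<^bsub>W\<^esub> pt \<one>\<^bsub>S\<^esub> (\<upsilon> x)"
    using x by (simp add: smash_alpha_def W_mult_Sym Sym_monomial_closed[OF xs] upsilon_closed)
  moreover have "monomial_sum xs \<in> carrier W"
    unfolding monomial_sum_def by (rule W.finsum_closed) (use closed[OF xs] in auto)
  moreover have "?t (x # xs) 0 \<in> carrier W" by (rule closed[OF xxs]) simp
  moreover have "\<alpha> (\<iota> x) \<in> carrier W"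
    by (rule linear_map_closed[OF algebra_hom_linear[OF alpha_hom] iota_closed[OF x]])
  ultimately show ?thesis by (simp add: W.a_comm)
qed

definition \<beta> :: "('g list \<Rightarrow> 'r) set set \<Rightarrow> (('g list \<Rightarrow> 'r) set set \<times> ('g list \<Rightarrow> 'r) set set \<Rightarrow> 'r) set"
  where "\<beta> = smash_beta R L \<sigma>"

text \<open>
  The formula for \<open>\<beta>\<close> on monomials is the Leibniz rule in disguise: \<open>\<beta>\<close> is the derivation extending
  \<open>x \<mapsto> \<one> # x\<close>, where \<open>Sym(\<gg>)\<close> acts on the smash product through \<open>\<alpha>\<close>.
\<close>

lemma
  shows beta_derivation: "derivation R S W (\<lambda>a w. \<alpha> a \<otimes>\<^bsub>W\<^esub> w) \<beta>"
    and beta_gen: "x \<in> carrier L \<Longrightarrow> \<beta> (\<iota> x) = pt \<one>\<^bsub>S\<^esub> (\<upsilon> x)"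
proof -
  let ?m = "Sym_monomial R L"
  let ?der = "derivation R S W (\<lambda>a w. \<alpha> a \<otimes>\<^bsub>W\<^esub> w)"
  let ?P = "\<lambda>b. linear_map R S W b \<and> (\<forall>xs\<in>lists (carrier L). b (?m xs) =
    (\<Oplus>\<^bsub>W\<^esub>i\<in>{..<length xs}. pt (?m (take i xs @ drop (Suc i) xs)) (\<upsilon> (xs ! i))))"
  obtain D where D: "?der D" and D_gen: "\<And>x. x \<in> carrier L \<Longrightarrow> D (\<iota> x) = pt \<one>\<^bsub>S\<^esub> (\<upsilon> x)"
    by (rule Sym_derivation_exists[OF L.module_axioms module_W alpha_action pt_gen_linear]) (rule that)
  have "D (?m xs) = monomial_sum xs" if "xs \<in> lists (carrier L)" for xs
    using that
  proof induction
    case Nil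
    show ?case
      using derivation_one[OF S.algebra_axioms module_W alpha_action D]
      by (simp add: Sym_monomial_simps monomial_sum_def)
  next
    case (Cons x xs)
    then show ?case
      by (simp add: Sym_monomial_simps derivation_mult[OF D] iota_closed Sym_monomial_closed D_gen monomial_sum_Cons)
  qed
  then have PD: "?P D" using derivation_linear[OF D] by (simp add: monomial_sum_def)
  have P\<beta>: "?P \<beta>"
    unfolding \<beta>_def smash_beta_def Let_def
  proof (rule THE_extensional[where P = ?P, OF PD])
    show "h x \<in> carrier W" if "?P h" "x \<in> carrier S" for h x
      by (rule linear_map_closed[OF that(1)[THEN conjunct1] that(2)])
    show "?P h'" if h: "?P h" and eq: "\<And>x. x \<in> carrier S \<Longrightarrow> h' x = h x" for h h'
    proof
      show "linear_map R S W h'"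
        using linear_map_cong[OF S.module_axioms, of h' h W] eq h[THEN conjunct1] by simp
      show "\<forall>xs\<in>lists (carrier L). h' (?m xs) =
          (\<Oplus>\<^bsub>W\<^esub>i\<in>{..<length xs}. pt (?m (take i xs @ drop (Suc i) xs)) (\<upsilon> (xs ! i)))"
        using h[THEN conjunct2] eq Sym_monomial_closed by simp
    qed
    show "h x = h' x" if "?P h" "?P h'" "x \<in> carrier S" for h h' x
      by (rule Sym_linear_eq[OF module_W that(1)[THEN conjunct1] that(2)[THEN conjunct1] _ that(3)])
        (simp add: that(1,2)[THEN conjunct2, rule_format])
  qed
  have eq: "\<beta> a = D a" if "a \<in> carrier S" for a
    by (rule Sym_linear_eq[OF module_W P\<beta>[THEN conjunct1] PD[THEN conjunct1] _ that])
      (simp add: P\<beta>[THEN conjunct2, rule_format] PD[THEN conjunct2, rule_format])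
  show "?der \<beta>"
    using P\<beta>[THEN conjunct1] by (rule derivationI) (simp add: eq derivation_mult[OF D])
  show "\<beta> (\<iota> x) = pt \<one>\<^bsub>S\<^esub> (\<upsilon> x)" if "x \<in> carrier L"
    using that by (simp add: eq iota_closed D_gen)
qed

lemmas beta_linear = derivation_linear[OF beta_derivation]
lemmas beta_mult = derivation_mult[OF beta_derivation]
lemmas beta_closed = linear_map_closed[OF beta_linear]
lemmas beta_one = derivation_one[OF S.algebra_axioms module_W alpha_action beta_derivation]
lemmas alpha_linear = algebra_hom_linear[OF alpha_hom]
lemmas alpha_closed = linear_map_closed[OF alpha_linear]
lemmas alpha_mult = algebra_hom_mult[OF alpha_hom]

lemma alpha_pure: "\<lbrakk>a \<in> carrier S; u \<in> carrier U\<rbrakk> \<Longrightarrow> \<alpha> a \<otimes>\<^bsub>W\<^esub> pt \<one>\<^bsub>S\<^esub> u = pt a u"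
  by (simp add: smash_alpha_def W_mult_Sym)

lemma alpha_comm:
  "\<lbrakk>a \<in> carrier S; b \<in> carrier S\<rbrakk> \<Longrightarrow> \<alpha> a \<otimes>\<^bsub>W\<^esub> \<alpha> b = \<alpha> b \<otimes>\<^bsub>W\<^esub> \<alpha> a"
  by (simp add: alpha_mult[symmetric] S.m_comm)

text \<open>
  The commutator of \<open>\<alpha>(a)\<close> and \<open>\<beta>(b)\<close> obeys the Leibniz rule in \<open>b\<close>, because the image of \<open>\<alpha>\<close> is commutative. Hence
  it suffices to take for \<open>b\<close> a generator, and then the identity is the product rule for \<open>\<one> # x\<close>.
\<close>

lemma alpha_beta_commutator:
  assumes a: "a \<in> carrier S" and b: "b \<in> carrier S"
  shows "\<alpha> a \<otimes>\<^bsub>W\<^esub> \<beta> b = \<alpha> (pb a b) \<oplus>\<^bsub>W\<^esub> \<beta> b \<otimes>\<^bsub>W\<^esub> \<alpha> a"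
proof -
  have gen: "\<alpha> a \<otimes>\<^bsub>W\<^esub> \<beta> (\<iota> x) = \<alpha> (pb a (\<iota> x)) \<oplus>\<^bsub>W\<^esub> \<beta> (\<iota> x) \<otimes>\<^bsub>W\<^esub> \<alpha> a" if x: "x \<in> carrier L" for x
  proof -
    note i = iota_closed[OF x] and c = upsilon_closed[OF x]
    have "\<alpha> (pb a (\<iota> x)) = \<ominus>\<^bsub>W\<^esub> \<alpha> (pb (\<iota> x) a)"
      unfolding pb_skew[OF i a]
      by (rule linear_map_a_inv[OF S.module_axioms module_W alpha_linear pb_closed[OF i a]])
    moreover have "\<beta> (\<iota> x) \<otimes>\<^bsub>W\<^esub> \<alpha> a = \<alpha> (pb (\<iota> x) a) \<oplus>\<^bsub>W\<^esub> pt a (\<upsilon> x)"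
      using W_mult_gen[OF x a U.one_closed] c by (simp add: beta_gen[OF x] smash_alpha_def W_simps(3))
    moreover have "\<alpha> a \<otimes>\<^bsub>W\<^esub> \<beta> (\<iota> x) = pt a (\<upsilon> x)"
      by (simp add: beta_gen[OF x] alpha_pure a c)
    moreover have "pt a (\<upsilon> x) \<in> carrier W" using a c by (simp add: W_simps(1) pt_closed)
    ultimately show ?thesis
      using alpha_closed[OF pb_closed[OF i a]] by (simp add: W.r_neg1)
  qed
  show ?thesis
    using SA.assoc_algebra_axioms Sym_generates b
  proof (induction b rule: generates_induct)
    case one
    show ?case
      using alpha_closed[OF a] linear_map_zero[OF S.module_axioms module_W alpha_linear]
      by (simp add: beta_one pb_one a)
  next
    case (mult x b)
    then obtain y where y: "y \<in> carrier L" "x = \<iota> y" by auto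
    have g: "\<alpha> a \<otimes>\<^bsub>W\<^esub> \<beta> x = \<alpha> (pb a x) \<oplus>\<^bsub>W\<^esub> \<beta> x \<otimes>\<^bsub>W\<^esub> \<alpha> a" unfolding y(2) by (rule gen[OF y(1)])
    note c = alpha_closed[OF a] alpha_closed[OF mult(2)] alpha_closed[OF mult(3)]
      beta_closed[OF mult(2)] beta_closed[OF mult(3)]
      alpha_closed[OF pb_closed[OF a mult(2)]] alpha_closed[OF pb_closed[OF a mult(3)]]
    have comm: "\<alpha> a \<otimes>\<^bsub>W\<^esub> (\<alpha> p \<otimes>\<^bsub>W\<^esub> w) = \<alpha> p \<otimes>\<^bsub>W\<^esub> (\<alpha> a \<otimes>\<^bsub>W\<^esub> w)"
      if "p \<in> carrier S" "w \<in> carrier W" for p w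
      using that alpha_comm[OF a that(1)] alpha_closed a by (simp add: W.m_assoc[symmetric])
    have "\<alpha> a \<otimes>\<^bsub>W\<^esub> \<beta> (x \<otimes>\<^bsub>S\<^esub> b) =
        \<alpha> x \<otimes>\<^bsub>W\<^esub> (\<alpha> a \<otimes>\<^bsub>W\<^esub> \<beta> b) \<oplus>\<^bsub>W\<^esub> \<alpha> b \<otimes>\<^bsub>W\<^esub> (\<alpha> a \<otimes>\<^bsub>W\<^esub> \<beta> x)"
      using mult(2,3) c by (simp add: beta_mult W.r_distr comm)
    also have "\<dots> = (\<alpha> x \<otimes>\<^bsub>W\<^esub> \<alpha> (pb a b) \<oplus>\<^bsub>W\<^esub> \<alpha> b \<otimes>\<^bsub>W\<^esub> \<alpha> (pb a x)) \<oplus>\<^bsub>W\<^esub>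
        (\<alpha> x \<otimes>\<^bsub>W\<^esub> \<beta> b \<oplus>\<^bsub>W\<^esub> \<alpha> b \<otimes>\<^bsub>W\<^esub> \<beta> x) \<otimes>\<^bsub>W\<^esub> \<alpha> a"
      unfolding mult(4) g using c by (simp add: W.r_distr W.l_distr W.m_assoc W.a_ac)
    also have "\<dots> = \<alpha> (pb a (x \<otimes>\<^bsub>S\<^esub> b)) \<oplus>\<^bsub>W\<^esub> \<beta> (x \<otimes>\<^bsub>S\<^esub> b) \<otimes>\<^bsub>W\<^esub> \<alpha> a"
      using mult(2,3) a by (simp add: beta_mult pb_mult_right pb_closed linear_map_add[OF alpha_linear] alpha_mult)
    finally show ?case .
  next
    case (add b c)
    then show ?case
      using a alpha_closed beta_closed pb_closed
      by (simp add: linear_map_add[OF beta_linear] linear_map_add[OF alpha_linear] pb_add_right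
          W.r_distr W.l_distr W.a_ac)
  next
    case (smult r b)
    then show ?case
      using a alpha_closed beta_closed pb_closed
      by (simp add: linear_map_smult[OF beta_linear] linear_map_smult[OF alpha_linear] pb_smult_right
          W.smult_mult_left W.smult_mult_right W.smult_r_distr)
  qed
qed

lemma beta_commutator_gen:
  assumes x: "x \<in> carrier L" and y: "y \<in> carrier L"
  shows "\<beta> (\<iota> x) \<otimes>\<^bsub>W\<^esub> \<beta> (\<iota> y) = \<beta> (pb (\<iota> x) (\<iota> y)) \<oplus>\<^bsub>W\<^esub> \<beta> (\<iota> y) \<otimes>\<^bsub>W\<^esub> \<beta> (\<iota> x)"
proof -
  note b = bracket_closed[OF x y] and s = cocycle_closed[OF x y]
  note c = upsilon_closed[OF x] upsilon_closed[OF y] upsilon_closed[OF b]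
  have "\<beta> (pb (\<iota> x) (\<iota> y)) = pt \<one>\<^bsub>S\<^esub> (\<upsilon> (bracket L x y))"
    using b s c pt_closed[OF S.one_closed c(3)]
    by (simp add: pb_gen[OF x y] linear_map_add[OF beta_linear] linear_map_smult[OF beta_linear]
        iota_closed beta_gen beta_one W_simps(1))
  moreover have "\<beta> (\<iota> p) \<otimes>\<^bsub>W\<^esub> \<beta> (\<iota> q) = pt \<one>\<^bsub>S\<^esub> (\<upsilon> p \<otimes>\<^bsub>U\<^esub> \<upsilon> q)" if "p \<in> carrier L" "q \<in> carrier L" for p q
    using that by (simp add: beta_gen pt_gen_mult upsilon_closed)
  moreover have "pt \<one>\<^bsub>S\<^esub> (\<upsilon> x \<otimes>\<^bsub>U\<^esub> \<upsilon> y) =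
      pt \<one>\<^bsub>S\<^esub> (\<upsilon> (bracket L x y)) \<oplus>\<^bsub>TP\<^esub> pt \<one>\<^bsub>S\<^esub> (\<upsilon> y \<otimes>\<^bsub>U\<^esub> \<upsilon> x)"
    unfolding ULie_gen_bracket[OF L.lie_algebra_axioms x y] using c by (intro pt_add_right) simp_all
  ultimately show ?thesis using x y by (simp add: W_simps(3))
qed

text \<open>
  The commutator of \<open>\<beta>(ab)\<close> and \<open>\<beta>(c)\<close> contains, besides the Leibniz terms, commutators of \<open>\<alpha>(a)\<close> and \<open>\<alpha>(b)\<close>
  with \<open>\<beta>(c)\<close>. These are \<open>\<alpha>({a, c})\<close> and \<open>\<alpha>({b, c})\<close>, just what \<open>\<beta>\<close> of \<open>{ab, c}\<close> requires.
\<close>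

lemma beta_commutator_mult:
  assumes a: "a \<in> carrier S" and b: "b \<in> carrier S" and c: "c \<in> carrier S"
    and ac: "\<beta> a \<otimes>\<^bsub>W\<^esub> \<beta> c = \<beta> (pb a c) \<oplus>\<^bsub>W\<^esub> \<beta> c \<otimes>\<^bsub>W\<^esub> \<beta> a"
    and bc: "\<beta> b \<otimes>\<^bsub>W\<^esub> \<beta> c = \<beta> (pb b c) \<oplus>\<^bsub>W\<^esub> \<beta> c \<otimes>\<^bsub>W\<^esub> \<beta> b"
  shows "\<beta> (a \<otimes>\<^bsub>S\<^esub> b) \<otimes>\<^bsub>W\<^esub> \<beta> c = \<beta> (pb (a \<otimes>\<^bsub>S\<^esub> b) c) \<oplus>\<^bsub>W\<^esub> \<beta> c \<otimes>\<^bsub>W\<^esub> \<beta> (a \<otimes>\<^bsub>S\<^esub> b)"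
proof -
  let ?x = "pb a c" and ?y = "pb b c"
  note p = pb_closed[OF a c] pb_closed[OF b c]
  note cl = alpha_closed[OF a] alpha_closed[OF b] beta_closed[OF a] beta_closed[OF b] beta_closed[OF c]
    alpha_closed[OF p(1)] alpha_closed[OF p(2)] beta_closed[OF p(1)] beta_closed[OF p(2)]
  have move: "\<alpha> q \<otimes>\<^bsub>W\<^esub> (\<beta> c \<otimes>\<^bsub>W\<^esub> w) = \<alpha> (pb q c) \<otimes>\<^bsub>W\<^esub> w \<oplus>\<^bsub>W\<^esub> \<beta> c \<otimes>\<^bsub>W\<^esub> (\<alpha> q \<otimes>\<^bsub>W\<^esub> w)"
    if "q \<in> carrier S" "w \<in> carrier W" for q w
  proof -
    note qc = alpha_closed[OF that(1)] alpha_closed[OF pb_closed[OF that(1) c]]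
    have "\<alpha> q \<otimes>\<^bsub>W\<^esub> (\<beta> c \<otimes>\<^bsub>W\<^esub> w) = (\<alpha> q \<otimes>\<^bsub>W\<^esub> \<beta> c) \<otimes>\<^bsub>W\<^esub> w"
      using qc cl that(2) by (simp add: W.m_assoc)
    then show ?thesis
      unfolding alpha_beta_commutator[OF that(1) c] using qc cl that(2) by (simp add: W.l_distr W.m_assoc)
  qed
  have "\<beta> (a \<otimes>\<^bsub>S\<^esub> b) \<otimes>\<^bsub>W\<^esub> \<beta> c =
      \<alpha> a \<otimes>\<^bsub>W\<^esub> (\<beta> b \<otimes>\<^bsub>W\<^esub> \<beta> c) \<oplus>\<^bsub>W\<^esub> \<alpha> b \<otimes>\<^bsub>W\<^esub> (\<beta> a \<otimes>\<^bsub>W\<^esub> \<beta> c)"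
    using a b cl by (simp add: beta_mult W.l_distr W.m_assoc)
  also have "\<dots> = (\<alpha> a \<otimes>\<^bsub>W\<^esub> \<beta> ?y \<oplus>\<^bsub>W\<^esub> \<alpha> ?x \<otimes>\<^bsub>W\<^esub> \<beta> b) \<oplus>\<^bsub>W\<^esub> (\<alpha> b \<otimes>\<^bsub>W\<^esub> \<beta> ?x \<oplus>\<^bsub>W\<^esub> \<alpha> ?y \<otimes>\<^bsub>W\<^esub> \<beta> a)
      \<oplus>\<^bsub>W\<^esub> \<beta> c \<otimes>\<^bsub>W\<^esub> (\<alpha> a \<otimes>\<^bsub>W\<^esub> \<beta> b \<oplus>\<^bsub>W\<^esub> \<alpha> b \<otimes>\<^bsub>W\<^esub> \<beta> a)"
    unfolding ac bc using a b cl by (simp add: W.r_distr move W.a_ac)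
  also have "\<dots> = \<beta> (pb (a \<otimes>\<^bsub>S\<^esub> b) c) \<oplus>\<^bsub>W\<^esub> \<beta> c \<otimes>\<^bsub>W\<^esub> \<beta> (a \<otimes>\<^bsub>S\<^esub> b)"
    using a b c p cl by (simp add: pb_mult_left beta_mult linear_map_add[OF beta_linear] W.a_ac)
  finally show ?thesis .
qed

lemma beta_commutator_extend:
  assumes c: "c \<in> carrier S"
    and gen: "\<And>x. x \<in> carrier L \<Longrightarrow>
      \<beta> (\<iota> x) \<otimes>\<^bsub>W\<^esub> \<beta> c = \<beta> (pb (\<iota> x) c) \<oplus>\<^bsub>W\<^esub> \<beta> c \<otimes>\<^bsub>W\<^esub> \<beta> (\<iota> x)"
    and a: "a \<in> carrier S"
  shows "\<beta> a \<otimes>\<^bsub>W\<^esub> \<beta> c = \<beta> (pb a c) \<oplus>\<^bsub>W\<^esub> \<beta> c \<otimes>\<^bsub>W\<^esub> \<beta> a"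
  using SA.assoc_algebra_axioms Sym_generates a
proof (induction a rule: generates_induct)
  case one
  show ?case
    using beta_closed[OF c] linear_map_zero[OF S.module_axioms module_W beta_linear]
    by (simp add: beta_one pb_one c)
next
  case (mult x a)
  then obtain y where y: "y \<in> carrier L" "x = \<iota> y" by auto
  show ?case
    by (rule beta_commutator_mult[OF mult(2,3) c _ mult(4)]) (simp add: y gen)
next
  case (add a b)
  then show ?case
    using c beta_closed pb_closed
    by (simp add: linear_map_add[OF beta_linear] pb_add_left W.r_distr W.l_distr W.a_ac)
next
  case (smult r a)
  then show ?case
    using c beta_closed pb_closed
    by (simp add: linear_map_smult[OF beta_linear] pb_smult_left
        W.smult_mult_left W.smult_mult_right W.smult_r_distr)
qed

lemma beta_commutator_swap:
  assumes a: "a \<in> carrier S" and b: "b \<in> carrier S"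
    and ab: "\<beta> a \<otimes>\<^bsub>W\<^esub> \<beta> b = \<beta> (pb a b) \<oplus>\<^bsub>W\<^esub> \<beta> b \<otimes>\<^bsub>W\<^esub> \<beta> a"
  shows "\<beta> b \<otimes>\<^bsub>W\<^esub> \<beta> a = \<beta> (pb b a) \<oplus>\<^bsub>W\<^esub> \<beta> a \<otimes>\<^bsub>W\<^esub> \<beta> b"
proof -
  have "\<beta> (pb b a) = \<ominus>\<^bsub>W\<^esub> \<beta> (pb a b)"
    unfolding pb_skew[OF a b]
    by (rule linear_map_a_inv[OF S.module_axioms module_W beta_linear pb_closed[OF a b]])
  then show ?thesis
    unfolding ab using beta_closed[OF a] beta_closed[OF b] beta_closed[OF pb_closed[OF a b]]
    by (simp add: W.r_neg1)
qed

text \<open>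
  The extension from generators works in the first argument; skew-symmetry gives it in the second.
\<close>

lemma beta_commutator:
  assumes a: "a \<in> carrier S" and b: "b \<in> carrier S"
  shows "\<beta> a \<otimes>\<^bsub>W\<^esub> \<beta> b = \<beta> (pb a b) \<oplus>\<^bsub>W\<^esub> \<beta> b \<otimes>\<^bsub>W\<^esub> \<beta> a"
proof (rule beta_commutator_extend[OF b _ a])
  fix x assume x: "x \<in> carrier L"
  have "\<beta> b \<otimes>\<^bsub>W\<^esub> \<beta> (\<iota> x) = \<beta> (pb b (\<iota> x)) \<oplus>\<^bsub>W\<^esub> \<beta> (\<iota> x) \<otimes>\<^bsub>W\<^esub> \<beta> b"
    by (rule beta_commutator_extend[OF iota_closed[OF x] beta_commutator_gen[OF _ x] b])
  then show "\<beta> (\<iota> x) \<otimes>\<^bsub>W\<^esub> \<beta> b = \<beta> (pb (\<iota> x) b) \<oplus>\<^bsub>W\<^esub> \<beta> b \<otimes>\<^bsub>W\<^esub> \<beta> (\<iota> x)"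
    by (rule beta_commutator_swap[OF b iota_closed[OF x]])
qed

lemma Sym_poisson_simps:
  "carrier (Sym_poisson R L \<sigma>) = carrier S" "add (Sym_poisson R L \<sigma>) = add S"
  "mult (Sym_poisson R L \<sigma>) = mult S" "one (Sym_poisson R L \<sigma>) = one S"
  "smult (Sym_poisson R L \<sigma>) = smult S" "bracket (Sym_poisson R L \<sigma>) = pb"
  by (simp_all add: Sym_poisson_def pb_def)

lemma poisson_enveloping_pair_Sym_iff:
  assumes V: "assoc_algebra R V"
  shows "poisson_enveloping_pair R (Sym_poisson R L \<sigma>) V a' b' \<longleftrightarrow>
    algebra_hom R S V a' \<and> derivation R S V (\<lambda>a v. a' a \<otimes>\<^bsub>V\<^esub> v) b' \<and>
    (\<forall>a\<in>carrier S. \<forall>b\<in>carrier S. b' a \<otimes>\<^bsub>V\<^esub> b' b = b' (pb a b) \<oplus>\<^bsub>V\<^esub> b' b \<otimes>\<^bsub>V\<^esub> b' a) \<and>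
    (\<forall>a\<in>carrier S. \<forall>b\<in>carrier S. a' a \<otimes>\<^bsub>V\<^esub> b' b = a' (pb a b) \<oplus>\<^bsub>V\<^esub> b' b \<otimes>\<^bsub>V\<^esub> a' a)"
proof -
  have "algebra_hom R (Sym_poisson R L \<sigma>) V a' \<longleftrightarrow> algebra_hom R S V a'"
    "linear_map R (Sym_poisson R L \<sigma>) V b' \<longleftrightarrow> linear_map R S V b'"
    by (simp_all add: algebra_hom_def ring_hom_def linear_map_def Sym_poisson_simps)
  then show ?thesis
    unfolding poisson_enveloping_pair_iff[OF poisson_algebra_Sym V]
    by (simp only: Sym_poisson_simps derivation_def ball_conj_distrib conj_ac)
qed

lemma poisson_enveloping_pair_smash:
  "poisson_enveloping_pair R (Sym_poisson R L \<sigma>) W \<alpha> \<beta>"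
  unfolding poisson_enveloping_pair_Sym_iff[OF assoc_algebra_W]
  by (intro conjI ballI alpha_hom beta_derivation beta_commutator alpha_beta_commutator)

text \<open>
  A pair \<open>(\<alpha>', \<beta>')\<close> restricts on the Lie algebra to a Lie homomorphism, as \<open>\<beta>'\<close> kills the constants that
  the cocycle contributes. Its extension \<open>B\<close> to the enveloping algebra and \<open>\<alpha>'\<close> combine to \<open>a # u \<mapsto> \<alpha>'(a) B(u)\<close>.
  Multiplicativity has to be checked only for a generator as the left factor. The composite with \<open>\<beta>\<close> is \<open>\<beta>'\<close>, since
  both are derivations, and they agree on the Lie algebra.
\<close>

lemma smash_universal_exists:
  assumes V: "assoc_algebra R V" and pair: "poisson_enveloping_pair R (Sym_poisson R L \<sigma>) V a' b'"
  obtains \<gamma> where "algebra_hom R W V \<gamma>" "\<And>a. a \<in> carrier S \<Longrightarrow> \<gamma> (\<alpha> a) = a' a"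
    "\<And>a. a \<in> carrier S \<Longrightarrow> \<gamma> (\<beta> a) = b' a"
proof -
  interpret V: assoc_algebra R V by fact
  note pair' = pair[unfolded poisson_enveloping_pair_Sym_iff[OF V]]
  note hom = pair'[THEN conjunct1] and der = pair'[THEN conjunct2, THEN conjunct1]
    and bb = pair'[THEN conjunct2, THEN conjunct2, THEN conjunct1, rule_format]
    and ab = pair'[THEN conjunct2, THEN conjunct2, THEN conjunct2, rule_format]
  note al = algebra_hom_linear[OF hom] and bl = derivation_linear[OF der]
  note ac = linear_map_closed[OF al] and bc = linear_map_closed[OF bl]
  note act' = left_module_action_hom[OF SA.assoc_algebra_axioms V hom]
  have b1: "b' \<one>\<^bsub>S\<^esub> = \<zero>\<^bsub>V\<^esub>" by (rule derivation_one[OF S.algebra_axioms V.module_axioms act' der])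
  have lin: "linear_map R L V (\<lambda>x. b' (\<iota> x))" by (rule linear_map_comp[OF iota_linear bl])
  have comm: "b' (\<iota> x) \<otimes>\<^bsub>V\<^esub> b' (\<iota> y) = b' (\<iota> (bracket L x y)) \<oplus>\<^bsub>V\<^esub> b' (\<iota> y) \<otimes>\<^bsub>V\<^esub> b' (\<iota> x)"
    if x: "x \<in> carrier L" and y: "y \<in> carrier L" for x y
  proof -
    note c = iota_closed[OF x] iota_closed[OF y] iota_closed[OF bracket_closed[OF x y]]
    have "b' (pb (\<iota> x) (\<iota> y)) = b' (\<iota> (bracket L x y))"
      using c bc[OF c(3)] cocycle_closed[OF x y]
      by (simp add: pb_gen[OF x y] linear_map_add[OF bl] linear_map_smult[OF bl] b1)
    then show ?thesis using bb[OF c(1,2)] by simp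
  qed
  obtain B where B: "algebra_hom R U V B" and Bx: "\<And>x. x \<in> carrier L \<Longrightarrow> B (\<upsilon> x) = b' (\<iota> x)"
    by (rule ULie_universal[OF L.lie_algebra_axioms V lin comm]) (assumption+, rule that)
  note Bl = algebra_hom_linear[OF B]
  note Bc = linear_map_closed[OF Bl]
  note f = bilinear_map_comp[OF V.mult_bilinear al Bl]
  define \<gamma> where "\<gamma> = tensor_lift R S U V (\<lambda>a u. a' a \<otimes>\<^bsub>V\<^esub> B u)"
  have \<gamma>l: "linear_map R TP V \<gamma>"
    unfolding \<gamma>_def by (rule tensor_lift_linear[OF S.module_axioms U.module_axioms V.module_axioms f])
  have \<gamma>p: "\<gamma> (pt a u) = a' a \<otimes>\<^bsub>V\<^esub> B u" if "a \<in> carrier S" "u \<in> carrier U" for a u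
    unfolding \<gamma>_def by (rule tensor_lift_pure[OF S.module_axioms U.module_axioms V.module_axioms f that])
  note \<gamma>c = linear_map_closed[OF \<gamma>l]
  have \<gamma>W: "linear_map R W V \<gamma>" using \<gamma>l by (simp add: linear_map_def W_simps(1,3,4))
  have \<gamma>\<alpha>: "\<gamma> (\<alpha> a) = a' a" if "a \<in> carrier S" for a
    using that ac[OF that] by (simp add: smash_alpha_def \<gamma>p algebra_hom_one[OF B])
  have \<gamma>x: "\<gamma> (pt \<one>\<^bsub>S\<^esub> (\<upsilon> x)) = b' (\<iota> x)" if "x \<in> carrier L" for x
    using that bc[OF iota_closed[OF that]] by (simp add: \<gamma>p upsilon_closed Bx algebra_hom_one[OF hom])
  have mult_alpha: "\<gamma> (\<alpha> a \<otimes>\<^bsub>W\<^esub> t) = a' a \<otimes>\<^bsub>V\<^esub> \<gamma> t" if a: "a \<in> carrier S" and "t \<in> carrier TP" for a t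
    using that(2)
  proof (induction t rule: TP_induct)
    case (pure b u)
    then show ?case using a ac Bc
      by (simp add: smash_alpha_def W_mult_Sym \<gamma>p algebra_hom_mult[OF hom] V.m_assoc)
  next
    case (add s t)
    have "pt a \<one>\<^bsub>U\<^esub> \<in> carrier TP" using a by (simp add: pt_closed)
    then show ?case using add a ac \<gamma>c
      by (simp add: smash_alpha_def W_add_right W_closed linear_map_add[OF \<gamma>l] V.r_distr)
  qed
  have mult_gen: "\<gamma> (pt \<one>\<^bsub>S\<^esub> (\<upsilon> x) \<otimes>\<^bsub>W\<^esub> t) = b' (\<iota> x) \<otimes>\<^bsub>V\<^esub> \<gamma> t"
    if x: "x \<in> carrier L" and "t \<in> carrier TP" for x t
    using that(2)
  proof (induction t rule: TP_induct)
    case (pure b u)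
    note i = iota_closed[OF x] and c = upsilon_closed[OF x]
    note p = pb_closed[OF i pure(1)]
    have "\<gamma> (pt \<one>\<^bsub>S\<^esub> (\<upsilon> x) \<otimes>\<^bsub>W\<^esub> pt b u) = a' (pb (\<iota> x) b) \<otimes>\<^bsub>V\<^esub> B u \<oplus>\<^bsub>V\<^esub> a' b \<otimes>\<^bsub>V\<^esub> (b' (\<iota> x) \<otimes>\<^bsub>V\<^esub> B u)"
      using pure p c x
      by (simp add: W_mult_gen[OF x] linear_map_add[OF \<gamma>l] pt_closed \<gamma>p algebra_hom_mult[OF B] Bx)
    also have "\<dots> = (a' (pb (\<iota> x) b) \<oplus>\<^bsub>V\<^esub> a' b \<otimes>\<^bsub>V\<^esub> b' (\<iota> x)) \<otimes>\<^bsub>V\<^esub> B u"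
      using ac[OF p] ac[OF pure(1)] bc[OF i] Bc[OF pure(2)] by (simp add: V.l_distr V.m_assoc)
    also have "a' (pb (\<iota> x) b) \<oplus>\<^bsub>V\<^esub> a' b \<otimes>\<^bsub>V\<^esub> b' (\<iota> x) = b' (\<iota> x) \<otimes>\<^bsub>V\<^esub> a' b"
    proof -
      have "a' (pb b (\<iota> x)) = \<ominus>\<^bsub>V\<^esub> a' (pb (\<iota> x) b)"
        unfolding pb_skew[OF i pure(1)]
        by (rule linear_map_a_inv[OF S.module_axioms V.module_axioms al p])
      then show ?thesis
        unfolding ab[OF pure(1) i] using ac[OF p] ac[OF pure(1)] bc[OF i] by (simp add: V.r_neg2)
    qed
    also have "b' (\<iota> x) \<otimes>\<^bsub>V\<^esub> a' b \<otimes>\<^bsub>V\<^esub> B u = b' (\<iota> x) \<otimes>\<^bsub>V\<^esub> \<gamma> (pt b u)"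
      using ac[OF pure(1)] bc[OF i] Bc[OF pure(2)] pure by (simp add: \<gamma>p V.m_assoc)
    finally show ?case .
  next
    case (add s t)
    have "pt \<one>\<^bsub>S\<^esub> (\<upsilon> x) \<in> carrier TP" using upsilon_closed[OF x] by (simp add: pt_closed)
    then show ?case using add bc[OF iota_closed[OF x]] \<gamma>c
      by (simp add: W_add_right W_closed linear_map_add[OF \<gamma>l] V.r_distr)
  qed
  have mult: "\<gamma> (w \<otimes>\<^bsub>W\<^esub> t) = \<gamma> w \<otimes>\<^bsub>V\<^esub> \<gamma> t" if w: "w \<in> carrier W" and t: "t \<in> carrier W" for w t
    using assoc_algebra_W W_generates w
  proof (induction w rule: generates_induct)
    case one
    have "\<gamma> \<one>\<^bsub>W\<^esub> = \<one>\<^bsub>V\<^esub>"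
      by (simp add: W_simps(5) \<gamma>p algebra_hom_one[OF hom] algebra_hom_one[OF B])
    then show ?case using t linear_map_closed[OF \<gamma>W t] by simp
  next
    case (mult g w)
    note wt = W.m_closed[OF mult(3) t]
    have assoc: "g \<otimes>\<^bsub>W\<^esub> w \<otimes>\<^bsub>W\<^esub> t = g \<otimes>\<^bsub>W\<^esub> (w \<otimes>\<^bsub>W\<^esub> t)" by (rule W.m_assoc[OF mult(2,3) t])
    note wc = linear_map_closed[OF \<gamma>W mult(3)] and tc = linear_map_closed[OF \<gamma>W t]
    from mult(1) consider a where "a \<in> carrier S" "g = \<alpha> a" | x where "x \<in> carrier L" "g = pt \<one>\<^bsub>S\<^esub> (\<upsilon> x)"
      by blast
    then show ?case
    proof cases
      case 1
      show ?thesis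
        unfolding assoc unfolding 1(2)
        using mult_alpha[OF 1(1) wt[unfolded W_simps(1)]] mult_alpha[OF 1(1) mult(3)[unfolded W_simps(1)]]
          ac[OF 1(1)] wc tc mult(4) by (simp add: V.m_assoc)
    next
      case 2
      show ?thesis
        unfolding assoc unfolding 2(2)
        using mult_gen[OF 2(1) wt[unfolded W_simps(1)]] mult_gen[OF 2(1) mult(3)[unfolded W_simps(1)]]
          bc[OF iota_closed[OF 2(1)]] wc tc mult(4) by (simp add: V.m_assoc)
    qed
  next
    case (add v w)
    then show ?case using t linear_map_closed[OF \<gamma>W]
      by (simp add: W.l_distr linear_map_add[OF \<gamma>W] V.l_distr)
  next
    case (smult r w)
    then show ?case using t linear_map_closed[OF \<gamma>W]
      by (simp add: W.smult_mult_left linear_map_smult[OF \<gamma>W] V.smult_mult_left)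
  qed
  have \<gamma>_hom: "algebra_hom R W V \<gamma>"
    by (rule algebra_homI[OF \<gamma>W _ mult])
      (simp_all add: W_simps(5) \<gamma>p algebra_hom_one[OF hom] algebra_hom_one[OF B])
  have "derivation R S V (\<lambda>a v. a' a \<otimes>\<^bsub>V\<^esub> v) (\<lambda>a. \<gamma> (\<beta> a))"
  proof (rule derivationI[OF linear_map_comp[OF beta_linear \<gamma>W]])
    fix a b assume a: "a \<in> carrier S" and b: "b \<in> carrier S"
    show "\<gamma> (\<beta> (a \<otimes>\<^bsub>S\<^esub> b)) = a' a \<otimes>\<^bsub>V\<^esub> \<gamma> (\<beta> b) \<oplus>\<^bsub>V\<^esub> a' b \<otimes>\<^bsub>V\<^esub> \<gamma> (\<beta> a)"
      using a b by (simp add: beta_mult linear_map_add[OF \<gamma>W] alpha_closed beta_closed mult \<gamma>\<alpha>)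
  qed
  then have "\<gamma> (\<beta> a) = b' a" if "a \<in> carrier S" for a
    by (rule derivation_eq[OF S.algebra_axioms V.module_axioms act' Sym_generates _ der _ that])
      (auto simp: beta_gen \<gamma>x)
  with \<gamma>_hom \<gamma>\<alpha> show thesis by (rule that)
qed

lemma smash_universal_unique:
  assumes f: "algebra_hom R W V f" and g: "algebra_hom R W V g"
    and \<alpha>: "\<And>a. a \<in> carrier S \<Longrightarrow> f (\<alpha> a) = g (\<alpha> a)"
    and \<beta>: "\<And>a. a \<in> carrier S \<Longrightarrow> f (\<beta> a) = g (\<beta> a)"
    and w: "w \<in> carrier W"
  shows "f w = g w"
proof (rule algebra_hom_unique[OF assoc_algebra_W W_generates f g _ w])
  fix x assume "x \<in> \<alpha> ` carrier S \<union> (\<lambda>x. pt \<one>\<^bsub>S\<^esub> (\<upsilon> x)) ` carrier L"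
  then consider a where "a \<in> carrier S" "x = \<alpha> a" | y where "y \<in> carrier L" "x = pt \<one>\<^bsub>S\<^esub> (\<upsilon> y)"
    by blast
  then show "f x = g x"
  proof cases
    case 1 then show ?thesis by (simp add: \<alpha>)
  next
    case 2 then show ?thesis using \<beta>[OF iota_closed[OF 2(1)]] by (simp add: beta_gen)
  qed
qed

lemma poisson_enveloping_algebra_smash:
  "poisson_enveloping_algebra TYPE('v) R (Sym_poisson R L \<sigma>) W \<alpha> \<beta>"
  unfolding poisson_enveloping_algebra_def
proof (intro conjI allI impI)
  show "poisson_algebra R (Sym_poisson R L \<sigma>)" by (rule poisson_algebra_Sym)
  show "assoc_algebra R W" by (rule assoc_algebra_W)
  show "poisson_enveloping_pair R (Sym_poisson R L \<sigma>) W \<alpha> \<beta>" by (rule poisson_enveloping_pair_smash)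
  fix V :: "('r, 'v) module" and a' b'
  assume "assoc_algebra R V \<and> poisson_enveloping_pair R (Sym_poisson R L \<sigma>) V a' b'"
  then have V: "assoc_algebra R V" and pair: "poisson_enveloping_pair R (Sym_poisson R L \<sigma>) V a' b'"
    by auto
  obtain \<gamma> where \<gamma>: "algebra_hom R W V \<gamma>" and \<gamma>\<alpha>: "\<And>a. a \<in> carrier S \<Longrightarrow> \<gamma> (\<alpha> a) = a' a"
    and \<gamma>\<beta>: "\<And>a. a \<in> carrier S \<Longrightarrow> \<gamma> (\<beta> a) = b' a"
    by (rule smash_universal_exists[OF V pair]) (rule that)
  let ?\<gamma> = "restrict \<gamma> (carrier W)"
  have \<gamma>E: "?\<gamma> \<in> carrier W \<rightarrow>\<^sub>E carrier V"
    using linear_map_closed[OF algebra_hom_linear[OF \<gamma>]] by auto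
  have hom: "algebra_hom R W V ?\<gamma>" by (rule algebra_hom_cong[OF assoc_algebra_W \<gamma>]) simp
  show "\<exists>!\<gamma>. \<gamma> \<in> carrier W \<rightarrow>\<^sub>E carrier V \<and> algebra_hom R W V \<gamma> \<and>
      (\<forall>a\<in>carrier (Sym_poisson R L \<sigma>). \<gamma> (\<alpha> a) = a' a) \<and>
      (\<forall>a\<in>carrier (Sym_poisson R L \<sigma>). \<gamma> (\<beta> a) = b' a)"
    unfolding Sym_poisson_simps(1)
  proof (rule ex1I[of _ ?\<gamma>])
    show "?\<gamma> \<in> carrier W \<rightarrow>\<^sub>E carrier V \<and> algebra_hom R W V ?\<gamma> \<and>
        (\<forall>a\<in>carrier S. ?\<gamma> (\<alpha> a) = a' a) \<and> (\<forall>a\<in>carrier S. ?\<gamma> (\<beta> a) = b' a)"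
      using \<gamma>E hom by (simp add: \<gamma>\<alpha> \<gamma>\<beta> alpha_closed beta_closed)
    fix \<delta> assume \<delta>: "\<delta> \<in> carrier W \<rightarrow>\<^sub>E carrier V \<and> algebra_hom R W V \<delta> \<and>
        (\<forall>a\<in>carrier S. \<delta> (\<alpha> a) = a' a) \<and> (\<forall>a\<in>carrier S. \<delta> (\<beta> a) = b' a)"
    show "\<delta> = ?\<gamma>"
    proof (rule PiE_ext[OF \<delta>[THEN conjunct1] \<gamma>E])
      fix w assume w: "w \<in> carrier W"
      have "\<delta> w = \<gamma> w"
        by (rule smash_universal_unique[OF \<delta>[THEN conjunct2, THEN conjunct1] \<gamma> _ _ w])
          (simp_all add: \<delta> \<gamma>\<alpha> \<gamma>\<beta>)
      then show "\<delta> w = ?\<gamma> w" using w by simp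
    qed
  qed
qed

end

theorem proposition2p10:
  fixes R :: "('r, 'e) ring_scheme"
    and \<gg> :: "('r, 'g) lie"
    and \<sigma> :: "'g \<Rightarrow> 'g \<Rightarrow> 'r"
  assumes "cring R"
    and "lie_algebra R \<gg>"
    and "two_cocycle R \<gg> \<sigma>"
  shows "poisson_enveloping_algebra TYPE('v) R (Sym_poisson R \<gg> \<sigma>)
           (Sym_smash_ULie R \<gg> \<sigma>) (smash_alpha R \<gg>) (smash_beta R \<gg> \<sigma>)"
proof -
  interpret lie_cocycle R \<gg> \<sigma>
    using assms by (intro lie_cocycle.intro lie_cocycle_axioms.intro)
  show ?thesis using poisson_enveloping_algebra_smash unfolding \<beta>_def .
qed

end
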